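(* A Banach space admits a Good Finite Dimensional Approximation (GFDA) if and only if it is isomorphic to a separable dual space.
   Context: Banach spaces are over the real numbers; "isomorphic" means linearly homeomorphic. A separable dual space is a separable Banach space which is the dual space of some Banach space. A standard inverse system $\{(W_i,\theta_i)\}_{i\ge 1}$ is a sequence of finite dimensional Banach spaces $W_i$ together with linear maps $\theta_i:W_{i+1}\to W_i$ of norm $\le 1$. Its inverse limit $\varprojlim W_i$ is the vector space of all $(w_i)\in\prod_i W_i$ with $\theta_i(w_{i+1})=w_i$ for all $i$ and $\sup_i\|w_i\|<\infty$, equipped with the norm $\|(w_i)\|=\lim_{j\to\infty}\|w_j\|$. The projection $\pi_j:\varprojlim W_i\to W_j$ is $\pi_j((w_i))=w_j$. Let $V\subset\varprojlim W_i$ be a closed subspace (with the induced norm). The pair $(\varprojlim W_i,V)$ has the Determining Property if every sequence $\{v_k\}\subset V$ satisfying the following three conditions converges strongly (i.e. in norm): (a) for every $j$ the sequence $\{\pi_j(v_k)\}_k$ converges in $W_j$; (b) $\{\|v_k\|\}$ is bounded; (c) the convergence $\|\pi_j(v_k)\|\to\|v_k\|$ as $j\to\infty$ is uniform in $k$. A quotient map of normed spaces is a surjective linear map $\pi:A\to B$ such that $\|b\|=\inf\{\|a\| : a\in\pi^{-1}(b)\}$ for every $b\in B$. A Good Finite Dimensional Approximation (GFDA) of a Banach space $V$ is a pair $(\varprojlim W_i,V)$, where $\{(W_i,\theta_i)\}$ is a standard inverse system and $V$ is a closed subspace of $\varprojlim W_i$, such that the pair has the Determining Property and $\pi_i|_V:V\to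 W_i$ is a quotient map for every $i$. A Banach space admits a GFDA if it has one. *)

theory Defs
  imports "HOL-Analysis.Analysis" "HOL-Library.Function_Algebras" "HOL-Library.Equipollence"
begin

text \<open>
  Spaces that occur under an existential quantifier cannot be represented by type classes.  Such a
  normed space is given by a linear subspace \<open>X\<close> of a real vector space type together with a norm
  \<open>N\<close>, whose values outside \<open>X\<close> are irrelevant.  Spaces of functions (dual spaces, inverse limits)
  use the pointwise vector space structure on function types.
\<close>

instantiation "fun" :: (type, real_vector) real_vector
begin

definition scaleR_fun_def: "scaleR c f = (\<lambda>x. c *\<^sub>R f x)"

instance
  by standard (auto simp: scaleR_fun_def plus_fun_def fun_eq_iff scaleR_add_right scaleR_add_left)

end


section \<open>Normed spaces on a carrier\<close>

definition normed_on :: "'a::real_vector set \<Rightarrow> ('a \<Rightarrow> real) \<Rightarrow> bool" where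
  "normed_on X N \<longleftrightarrow> subspace X \<and>
     (\<forall>x\<in>X. 0 \<le> N x \<and> (N x = 0 \<longleftrightarrow> x = 0)) \<and>
     (\<forall>c. \<forall>x\<in>X. N (c *\<^sub>R x) = \<bar>c\<bar> * N x) \<and>
     (\<forall>x\<in>X. \<forall>y\<in>X. N (x + y) \<le> N x + N y)"

text \<open>The locale \<open>Metric_space\<close> asks for symmetry and nonnegativity on the whole type, hence the
  value 0 off the carrier.\<close>

definition norm_dist :: "'a::real_vector set \<Rightarrow> ('a \<Rightarrow> real) \<Rightarrow> 'a \<Rightarrow> 'a \<Rightarrow> real" where
  "norm_dist X N x y = (if x \<in> X \<and> y \<in> X then N (x - y) else 0)"

definition norm_topology :: "'a::real_vector set \<Rightarrow> ('a \<Rightarrow> real) \<Rightarrow> 'a topology" where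
  "norm_topology X N = Metric_space.mtopology X (norm_dist X N)"

definition banach_on :: "'a::real_vector set \<Rightarrow> ('a \<Rightarrow> real) \<Rightarrow> bool" where
  "banach_on X N \<longleftrightarrow> normed_on X N \<and> Metric_space.mcomplete X (norm_dist X N)"

definition linear_on :: "'a::real_vector set \<Rightarrow> ('a \<Rightarrow> 'b::real_vector) \<Rightarrow> bool" where
  "linear_on X f \<longleftrightarrow>
     (\<forall>x\<in>X. \<forall>y\<in>X. f (x + y) = f x + f y) \<and> (\<forall>c. \<forall>x\<in>X. f (c *\<^sub>R x) = c *\<^sub>R f x)"

definition isomorphic_on ::
    "'a::real_vector set \<Rightarrow> ('a \<Rightarrow> real) \<Rightarrow> 'b::real_vector set \<Rightarrow> ('b \<Rightarrow> real) \<Rightarrow> bool" where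
  "isomorphic_on X N Y M \<longleftrightarrow>
     (\<exists>T. linear_on X T \<and> homeomorphic_map (norm_topology X N) (norm_topology Y M) T)"

definition norm_quotient_map ::
    "'a::real_vector set \<Rightarrow> ('a \<Rightarrow> real) \<Rightarrow> 'b::real_vector set \<Rightarrow> ('b \<Rightarrow> real) \<Rightarrow> ('a \<Rightarrow> 'b) \<Rightarrow> bool" where
  "norm_quotient_map A N B M p \<longleftrightarrow>
     linear_on A p \<and> p ` A = B \<and> (\<forall>b\<in>B. M b = (INF a\<in>{a\<in>A. p a = b}. N a))"


section \<open>Dual spaces\<close>

text \<open>Functionals on \<open>Y\<close> are made unique as functions by the value 0 outside \<open>Y\<close>.\<close>

definition dual_space :: "'a::real_vector set \<Rightarrow> ('a \<Rightarrow> real) \<Rightarrow> ('a \<Rightarrow> real) set" where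
  "dual_space Y N =
     {f. linear_on Y f \<and> (\<exists>C. \<forall>y\<in>Y. \<bar>f y\<bar> \<le> C * N y) \<and> (\<forall>y. y \<notin> Y \<longrightarrow> f y = 0)}"

definition dual_norm :: "'a::real_vector set \<Rightarrow> ('a \<Rightarrow> real) \<Rightarrow> ('a \<Rightarrow> real) \<Rightarrow> real" where
  "dual_norm Y N f = (SUP y\<in>{y\<in>Y. N y \<le> 1}. \<bar>f y\<bar>)"

text \<open>The argument of type \<open>'u itself\<close>, here and below, is the type whose subspaces the
  existential quantifiers range over.\<close>

definition isomorphic_to_separable_dual ::
    "'u::real_vector itself \<Rightarrow> 'v::real_vector set \<Rightarrow> ('v \<Rightarrow> real) \<Rightarrow> bool" where
  "isomorphic_to_separable_dual u V N \<longleftrightarrow>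
     (\<exists>(Y::'u set) M. banach_on Y M \<and>
        separable_space (norm_topology (dual_space Y M) (dual_norm Y M)) \<and>
        isomorphic_on V N (dual_space Y M) (dual_norm Y M))"


section \<open>Inverse systems\<close>

definition standard_inverse_system ::
    "(nat \<Rightarrow> 'w::real_vector set) \<Rightarrow> (nat \<Rightarrow> 'w \<Rightarrow> real) \<Rightarrow> (nat \<Rightarrow> 'w \<Rightarrow> 'w) \<Rightarrow> bool" where
  "standard_inverse_system W N \<theta> \<longleftrightarrow>
     (\<forall>i. banach_on (W i) (N i) \<and> (\<exists>B. finite B \<and> span B = W i)) \<and>
     (\<forall>i. linear_on (W (Suc i)) (\<theta> i) \<and> \<theta> i \<in> W (Suc i) \<rightarrow> W i \<and>
          (\<forall>w\<in>W (Suc i). N i (\<theta> i w) \<le> N (Suc i) w))"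

definition inverse_limit ::
    "(nat \<Rightarrow> 'w::real_vector set) \<Rightarrow> (nat \<Rightarrow> 'w \<Rightarrow> real) \<Rightarrow> (nat \<Rightarrow> 'w \<Rightarrow> 'w) \<Rightarrow> (nat \<Rightarrow> 'w) set" where
  "inverse_limit W N \<theta> =
     {w. (\<forall>i. w i \<in> W i) \<and> (\<forall>i. \<theta> i (w (Suc i)) = w i) \<and> bdd_above (range (\<lambda>i. N i (w i)))}"

definition limit_norm :: "(nat \<Rightarrow> 'w \<Rightarrow> real) \<Rightarrow> (nat \<Rightarrow> 'w) \<Rightarrow> real" where
  "limit_norm N w = lim (\<lambda>j. N j (w j))"

definition determining_property ::
    "(nat \<Rightarrow> 'w::real_vector set) \<Rightarrow> (nat \<Rightarrow> 'w \<Rightarrow> real) \<Rightarrow> (nat \<Rightarrow> 'w) set \<Rightarrow> bool" where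
  "determining_property W N V \<longleftrightarrow>
     (\<forall>v::nat \<Rightarrow> nat \<Rightarrow> 'w.
        range v \<subseteq> V \<and>
        (\<forall>j. \<exists>l. limitin (norm_topology (W j) (N j)) (\<lambda>k. v k j) l sequentially) \<and>
        bdd_above (range (\<lambda>k. limit_norm N (v k))) \<and>
        uniform_limit UNIV (\<lambda>j k. N j (v k j)) (\<lambda>k. limit_norm N (v k)) sequentially
        \<longrightarrow> (\<exists>l. limitin (norm_topology V (limit_norm N)) v l sequentially))"

definition GFDA ::
    "(nat \<Rightarrow> 'w::real_vector set) \<Rightarrow> (nat \<Rightarrow> 'w \<Rightarrow> real) \<Rightarrow> (nat \<Rightarrow> 'w \<Rightarrow> 'w) \<Rightarrow> (nat \<Rightarrow> 'w) set \<Rightarrow> bool" where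
  "GFDA W N \<theta> V \<longleftrightarrow>
     standard_inverse_system W N \<theta> \<and>
     subspace V \<and> closedin (norm_topology (inverse_limit W N \<theta>) (limit_norm N)) V \<and>
     determining_property W N V \<and>
     (\<forall>i. norm_quotient_map V (limit_norm N) (W i) (N i) (\<lambda>w. w i))"

text \<open>A Banach space is identified with a closed subspace of an inverse limit by a linear
  homeomorphism.  Isometric identification would be too strict: a space with an isometric GFDA is
  isometrically a dual space, whereas every nonreflexive dual space has an equivalent norm that is
  not a dual norm.\<close>

definition admits_GFDA ::
    "'u::real_vector itself \<Rightarrow> 'v::real_vector set \<Rightarrow> ('v \<Rightarrow> real) \<Rightarrow> bool" where
  "admits_GFDA u V M \<longleftrightarrow>
     (\<exists>(W::nat \<Rightarrow> 'u set) N \<theta> U. GFDA W N \<theta> U \<and> isomorphic_on V M U (limit_norm N))"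

text \<open>Finite dimensional spaces and separable Banach spaces have Hamel dimension at most the
  cardinality of the reals, and so do the preduals of separable duals, which are separable.  A real
  vector space type meeting the following condition therefore contains a linear copy of every space
  that is relevant for the existential quantifiers above, and enlarging the type does not matter.\<close>

definition has_continuum_dimension :: "'u::real_vector itself \<Rightarrow> bool" where
  "has_continuum_dimension u \<longleftrightarrow> (\<exists>B::'u set. independent B \<and> (UNIV::real set) \<lesssim> B)"

lemma has_continuum_dimension_real_fun: "has_continuum_dimension TYPE(real \<Rightarrow> real)"
proof -
  define d :: "real \<Rightarrow> real \<Rightarrow> real" where "d t = (\<lambda>x. if x = t then 1 else 0)" for t
  have inj: "inj d"
    by (rule injI) (metis d_def zero_neq_one)
  have sub: "subspace {f :: real \<Rightarrow> real. f t = 0}" for t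
    by (auto simp: subspace_def scaleR_fun_def)
  have "independent (range d)"
    unfolding dependent_def
  proof safe
    fix t assume "d t \<in> span (range d - {d t})"
    moreover have "range d - {d t} \<subseteq> {f. f t = 0}"
      by (auto simp: d_def)
    ultimately have "d t \<in> {f. f t = 0}"
      using span_minimal[OF _ sub] by blast
    then show False
      by (simp add: d_def)
  qed
  moreover have "(UNIV::real set) \<lesssim> range d"
    using inj by (auto simp: lepoll_def)
  ultimately show ?thesis
    unfolding has_continuum_dimension_def by blast
qed

end

theory Submission
  imports Defs
begin

text \<open>
  The Determining Property is a form of the weak-star Kadec--Klee property, which every separable dual has
  in a suitable equivalent dual norm; conversely, with quotient maps it makes the space equal to the inverse
  limit, which is the dual of the direct limit of the duals.

  \<^bold>\<open>From a separable dual to a GFDA.\<close>  Let \<open>V\<close> be isomorphic to a separable dual of \<open>Y\<close>.  Choose a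
  dense sequence \<open>d n\<close> in \<open>V\<close> and a vector in the unit ball of \<open>Y\<close> on which \<open>d n\<close> attains at least half
  of its norm; evaluation there is a functional \<open>e n\<close> on \<open>V\<close>.  The \<open>e n\<close> norm \<open>V\<close> up to a constant, and
  every bounded sequence on which all \<open>e n\<close> converge has a limit in the topology of the \<open>e n\<close>.  These
  properties, collected in the locale \<open>coordinate_dual\<close>, are all that is used of the predual.  The
  norm \<open>kk_norm\<close>, the sum of \<open>sup\<^sub>i \<bar>e i x\<bar>\<close> and of the weighted distances from \<open>x\<close> to the lines through
  the \<open>d n\<close>, is lower semicontinuous for the convergence of all \<open>e i\<close>, and a sequence that converges in
  this sense without loss of \<open>kk_norm\<close> converges strongly (\<open>kk_norm_Kadec_Klee\<close>).  Let \<open>W j\<close> be the space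
  of values of the first \<open>j\<close> functionals, with the quotient norm.  The projections of \<open>V\<close> to \<open>W j\<close> are
  quotient maps by construction; lower semicontinuity says that the norms of the projections increase to
  \<open>kk_norm\<close>, so that \<open>V\<close> embeds isometrically into the inverse limit; and the Determining Property is the
  Kadec--Klee property, because the uniform convergence of the norms of projections transports the convergence of
  the norms in each \<open>W j\<close> to the limit norm (\<open>determining_property_S\<close>).

  \<^bold>\<open>From a GFDA to a separable dual.\<close>  Let \<open>U\<close> be the subspace of the inverse limit of the \<open>W i\<close>.  A
  point of the limit is approximated coordinatewise by almost isometric lifts to \<open>U\<close> of its entries, and
  the Determining Property applies to these lifts; so \<open>U\<close> is the whole inverse limit (\<open>L_eq_U\<close>).  The same criterion shows
  that \<open>U\<close> is separable: the coordinates of \<open>v\<close> in all \<open>W i\<close> together with moduli of convergence of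
  \<open>N j (v j)\<close> embed \<open>U\<close> into a countable product of real lines, and convergence of these data implies convergence in
  norm (\<open>countable_dense_subset\<close>).  The predual is the closed span, in the dual of \<open>V\<close>, of the
  functionals that factor through some \<open>W i\<close>.  Since \<open>W i\<close> is reflexive, a functional on the predual
  yields a compatible bounded sequence of points of the \<open>W i\<close>, that is, a point of the inverse limit and
  hence of \<open>V\<close> (\<open>linear_functional_on_predual\<close>).  By separability of \<open>V\<close>, the predual has at most the cardinality of
  the reals, and therefore it embeds linearly into any type of continuum dimension.
\<close>

section \<open>Normed spaces on a carrier\<close>

lemma normed_onD:
  assumes "normed_on X N"
  shows normed_on_subspace: "subspace X"
    and normed_on_nonneg: "x \<in> X \<Longrightarrow> 0 \<le> N x"
    and normed_on_eq_0: "x \<in> X \<Longrightarrow> N x = 0 \<longleftrightarrow> x = 0"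
    and normed_on_scale: "x \<in> X \<Longrightarrow> N (c *\<^sub>R x) = \<bar>c\<bar> * N x"
    and normed_on_triangle: "x \<in> X \<Longrightarrow> y \<in> X \<Longrightarrow> N (x + y) \<le> N x + N y"
  using assms by (auto simp: normed_on_def)

lemma normed_on_uminus: "normed_on X N \<Longrightarrow> x \<in> X \<Longrightarrow> N (- x) = N x"
  using normed_on_scale[of X N x "-1"] by simp

lemma normed_on_minus:
  assumes "normed_on X N" "x \<in> X" "y \<in> X"
  shows "N (x - y) \<le> N x + N y" "N (x - y) = N (y - x)" "\<bar>N x - N y\<bar> \<le> N (x - y)"
proof -
  note S = normed_on_subspace[OF assms(1)]
  show 1: "N (x - y) \<le> N x + N y"
    using normed_on_triangle[OF assms(1,2), of "-y"] normed_on_uminus[OF assms(1,3)]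
      subspace_neg[OF S assms(3)] by simp
  show 2: "N (x - y) = N (y - x)"
    using normed_on_uminus[OF assms(1) subspace_diff[OF S assms(2,3)]] by simp
  have 3: "N x - N y \<le> N (x - y)"
    using normed_on_triangle[OF assms(1) subspace_diff[OF S assms(2,3)] assms(3)] by simp
  show "\<bar>N x - N y\<bar> \<le> N (x - y)"
    using normed_on_triangle[OF assms(1) subspace_diff[OF S assms(3,2)] assms(2)] 2 3 by simp
qed

lemma normed_on_sum:
  assumes "normed_on X N" "\<And>i. i \<in> I \<Longrightarrow> f i \<in> X"
  shows "N (sum f I) \<le> (\<Sum>i\<in>I. N (f i))"
  using assms(2)
proof (induction I rule: infinite_finite_induct)
  case (insert i I)
  have "sum f I \<in> X"
    using insert by (intro subspace_sum[OF normed_on_subspace[OF assms(1)]]) auto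
  then show ?case
    using insert normed_on_triangle[OF assms(1), of "f i" "sum f I"] by fastforce
qed (use normed_on_eq_0[OF assms(1), of 0] subspace_0[OF normed_on_subspace[OF assms(1)]] in auto)

lemma normed_on_subset: "normed_on X N \<Longrightarrow> subspace Y \<Longrightarrow> Y \<subseteq> X \<Longrightarrow> normed_on Y N"
  unfolding normed_on_def by (meson subsetD)

lemma normed_on_Metric_space:
  assumes "normed_on X N"
  shows "Metric_space X (norm_dist X N)"
proof -
  note S = normed_on_subspace[OF assms]
  have "N (x - z) \<le> N (x - y) + N (y - z)" if "x \<in> X" "y \<in> X" "z \<in> X" for x y z
    using normed_on_triangle[OF assms, of "x - y" "y - z"] that subspace_diff[OF S] by simp
  then show ?thesis
    using normed_on_minus(2)[OF assms] normed_on_nonneg[OF assms] normed_on_eq_0[OF assms]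
      subspace_diff[OF S]
    by unfold_locales (auto simp: norm_dist_def)
qed

lemma topspace_norm_topology: "normed_on X N \<Longrightarrow> topspace (norm_topology X N) = X"
  unfolding norm_topology_def
  by (rule Metric_space.topspace_mtopology[OF normed_on_Metric_space])

lemma limitin_norm_topology:
  assumes "normed_on X N"
  shows "limitin (norm_topology X N) f l F \<longleftrightarrow>
           l \<in> X \<and> (\<forall>\<epsilon>>0. \<forall>\<^sub>F k in F. f k \<in> X \<and> N (f k - l) < \<epsilon>)"
proof -
  have "(f k \<in> X \<and> norm_dist X N (f k) l < \<epsilon>) = (f k \<in> X \<and> N (f k - l) < \<epsilon>)"
    if "l \<in> X" for k \<epsilon>
    using that by (auto simp: norm_dist_def)
  then show ?thesis
    unfolding norm_topology_def Metric_space.limitin_metric[OF normed_on_Metric_space[OF assms]]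
    by (cases "l \<in> X") auto
qed

lemma limitin_norm_topology_tendsto:
  assumes "normed_on X N" "\<And>k. f k \<in> X" "l \<in> X"
  shows "limitin (norm_topology X N) f l F \<longleftrightarrow> ((\<lambda>k. N (f k - l)) \<longlongrightarrow> 0) F"
  using assms normed_on_nonneg[OF assms(1)] subspace_diff[OF normed_on_subspace[OF assms(1)]]
  by (auto simp: limitin_norm_topology[OF assms(1)] tendsto_iff)

lemma banach_onI:
  assumes "normed_on X N"
    and "\<And>s. range s \<subseteq> X \<Longrightarrow> (\<And>e. e > 0 \<Longrightarrow> \<exists>n0. \<forall>m\<ge>n0. \<forall>n\<ge>n0. N (s m - s n) < e) \<Longrightarrow>
           \<exists>l\<in>X. (\<lambda>k. N (s k - l)) \<longlonglongrightarrow> 0"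
  shows "banach_on X N"
proof -
  interpret Metric_space X "norm_dist X N"
    by (rule normed_on_Metric_space[OF assms(1)])
  have "\<exists>l. limitin mtopology s l sequentially" if Cau: "MCauchy s" for s
  proof -
    have s: "range s \<subseteq> X"
      using Cau by (auto simp: MCauchy_def)
    have "\<exists>l\<in>X. (\<lambda>k. N (s k - l)) \<longlonglongrightarrow> 0"
    proof (rule assms(2)[OF s])
      fix e :: real assume "e > 0"
      then obtain n0 where n0: "\<forall>n n'. n0 \<le> n \<longrightarrow> n0 \<le> n' \<longrightarrow> norm_dist X N (s n) (s n') < e"
        using Cau unfolding MCauchy_def by blast
      have "s n \<in> X" for n using s by auto
      then show "\<exists>n0. \<forall>m\<ge>n0. \<forall>n\<ge>n0. N (s m - s n) < e"
        using n0 by (auto simp: norm_dist_def)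
    qed
    then obtain l where "l \<in> X" "(\<lambda>k. N (s k - l)) \<longlonglongrightarrow> 0" by blast
    moreover have "s n \<in> X" for n using s by auto
    ultimately have "limitin (norm_topology X N) s l sequentially"
      by (subst limitin_norm_topology_tendsto[OF assms(1)]) auto
    then show ?thesis
      unfolding norm_topology_def by blast
  qed
  then show ?thesis
    using assms(1) by (simp add: banach_on_def mcomplete_def)
qed

lemma linear_onD:
  assumes "linear_on X T" "subspace X"
  shows linear_on_add: "x \<in> X \<Longrightarrow> y \<in> X \<Longrightarrow> T (x + y) = T x + T y"
    and linear_on_scale: "x \<in> X \<Longrightarrow> T (c *\<^sub>R x) = c *\<^sub>R T x"
    and linear_on_0: "T 0 = 0"
    and linear_on_diff: "x \<in> X \<Longrightarrow> y \<in> X \<Longrightarrow> T (x - y) = T x - T y"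
proof -
  show a: "T (x + y) = T x + T y" if "x \<in> X" "y \<in> X" for x y
    using assms that by (auto simp: linear_on_def)
  show b: "T (c *\<^sub>R x) = c *\<^sub>R T x" if "x \<in> X" for x c
    using assms that by (auto simp: linear_on_def)
  show "T 0 = 0"
    using b[of 0 0] subspace_0[OF assms(2)] by simp
  show "T (x - y) = T x - T y" if "x \<in> X" "y \<in> X" for x y
    using a[of x "-y"] b[of y "-1"] that subspace_neg[OF assms(2)] by simp
qed

lemma linear_on_inverse:
  assumes T: "linear_on X T" and S: "subspace X"
    and gX: "\<And>y. y \<in> Y \<Longrightarrow> g y \<in> X" and Tg: "\<And>y. y \<in> Y \<Longrightarrow> T (g y) = y"
    and gT: "\<And>x. x \<in> X \<Longrightarrow> g (T x) = x"
  shows "linear_on Y g"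
  unfolding linear_on_def
proof (intro conjI ballI allI)
  fix x y assume xy: "x \<in> Y" "y \<in> Y"
  have "g (x + y) = g (T (g x) + T (g y))" using Tg xy by simp
  also have "\<dots> = g (T (g x + g y))"
    using linear_on_add[OF T S] gX xy by simp
  also have "\<dots> = g x + g y" using gT subspace_add[OF S] gX xy by simp
  finally show "g (x + y) = g x + g y" .
next
  fix c :: real and x assume x: "x \<in> Y"
  have "g (c *\<^sub>R x) = g (T (c *\<^sub>R g x))"
    using linear_on_scale[OF T S] gX x Tg by simp
  also have "\<dots> = c *\<^sub>R g x" using gT subspace_scale[OF S] gX x by simp
  finally show "g (c *\<^sub>R x) = c *\<^sub>R g x" .
qed

lemma linear_on_UNIV: "linear_on UNIV T \<longleftrightarrow> linear T"
  by (auto simp: linear_on_def linear_iff)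

lemma linear_imp_linear_on: "linear T \<Longrightarrow> linear_on X T"
  by (auto simp: linear_on_def linear_iff)

lemma normed_on_UNIV: "normed_on (UNIV :: 'a::real_normed_vector set) norm"
  by (auto simp: normed_on_def norm_triangle_ineq)

lemma norm_topology_UNIV: "norm_topology (UNIV :: 'a::real_normed_vector set) norm = euclidean"
proof -
  have "norm_dist (UNIV :: 'a set) norm = dist"
    by (auto simp: norm_dist_def dist_norm fun_eq_iff)
  then show ?thesis
    by (simp add: norm_topology_def)
qed

text \<open>
  Both spaces are carriers, so the topological
  notion of isomorphism reduces, in the next lemma, to a two-sided norm estimate, the only form used later.
\<close>

lemma continuous_map_norm_topology:
  assumes N: "normed_on X N" and M: "normed_on Y M" and T: "linear_on X T"
  shows "continuous_map (norm_topology X N) (norm_topology Y M) T \<longleftrightarrow>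
           T \<in> X \<rightarrow> Y \<and> (\<exists>C>0. \<forall>x\<in>X. M (T x) \<le> C * N x)" (is "?l \<longleftrightarrow> ?r")
proof
  interpret X: Metric_space X "norm_dist X N" by (rule normed_on_Metric_space[OF N])
  interpret Y: Metric_space Y "norm_dist Y M" by (rule normed_on_Metric_space[OF M])
  note S = normed_on_subspace[OF N]
  note T0 = linear_onD[OF T S]
  have eq: "?l \<longleftrightarrow> T \<in> X \<rightarrow> Y \<and>
     (\<forall>a\<in>X. \<forall>\<epsilon>>0. \<exists>\<delta>>0. \<forall>x. x \<in> X \<and> norm_dist X N a x < \<delta> \<longrightarrow> norm_dist Y M (T a) (T x) < \<epsilon>)"
    unfolding norm_topology_def
    by (subst X.metric_continuous_map[OF Y.Metric_space_axioms]) auto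
  { assume ?l
    then have TY: "T \<in> X \<rightarrow> Y" using eq by blast
    obtain d where d: "d > 0"
       "\<And>x. x \<in> X \<Longrightarrow> norm_dist X N 0 x < d \<Longrightarrow> norm_dist Y M (T 0) (T x) < 1"
      using \<open>?l\<close> eq subspace_0[OF S] zero_less_one[where 'a=real] by blast
    have d': "M (T x) < 1" if "x \<in> X" "N x < d" for x
    proof -
      have "T x \<in> Y" using TY that by auto
      then show ?thesis
        using d(2)[OF that(1)] that subspace_0[OF S] subspace_0[OF normed_on_subspace[OF M]] T0(3)
          normed_on_uminus[OF N] normed_on_uminus[OF M] by (simp add: norm_dist_def)
    qed
    have "M (T x) \<le> (2/d) * N x" if "x \<in> X" for x
    proof (cases "x = 0")
      case True
      then show ?thesis using T0(3) normed_on_eq_0[OF M, of 0] subspace_0[OF normed_on_subspace[OF M]]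
          normed_on_eq_0[OF N, of 0] that by simp
    next
      case False
      then have p: "N x > 0"
        using normed_on_eq_0[OF N that] normed_on_nonneg[OF N that] by simp
      let ?c = "d / (2 * N x)"
      have "N (?c *\<^sub>R x) < d"
        using p d(1) by (subst normed_on_scale[OF N that]) (simp add: field_simps)
      then have "M (T (?c *\<^sub>R x)) < 1"
        using d' that subspace_scale[OF S] by blast
      moreover have "T x \<in> Y" using TY that by auto
      ultimately have "\<bar>?c\<bar> * M (T x) < 1"
        by (simp add: T0(2)[OF that] normed_on_scale[OF M])
      then show ?thesis
        using p d(1) by (simp add: field_simps)
    qed
    then show ?r using TY d(1) by (intro conjI exI[of _ "2/d"]) auto
  }
  { assume ?r
    then obtain C where TY: "T \<in> X \<rightarrow> Y" and C: "C > 0" "\<forall>x\<in>X. M (T x) \<le> C * N x" by blast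
    have "norm_dist Y M (T a) (T x) < e"
      if "a \<in> X" "e > 0" "x \<in> X" "norm_dist X N a x < e / C" for a x e
    proof -
      have "T a \<in> Y" "T x \<in> Y" using TY that by auto
      then have "norm_dist Y M (T a) (T x) = M (T (a - x))"
        using that by (simp add: norm_dist_def T0(4))
      also have "\<dots> \<le> C * N (a - x)"
        using C(2) subspace_diff[OF S] that by blast
      also have "\<dots> < e"
        using that C(1) by (simp add: norm_dist_def field_simps)
      finally show ?thesis .
    qed
    then have "\<forall>a\<in>X. \<forall>e>0. \<exists>d>0. \<forall>x. x \<in> X \<and> norm_dist X N a x < d \<longrightarrow> norm_dist Y M (T a) (T x) < e"
      using C(1) by (meson divide_pos_pos)
    then show ?l using eq TY by blast
  }
qed

lemma isomorphic_on_iff: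
  assumes N: "normed_on X N" and M: "normed_on Y M"
  shows "isomorphic_on X N Y M \<longleftrightarrow>
    (\<exists>T c C. linear_on X T \<and> T ` X = Y \<and> c > 0 \<and> C > 0 \<and>
       (\<forall>x\<in>X. c * N x \<le> M (T x) \<and> M (T x) \<le> C * N x))" (is "?l \<longleftrightarrow> ?r")
proof
  note S = normed_on_subspace[OF N] and SY = normed_on_subspace[OF M]
  note top = topspace_norm_topology[OF N] topspace_norm_topology[OF M]
  { assume ?l
    then obtain T g where T: "linear_on X T"
      and h: "homeomorphic_maps (norm_topology X N) (norm_topology Y M) T g"
      unfolding isomorphic_on_def homeomorphic_map_maps by blast
    then have cT: "continuous_map (norm_topology X N) (norm_topology Y M) T"
      and cg: "continuous_map (norm_topology Y M) (norm_topology X N) g"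
      and gT: "\<And>x. x \<in> X \<Longrightarrow> g (T x) = x" and Tg: "\<And>y. y \<in> Y \<Longrightarrow> T (g y) = y"
      unfolding homeomorphic_maps_def top by auto
    have gX: "g y \<in> X" if "y \<in> Y" for y
      using cg that unfolding continuous_map_def top by blast
    have TY: "T x \<in> Y" if "x \<in> X" for x
      using cT that unfolding continuous_map_def top by blast
    have "linear_on Y g"
      using linear_on_inverse[OF T S gX Tg gT] by simp
    from continuous_map_norm_topology[OF M N this] cg
    obtain D where D: "D > 0" "\<forall>y\<in>Y. N (g y) \<le> D * M y" by blast
    from continuous_map_norm_topology[OF N M T] cT
    obtain C where C: "C > 0" "\<forall>x\<in>X. M (T x) \<le> C * N x" by blast
    have "(1/D) * N x \<le> M (T x)" if "x \<in> X" for x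
      using D(2)[rule_format, OF TY[OF that]] gT[OF that] D(1) by (simp add: field_simps)
    moreover have "T ` X = Y"
      using TY gX Tg by force
    ultimately show ?r
      using T D(1) C by (intro exI[of _ T] exI[of _ "1/D"] exI[of _ C]) auto
  }
  { assume ?r
    then obtain T c C where T: "linear_on X T" "T ` X = Y" and c: "c > 0" "C > 0"
      and b: "\<forall>x\<in>X. c * N x \<le> M (T x) \<and> M (T x) \<le> C * N x" by blast
    have inj: "inj_on T X"
    proof
      fix x y assume xy: "x \<in> X" "y \<in> X" "T x = T y"
      have d: "x - y \<in> X" using xy subspace_diff[OF S] by blast
      have "T (x - y) = 0" using linear_on_diff[OF T(1) S] xy by simp
      then have "c * N (x - y) \<le> M 0" using b d by force
      then have "N (x - y) \<le> 0"
        using c(1) normed_on_eq_0[OF M subspace_0[OF SY]] by (simp add: mult_le_0_iff)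
      then show "x = y"
        using normed_on_nonneg[OF N d] normed_on_eq_0[OF N d] by simp
    qed
    define g where "g = inv_into X T"
    have gT: "g (T x) = x" if "x \<in> X" for x unfolding g_def using inj that by simp
    have Tg: "T (g y) = y" if "y \<in> Y" for y
      unfolding g_def using that T(2) by (simp add: f_inv_into_f)
    have gX: "g y \<in> X" if "y \<in> Y" for y
      unfolding g_def using that T(2) by (simp add: inv_into_into)
    have lg: "linear_on Y g"
      using linear_on_inverse[OF T(1) S gX Tg gT] by simp
    have "N (g y) \<le> (1/c) * M y" if "y \<in> Y" for y
      using b[rule_format, OF gX[OF that]] Tg[OF that] c(1) by (simp add: field_simps)
    then have "continuous_map (norm_topology Y M) (norm_topology X N) g"
      unfolding continuous_map_norm_topology[OF M N lg] using gX c
      by (intro conjI exI[of _ "1/c"]) auto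
    moreover have "continuous_map (norm_topology X N) (norm_topology Y M) T"
      unfolding continuous_map_norm_topology[OF N M T(1)] using T(2) b c
      by (intro conjI exI[of _ C]) auto
    ultimately have "homeomorphic_maps (norm_topology X N) (norm_topology Y M) T g"
      unfolding homeomorphic_maps_def top using gT Tg by blast
    then show ?l
      using T(1) unfolding isomorphic_on_def homeomorphic_map_maps
      by (intro exI[of _ T] conjI exI[of _ g])
  }
qed

section \<open>Linear minorants of sublinear functionals\<close>

definition sublinear :: "('a::real_vector \<Rightarrow> real) \<Rightarrow> bool" where
  "sublinear p \<longleftrightarrow> (\<forall>x y. p (x + y) \<le> p x + p y) \<and> (\<forall>t\<ge>0. \<forall>x. p (t *\<^sub>R x) = t * p x)"

lemma sublinearD:
  assumes "sublinear p"
  shows "p (x + y) \<le> p x + p y" "0 \<le> t \<Longrightarrow> p (t *\<^sub>R x) = t * p x" "p 0 = 0" "- p (- x) \<le> p x"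
proof -
  show "p (x + y) \<le> p x + p y" "0 \<le> t \<Longrightarrow> p (t *\<^sub>R x) = t * p x"
    using assms by (auto simp: sublinear_def)
  have "p (0 *\<^sub>R 0) = 0 * p 0"
    using assms unfolding sublinear_def by (metis order_refl)
  then show "p 0 = 0" by simp
  moreover have "p (x + - x) \<le> p x + p (- x)"
    using assms unfolding sublinear_def by blast
  ultimately show "- p (- x) \<le> p x" by simp
qed

lemma sublinearI:
  assumes add: "\<And>x y. p (x + y) \<le> p x + p y"
    and le: "\<And>c x. c > 0 \<Longrightarrow> p (c *\<^sub>R x) \<le> c * p x"
  shows "sublinear p"
proof -
  have scale: "p (c *\<^sub>R x) = c * p x" if c: "c > 0" for c x
    using le[OF c, of x] le[of "1/c" "c *\<^sub>R x"] c by (simp add: field_simps)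
  have "p 0 = 0"
    using scale[of 2 0] by simp
  then show ?thesis
    unfolding sublinear_def using add scale by (metis mult_zero_left order_le_less scaleR_zero_left)
qed

text \<open>
  The infimum pushes \<open>p\<close> down as far as sublinearity permits in the direction \<open>- x\<close>.  If \<open>p\<close> is minimal,
  nothing changes, and the last inequality makes \<open>p\<close> odd.
\<close>

lemma sublinear_Inf_shift:
  fixes x :: "'a::real_vector"
  assumes p: "sublinear p"
  defines "q \<equiv> \<lambda>y. INF t\<in>{0..}. p (y + t *\<^sub>R x) - t * p x"
  shows "sublinear q" "q y \<le> p y" "q (- x) \<le> - p x"
proof -
  note P = sublinearD[OF p]
  have lower: "- p (- y) \<le> p (y + t *\<^sub>R x) - t * p x" if "t \<ge> 0" for y t
    using P(1)[of "y + t *\<^sub>R x" "- y"] P(2)[OF that, of x] by simp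
  have bdd: "bdd_below ((\<lambda>t. p (y + t *\<^sub>R x) - t * p x) ` {0..})" for y
    using lower by (intro bdd_belowI2[of _ "- p (- y)"]) auto
  have le: "q y \<le> p (y + t *\<^sub>R x) - t * p x" if "t \<ge> 0" for y t
    unfolding q_def using that by (intro cINF_lower bdd) auto
  have ge: "c \<le> q y" if "\<And>t. t \<ge> 0 \<Longrightarrow> c \<le> p (y + t *\<^sub>R x) - t * p x" for c y
    unfolding q_def using that by (intro cINF_greatest) auto
  show "q y \<le> p y" using le[of 0 y] by simp
  show "q (- x) \<le> - p x" using le[of 1 "- x"] P(3) by simp
  have add: "q (y + z) \<le> q y + q z" for y z
  proof -
    have "q (y + z) - (p (y + t *\<^sub>R x) - t * p x) \<le> q z" if t: "t \<ge> 0" for t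
    proof (rule ge)
      fix s :: real assume s: "s \<ge> 0"
      have "q (y + z) \<le> p ((y + z) + (t + s) *\<^sub>R x) - (t + s) * p x"
        using t s by (intro le) auto
      also have "(y + z) + (t + s) *\<^sub>R x = (y + t *\<^sub>R x) + (z + s *\<^sub>R x)"
        by (simp add: algebra_simps)
      finally show "q (y + z) - (p (y + t *\<^sub>R x) - t * p x) \<le> p (z + s *\<^sub>R x) - s * p x"
        using P(1)[of "y + t *\<^sub>R x" "z + s *\<^sub>R x"] by (simp add: algebra_simps)
    qed
    then have "q (y + z) - q z \<le> q y"
      by (intro ge) (simp add: algebra_simps)
    then show ?thesis by simp
  qed
  have scale_le: "q (c *\<^sub>R y) \<le> c * q y" if c: "c > 0" for c y
  proof -
    have "q (c *\<^sub>R y) / c \<le> q y"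
    proof (rule ge)
      fix t :: real assume t: "t \<ge> 0"
      have "q (c *\<^sub>R y) \<le> p (c *\<^sub>R y + (c * t) *\<^sub>R x) - (c * t) * p x"
        using c t by (intro le) auto
      also have "c *\<^sub>R y + (c * t) *\<^sub>R x = c *\<^sub>R (y + t *\<^sub>R x)"
        by (simp add: algebra_simps)
      also have "p \<dots> = c * p (y + t *\<^sub>R x)" using P(2) c by simp
      finally show "q (c *\<^sub>R y) / c \<le> p (y + t *\<^sub>R x) - t * p x"
        using c by (simp add: field_simps)
    qed
    then show ?thesis using c by (simp add: field_simps)
  qed
  show "sublinear q"
    using add scale_le by (rule sublinearI)
qed

lemma sublinear_Inf_chain:
  assumes C: "C \<noteq> {}" "\<And>q. q \<in> C \<Longrightarrow> sublinear q" "\<And>q. q \<in> C \<Longrightarrow> q \<le> p"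
    and chain: "\<And>q r. q \<in> C \<Longrightarrow> r \<in> C \<Longrightarrow> q \<le> r \<or> r \<le> q"
  defines "m \<equiv> \<lambda>x. INF q\<in>C. q x"
  shows "sublinear m" "\<And>q. q \<in> C \<Longrightarrow> m \<le> q"
proof -
  have bdd: "bdd_below ((\<lambda>q. q x) ` C)" for x
  proof (intro bdd_belowI2[of _ "- p (- x)"])
    fix q assume q: "q \<in> C"
    have "q (- x) \<le> p (- x)" using C(3)[OF q] by (simp add: le_fun_def)
    then show "- p (- x) \<le> q x" using sublinearD(4)[OF C(2)[OF q], of x] by simp
  qed
  have le: "m x \<le> q x" if "q \<in> C" for q x
    unfolding m_def using that by (intro cINF_lower bdd) auto
  have ge: "c \<le> m x" if "\<And>q. q \<in> C \<Longrightarrow> c \<le> q x" for c x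
    unfolding m_def using that C(1) by (intro cINF_greatest) auto
  show "\<And>q. q \<in> C \<Longrightarrow> m \<le> q"
    using le by (simp add: le_fun_def)
  have add: "m (x + y) \<le> m x + m y" for x y
  proof -
    have "m (x + y) - q x \<le> m y" if q: "q \<in> C" for q
    proof (rule ge)
      fix r assume r: "r \<in> C"
      obtain s where s: "s \<in> C" "s \<le> q" "s \<le> r"
        using chain[OF q r] q r by blast
      have "m (x + y) \<le> s (x + y)" by (rule le[OF s(1)])
      also have "\<dots> \<le> s x + s y" by (rule sublinearD(1)[OF C(2)[OF s(1)]])
      also have "\<dots> \<le> q x + r y" using s by (intro add_mono) (auto simp: le_fun_def)
      finally show "m (x + y) - q x \<le> r y" by simp
    qed
    then have "m (x + y) - m y \<le> m x"
      by (intro ge) (simp add: algebra_simps)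
    then show ?thesis by simp
  qed
  have scale_le: "m (c *\<^sub>R x) \<le> c * m x" if c: "c > 0" for c x
  proof -
    have "m (c *\<^sub>R x) / c \<le> m x"
    proof (rule ge)
      fix q assume q: "q \<in> C"
      have "m (c *\<^sub>R x) \<le> c * q x"
        using le[OF q, of "c *\<^sub>R x"] sublinearD(2)[OF C(2)[OF q], of c x] c by simp
      then show "m (c *\<^sub>R x) / c \<le> q x"
        using c by (simp add: field_simps)
    qed
    then show ?thesis using c by (simp add: field_simps)
  qed
  show "sublinear m"
    using add scale_le by (rule sublinearI)
qed

text \<open>
  The Hahn--Banach theorem in a form that avoids partially defined functionals: a minimal sublinear
  functional exists by Zorn's lemma, and it is odd by \<open>sublinear_Inf_shift\<close>, hence linear.
\<close>

lemma sublinear_linear_minorant: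
  assumes p: "sublinear p"
  shows "\<exists>f. linear f \<and> (\<forall>x. f x \<le> p x)"
proof -
  let ?A = "{q. sublinear q \<and> q \<le> p}"
  have "\<exists>m\<in>?A. \<forall>a\<in>?A. a \<le> m \<longrightarrow> a = m"
  proof (rule predicate_Zorn[of ?A "(\<ge>)"])
    show "partial_order_on ?A (relation_of (\<ge>) ?A)"
      by (auto simp: partial_order_on_def preorder_on_def refl_on_def trans_def antisym_def
          relation_of_def)
    fix C assume "C \<in> Chains (relation_of (\<ge>) ?A)"
    then have C: "C \<subseteq> ?A" "\<And>q r. q \<in> C \<Longrightarrow> r \<in> C \<Longrightarrow> q \<le> r \<or> r \<le> q"
      by (auto simp: Chains_def relation_of_def)
    show "\<exists>u\<in>?A. \<forall>a\<in>C. u \<le> a"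
    proof (cases "C = {}")
      case True
      then show ?thesis using p by auto
    next
      case False
      then obtain q where q: "q \<in> C" by blast
      let ?m = "\<lambda>x. INF q\<in>C. q x"
      have m: "sublinear ?m" "\<And>q. q \<in> C \<Longrightarrow> ?m \<le> q"
        using sublinear_Inf_chain[OF False, of p] C by blast+
      moreover have "?m \<le> p"
        using m(2)[OF q] q C(1) by (auto intro: order_trans)
      ultimately show ?thesis by blast
    qed
  qed
  then obtain f where f: "sublinear f" "f \<le> p" and min: "\<And>q. sublinear q \<Longrightarrow> q \<le> f \<Longrightarrow> q = f"
    by (auto intro: order_trans)
  have neg: "f (- x) = - f x" for x
  proof -
    define q where "q = (\<lambda>y. INF t\<in>{0..}. f (y + t *\<^sub>R x) - t * f x)"
    have "q = f"
      unfolding q_def using sublinear_Inf_shift[OF f(1)] by (intro min) (auto simp: le_fun_def)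
    moreover have "q (- x) \<le> - f x"
      unfolding q_def by (rule sublinear_Inf_shift(3)[OF f(1)])
    ultimately show ?thesis
      using sublinearD(4)[OF f(1), of x] by simp
  qed
  have add: "f (x + y) = f x + f y" for x y
    using sublinearD(1)[OF f(1), of x y] sublinearD(1)[OF f(1), of "- x" "- y"] neg[of x] neg[of y]
      neg[of "x + y"] by (simp add: add.commute)
  have "f (c *\<^sub>R x) = c *\<^sub>R f x" for c x
  proof (cases "c \<ge> 0")
    case False
    then show ?thesis
      using sublinearD(2)[OF f(1), of "- c" x] neg[of "c *\<^sub>R x"] by simp
  qed (use sublinearD(2)[OF f(1)] in simp)
  then have "linear f"
    using add by (intro linearI) auto
  then show ?thesis
    using f(2) by (auto simp: le_fun_def)
qed

text \<open>
  A linear minorant of the functional of \<open>sublinear_Inf_shift\<close> in direction \<open>- w\<close> must touch \<open>p\<close> at \<open>w\<close>.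
\<close>

lemma sublinear_supporting_functional:
  assumes p: "sublinear p"
  shows "\<exists>f. linear f \<and> (\<forall>x. f x \<le> p x) \<and> f w = p w"
proof -
  obtain f where f: "linear f" "\<And>y. f y \<le> (INF t\<in>{0..}. p (y + t *\<^sub>R w) - t * p w)"
    using sublinear_linear_minorant[OF sublinear_Inf_shift(1)[OF p]] by blast
  have le: "f y \<le> p y" for y
    using f(2) sublinear_Inf_shift(2)[OF p] order_trans by blast
  have "f (- w) \<le> - p w"
    using f(2) sublinear_Inf_shift(3)[OF p] order_trans by blast
  then have "f w = p w"
    using le[of w] linear_neg[OF f(1), of w] by simp
  then show ?thesis using f(1) le by blast
qed

text \<open>
  A linear projection, without any continuity, turns statements about functionals on a carrier into
  statements about functionals on the whole type.
\<close>

lemma subspace_projection: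
  assumes "subspace (X :: 'a::real_vector set)"
  obtains P where "linear P" "\<And>x. P x \<in> X" "\<And>x. x \<in> X \<Longrightarrow> P x = x"
  using linear_exists_left_inverse_on[of "id :: 'a \<Rightarrow> 'a" X] assms linear_id
  by (auto simp: image_subset_iff id_def)

lemma norming_functional:
  assumes N: "normed_on X N" and w: "w \<in> X"
  shows "\<exists>f. linear f \<and> (\<forall>x\<in>X. \<bar>f x\<bar> \<le> N x) \<and> f w = N w"
proof -
  obtain P where P: "linear P" "\<And>x. P x \<in> X" "\<And>x. x \<in> X \<Longrightarrow> P x = x"
    using subspace_projection[OF normed_on_subspace[OF N]] by blast
  have "sublinear (\<lambda>x. N (P x))"
    using normed_on_triangle[OF N] normed_on_scale[OF N] P(2)
    by (auto simp: sublinear_def linear_add[OF P(1)] linear_scale[OF P(1)])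
  then obtain f where f: "linear f" "\<And>x. f x \<le> N (P x)" "f w = N (P w)"
    using sublinear_supporting_functional[of _ w] by blast
  have "\<bar>f x\<bar> \<le> N x" if "x \<in> X" for x
  proof -
    have "- f x \<le> N (- x)"
      using f(2)[of "- x"] P(3)[of "- x"] subspace_neg[OF normed_on_subspace[OF N] that]
        linear_neg[OF f(1)] by simp
    then show ?thesis
      using f(2)[of x] P(3)[OF that] normed_on_uminus[OF N that] by simp
  qed
  then show ?thesis using f P(3)[OF w] by auto
qed

section \<open>Finite dimensional spaces\<close>

lemma coordinates_tendsto_imp_norm_tendsto:
  assumes N: "normed_on (span B) N"
    and eq: "\<And>n. s n = (\<Sum>b\<in>B. c b (s n) *\<^sub>R b)"
    and L: "\<And>b. b \<in> B \<Longrightarrow> (\<lambda>n. c b (s n)) \<longlonglongrightarrow> L b"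
  shows "(\<lambda>n. N (s n - (\<Sum>b\<in>B. L b *\<^sub>R b))) \<longlonglongrightarrow> 0"
proof (rule tendsto_sandwich[OF _ _ tendsto_const])
  let ?z = "\<Sum>b\<in>B. L b *\<^sub>R b"
  have diff: "s n - ?z = (\<Sum>b\<in>B. (c b (s n) - L b) *\<^sub>R b)" for n
    using eq[of n] by (simp add: scaleR_diff_left sum_subtractf)
  have "s n - ?z \<in> span B" for n
    unfolding diff by (intro span_sum span_scale span_base)
  then show "\<forall>\<^sub>F n in sequentially. 0 \<le> N (s n - ?z)"
    using normed_on_nonneg[OF N] by simp
  have "N (s n - ?z) \<le> (\<Sum>b\<in>B. \<bar>c b (s n) - L b\<bar> * N b)" for n
  proof -
    have "N (s n - ?z) \<le> (\<Sum>b\<in>B. N ((c b (s n) - L b) *\<^sub>R b))"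
      unfolding diff by (intro normed_on_sum[OF N] span_scale) (auto simp: span_base)
    also have "\<dots> = (\<Sum>b\<in>B. \<bar>c b (s n) - L b\<bar> * N b)"
      by (intro sum.cong normed_on_scale[OF N]) (auto simp: span_base)
    finally show ?thesis .
  qed
  then show "\<forall>\<^sub>F n in sequentially. N (s n - ?z) \<le> (\<Sum>b\<in>B. \<bar>c b (s n) - L b\<bar> * N b)"
    by simp
  have "(\<lambda>n. \<Sum>b\<in>B. \<bar>c b (s n) - L b\<bar> * N b) \<longlonglongrightarrow> (\<Sum>b\<in>B. \<bar>L b - L b\<bar> * N b)"
    by (intro tendsto_intros L)
  then show "(\<lambda>n. \<Sum>b\<in>B. \<bar>c b (s n) - L b\<bar> * N b) \<longlonglongrightarrow> 0" by simp
qed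

lemma bounded_coordinates_imp_complete:
  assumes N: "normed_on (span B) N" and C: "C \<ge> 0" and lin: "\<And>b. linear (c b)"
    and eq: "\<And>x. x \<in> span B \<Longrightarrow> x = (\<Sum>b\<in>B. c b x *\<^sub>R b)"
    and bd: "\<And>x b. x \<in> span B \<Longrightarrow> b \<in> B \<Longrightarrow> \<bar>c b x\<bar> \<le> C * N x"
    and s: "range s \<subseteq> span B"
    and Cau: "\<And>e. e > 0 \<Longrightarrow> \<exists>n0. \<forall>m\<ge>n0. \<forall>n\<ge>n0. N (s m - s n) < e"
  shows "\<exists>l\<in>span B. (\<lambda>k. N (s k - l)) \<longlonglongrightarrow> 0"
proof -
  have sB: "s n \<in> span B" for n using s by auto
  have "Cauchy (\<lambda>n. c b (s n))" if b: "b \<in> B" for b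
  proof (rule CauchyI')
    fix e :: real assume e: "e > 0"
    then obtain n0 where n0: "\<And>m n. m \<ge> n0 \<Longrightarrow> n \<ge> n0 \<Longrightarrow> N (s m - s n) < e / (C + 1)"
      using Cau[of "e / (C + 1)"] C by auto
    have "dist (c b (s m)) (c b (s n)) < e" if "m \<ge> n0" "n \<ge> n0" for m n
    proof -
      have sd: "s m - s n \<in> span B" using sB by (intro span_diff)
      have "dist (c b (s m)) (c b (s n)) = \<bar>c b (s m - s n)\<bar>"
        by (simp add: dist_real_def linear_diff[OF lin])
      also have "\<dots> \<le> C * N (s m - s n)" using bd[OF sd b] .
      also have "\<dots> \<le> (C + 1) * N (s m - s n)"
        using normed_on_nonneg[OF N sd] by (intro mult_right_mono) auto
      finally show ?thesis using n0[OF that] C by (simp add: field_simps)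
    qed
    then show "\<exists>M. \<forall>m\<ge>M. \<forall>n>m. dist (c b (s m)) (c b (s n)) < e"
      by (meson less_imp_le order_trans)
  qed
  then obtain L where L: "\<And>b. b \<in> B \<Longrightarrow> (\<lambda>n. c b (s n)) \<longlonglongrightarrow> L b"
    unfolding Cauchy_convergent_iff convergent_def by metis
  have "(\<lambda>n. N (s n - (\<Sum>b\<in>B. L b *\<^sub>R b))) \<longlonglongrightarrow> 0"
    using coordinates_tendsto_imp_norm_tendsto[OF N eq[OF sB] L] .
  moreover have "(\<Sum>b\<in>B. L b *\<^sub>R b) \<in> span B"
    by (intro span_sum span_scale span_base)
  ultimately show ?thesis by blast
qed

text \<open>
  A generator in the span of the earlier ones receives the coordinate \<open>0\<close>.  Any other \<open>a\<close> has positive distance to the span of the old ones, since that span is complete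
  by the induction hypothesis; the distance bounds the new coordinate.
\<close>

lemma finite_dim_bounded_coordinates:
  assumes "finite B" "normed_on (span B) N"
  shows "\<exists>c C. C \<ge> 0 \<and> (\<forall>b. linear (c b)) \<and>
           (\<forall>x\<in>span B. x = (\<Sum>b\<in>B. c b x *\<^sub>R b) \<and> (\<forall>b\<in>B. \<bar>c b x\<bar> \<le> C * N x))"
  using assms
proof (induction B rule: finite_induct)
  case empty
  then show ?case
    by (intro exI[of _ "\<lambda>_ _. 0"] exI[of _ 0]) (auto simp: linear_iff)
next
  case (insert a B)
  note N = insert.prems
  have sub: "span B \<subseteq> span (insert a B)" by (intro span_mono) auto
  have aX: "a \<in> span (insert a B)" by (simp add: span_base)
  note nonneg = normed_on_nonneg[OF N]
  obtain c C where C: "C \<ge> 0" and lin: "\<And>b. linear (c b)"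
    and eq: "\<And>x. x \<in> span B \<Longrightarrow> x = (\<Sum>b\<in>B. c b x *\<^sub>R b)"
    and bd: "\<And>x b. x \<in> span B \<Longrightarrow> b \<in> B \<Longrightarrow> \<bar>c b x\<bar> \<le> C * N x"
    using insert.IH normed_on_subset[OF N subspace_span sub] by blast
  show ?case
  proof (cases "a \<in> span B")
    case True
    then have sp: "span (insert a B) = span B" by (simp add: span_redundant)
    define c' where "c' b x = (if b = a then 0 else c b x)" for b x
    have "linear (c' b)" for b
      using lin[of b] by (cases "b = a") (auto simp: c'_def linear_iff)
    moreover have "x = (\<Sum>b\<in>insert a B. c' b x *\<^sub>R b)" if "x \<in> span B" for x
    proof -
      have "(\<Sum>b\<in>insert a B. c' b x *\<^sub>R b) = (\<Sum>b\<in>B. c b x *\<^sub>R b)"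
        using insert.hyps by (auto simp: c'_def intro!: sum.cong)
      then show ?thesis using eq[OF that] by simp
    qed
    moreover have "\<bar>c' b x\<bar> \<le> C * N x" if "x \<in> span B" "b \<in> insert a B" for x b
      using that bd C nonneg sp by (auto simp: c'_def)
    ultimately show ?thesis
      unfolding sp using C by blast
  next
    case False
    obtain h :: "'a \<Rightarrow> real" where l: "linear h" "h a = 1" "\<And>x. x \<in> span B \<Longrightarrow> h x = 0"
    proof -
      obtain B' where B': "independent B'" "span B' = span B"
        by (metis basis_exists maximal_independent_subset span_eq span_superset order_trans)
      have "independent (insert a B')"
        using B' False by (simp add: independent_insert)
      then obtain g :: "'a \<Rightarrow> real" where g: "linear g"
        "\<And>x. x \<in> insert a B' \<Longrightarrow> g x = (if x = a then 1 else 0)"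
        using linear_independent_extend[of "insert a B'" "\<lambda>x. if x = a then 1 else 0"] by blast
      have "g x = 0" if "x \<in> span B" for x
      proof (rule linear_eq_0_on_span[OF g(1), of B'])
        show "x \<in> span B'" using that B' by simp
        show "\<And>x. x \<in> B' \<Longrightarrow> g x = 0"
          using g(2) False B'(2) by (metis insertCI span_base)
      qed
      then show thesis using that g by auto
    qed
    have rest: "x - h x *\<^sub>R a \<in> span B" if x: "x \<in> span (insert a B)" for x
    proof -
      obtain k where k: "x - k *\<^sub>R a \<in> span B" using x by (auto simp: span_insert)
      then have "h (x - k *\<^sub>R a) = 0" using l(3) by blast
      then have "k = h x" using l(1,2) by (simp add: linear_diff linear_scale)
      then show ?thesis using k by simp
    qed
    have "\<exists>d>0. \<forall>y\<in>span B. d \<le> N (a - y)"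
    proof (rule ccontr)
      assume "\<not> ?thesis"
      then have "\<exists>y\<in>span B. N (a - y) < 1 / real (Suc n)" for n
        by (metis not_le of_nat_0_less_iff zero_less_Suc zero_less_divide_1_iff)
      then obtain y where y: "\<And>n. y n \<in> span B" "\<And>n. N (a - y n) < 1 / real (Suc n)"
        by metis
      have ay: "a - z \<in> span (insert a B)" if "z \<in> span B" for z
        using that sub aX by (intro span_diff) auto
      have Na: "(\<lambda>n. N (a - y n)) \<longlonglongrightarrow> 0"
        by (rule tendsto_sandwich[OF _ _ tendsto_const LIMSEQ_inverse_real_of_nat])
          (use y nonneg ay in \<open>auto simp: inverse_eq_divide less_imp_le\<close>)
      have yy: "N (y m - y n) \<le> N (a - y m) + N (a - y n)" for m n
        using normed_on_minus(1)[OF N ay ay, OF y(1) y(1), of n m] by simp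
      have "\<exists>n0. \<forall>m\<ge>n0. \<forall>n\<ge>n0. N (y m - y n) < e" if e: "e > 0" for e
      proof -
        have "\<forall>\<^sub>F n in sequentially. N (a - y n) < e / 2"
          using Na e by (intro order_tendstoD(2)[OF Na]) auto
        then obtain n0 where "\<And>n. n \<ge> n0 \<Longrightarrow> N (a - y n) < e / 2"
          by (auto simp: eventually_sequentially)
        then show ?thesis
          using yy by (intro exI[of _ n0] allI impI) (smt (verit) field_sum_of_halves)
      qed
      then obtain z where zB: "z \<in> span B" and Nz: "(\<lambda>n. N (y n - z)) \<longlonglongrightarrow> 0"
        using bounded_coordinates_imp_complete[OF normed_on_subset[OF N subspace_span sub] C lin eq bd, of y]
          y(1) by blast
      have "(\<lambda>n. N (a - y n) + N (y n - z)) \<longlonglongrightarrow> 0"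
        using tendsto_add[OF Na Nz] by simp
      moreover have "N (a - z) \<le> N (a - y n) + N (y n - z)" for n
        using normed_on_triangle[OF N ay[OF y(1)], of "y n - z" n] span_diff[OF y(1) zB, of n] sub
        by auto
      ultimately have "N (a - z) \<le> 0"
        by (intro LIMSEQ_le_const) auto
      then have "a = z"
        using nonneg[OF ay[OF zB]] normed_on_eq_0[OF N ay[OF zB]] by simp
      then show False using zB False by simp
    qed
    then obtain d where d: "d > 0" "\<And>y. y \<in> span B \<Longrightarrow> d \<le> N (a - y)" by blast
    have lN: "\<bar>h x\<bar> \<le> (1/d) * N x" if x: "x \<in> span (insert a B)" for x
    proof (cases "h x = 0")
      case True
      then show ?thesis using nonneg[OF x] d by simp
    next
      case False
      have yB: "- (1 / h x) *\<^sub>R (x - h x *\<^sub>R a) \<in> span B" (is "?y \<in> _")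
        using rest[OF x] by (rule span_scale)
      have "a - ?y = (1 / h x) *\<^sub>R x"
        using False by (simp add: algebra_simps)
      then have "d \<le> \<bar>1 / h x\<bar> * N x"
        using d(2)[OF yB] normed_on_scale[OF N x] by simp
      then show ?thesis using d(1) False by (simp add: field_simps)
    qed
    define c' where "c' b x = (if b = a then h x else c b (x - h x *\<^sub>R a))" for b x
    define C' where "C' = max (1/d) (C * (1 + N a / d))"
    have "linear (c' b)" for b
    proof (cases "b = a")
      case False
      then have "c' b = (\<lambda>x. c b x - h x * c b a)"
        by (simp add: fun_eq_iff c'_def linear_diff[OF lin] linear_scale[OF lin])
      then show ?thesis
        by (intro linearI)
          (simp_all add: linear_add[OF lin] linear_add[OF l(1)] linear_scale[OF lin]
            linear_scale[OF l(1)] algebra_simps)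
    qed (use l(1) in \<open>simp add: c'_def[abs_def]\<close>)
    moreover have "x = (\<Sum>b\<in>insert a B. c' b x *\<^sub>R b)" if x: "x \<in> span (insert a B)" for x
    proof -
      have "(\<Sum>b\<in>insert a B. c' b x *\<^sub>R b) = h x *\<^sub>R a + (\<Sum>b\<in>B. c' b x *\<^sub>R b)"
        using insert.hyps by (simp add: c'_def)
      also have "(\<Sum>b\<in>B. c' b x *\<^sub>R b) = (\<Sum>b\<in>B. c b (x - h x *\<^sub>R a) *\<^sub>R b)"
        using insert.hyps by (intro sum.cong) (auto simp: c'_def)
      also have "\<dots> = x - h x *\<^sub>R a" using eq[OF rest[OF x]] by simp
      finally show ?thesis by simp
    qed
    moreover have "\<bar>c' b x\<bar> \<le> C' * N x" if x: "x \<in> span (insert a B)" and b: "b \<in> insert a B" for x b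
    proof (cases "b = a")
      case True
      have "\<bar>c' b x\<bar> \<le> (1/d) * N x" using lN[OF x] True by (simp add: c'_def)
      also have "\<dots> \<le> C' * N x" using nonneg[OF x] by (intro mult_right_mono) (auto simp: C'_def)
      finally show ?thesis .
    next
      case False
      have la: "h x *\<^sub>R a \<in> span (insert a B)" by (intro span_scale aX)
      have "\<bar>c' b x\<bar> \<le> C * N (x - h x *\<^sub>R a)"
        using False b bd[OF rest[OF x]] by (simp add: c'_def)
      also have "\<dots> \<le> C * (N x + \<bar>h x\<bar> * N a)"
        using normed_on_minus(1)[OF N x la] normed_on_scale[OF N aX] C
        by (intro mult_left_mono) auto
      also have "\<dots> \<le> C * (N x + ((1/d) * N x) * N a)"
        using lN[OF x] nonneg[OF aX] C by (intro mult_left_mono add_left_mono mult_right_mono) auto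
      also have "\<dots> = (C * (1 + N a / d)) * N x" by (simp add: field_simps)
      also have "\<dots> \<le> C' * N x" using nonneg[OF x] by (intro mult_right_mono) (auto simp: C'_def)
      finally show ?thesis .
    qed
    moreover have "C' \<ge> 0" using d(1) by (simp add: C'_def le_max_iff_disj)
    ultimately show ?thesis by blast
  qed
qed

lemma finite_dim_banach_on:
  assumes "finite B" and N: "normed_on (span B) N"
  shows "banach_on (span B) N"
proof (rule banach_onI[OF N])
  fix s :: "nat \<Rightarrow> 'a" assume s: "range s \<subseteq> span B"
    and Cau: "\<And>e. e > 0 \<Longrightarrow> \<exists>n0. \<forall>m\<ge>n0. \<forall>n\<ge>n0. N (s m - s n) < e"
  obtain c C where "C \<ge> 0" "\<And>b. linear (c b)"
    "\<And>x. x \<in> span B \<Longrightarrow> x = (\<Sum>b\<in>B. c b x *\<^sub>R b)"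
    "\<And>x b. x \<in> span B \<Longrightarrow> b \<in> B \<Longrightarrow> \<bar>c b x\<bar> \<le> C * N x"
    using finite_dim_bounded_coordinates[OF assms] by blast
  then show "\<exists>l\<in>span B. (\<lambda>k. N (s k - l)) \<longlonglongrightarrow> 0"
    by (rule bounded_coordinates_imp_complete[OF N _ _ _ _ s Cau])
qed

section \<open>Inverse limits\<close>

lemma standard_inverse_systemD:
  assumes "standard_inverse_system W N \<theta>"
  shows "normed_on (W i) (N i)" "\<exists>B. finite B \<and> span B = W i"
    "linear_on (W (Suc i)) (\<theta> i)" "w \<in> W (Suc i) \<Longrightarrow> \<theta> i w \<in> W i"
    "w \<in> W (Suc i) \<Longrightarrow> N i (\<theta> i w) \<le> N (Suc i) w"
  using assms by (auto simp: standard_inverse_system_def banach_on_def Pi_iff)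

lemma limit_norm_tendsto:
  assumes S: "standard_inverse_system W N \<theta>" and w: "w \<in> inverse_limit W N \<theta>"
  shows "(\<lambda>j. N j (w j)) \<longlonglongrightarrow> limit_norm N w" "N j (w j) \<le> limit_norm N w"
    "i \<le> j \<Longrightarrow> N i (w i) \<le> N j (w j)"
proof -
  have inc: "incseq (\<lambda>j. N j (w j))"
  proof (rule incseq_SucI)
    fix n
    have "w (Suc n) \<in> W (Suc n)" "\<theta> n (w (Suc n)) = w n"
      using w by (auto simp: inverse_limit_def)
    then show "N n (w n) \<le> N (Suc n) (w (Suc n))"
      using standard_inverse_systemD(5)[OF S, of "w (Suc n)" n] by simp
  qed
  have bdd: "bdd_above (range (\<lambda>j. N j (w j)))"
    using w by (simp add: inverse_limit_def)
  have "(\<lambda>j. N j (w j)) \<longlonglongrightarrow> (SUP j. N j (w j))"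
    by (rule LIMSEQ_incseq_SUP[OF bdd inc])
  moreover from this have eq: "limit_norm N w = (SUP j. N j (w j))"
    unfolding limit_norm_def by (rule limI)
  ultimately show "(\<lambda>j. N j (w j)) \<longlonglongrightarrow> limit_norm N w" by simp
  show "N j (w j) \<le> limit_norm N w"
    unfolding eq by (intro cSUP_upper bdd) auto
  show "i \<le> j \<Longrightarrow> N i (w i) \<le> N j (w j)"
    using inc by (simp add: incseq_def)
qed

lemma normed_on_inverse_limit:
  assumes S: "standard_inverse_system W N \<theta>"
  shows "normed_on (inverse_limit W N \<theta>) (limit_norm N)"
proof -
  let ?L = "inverse_limit W N \<theta>"
  note n = standard_inverse_systemD(1)[OF S]
  note sub = normed_on_subspace[OF n]
  note lim = limit_norm_tendsto[OF S]
  have wW: "w i \<in> W i" if "w \<in> ?L" for w i using that by (simp add: inverse_limit_def)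
  have L0: "0 \<in> ?L"
    using subspace_0[OF sub] linear_on_0[OF standard_inverse_systemD(3)[OF S] sub]
      normed_on_eq_0[OF n, of 0]
    by (auto simp: inverse_limit_def)
  have Ladd: "v + w \<in> ?L" if "v \<in> ?L" "w \<in> ?L" for v w
  proof -
    have "N j (v j + w j) \<le> limit_norm N v + limit_norm N w" for j
      using normed_on_triangle[OF n wW wW, OF that] lim(2)[OF that(1), of j] lim(2)[OF that(2), of j]
      by (smt (verit))
    then have "bdd_above (range (\<lambda>j. N j (v j + w j)))"
      by (intro bdd_aboveI2)
    then show ?thesis
      using that linear_on_add[OF standard_inverse_systemD(3)[OF S] sub] subspace_add[OF sub]
      by (auto simp: inverse_limit_def)
  qed
  have Lscale: "c *\<^sub>R v \<in> ?L" if "v \<in> ?L" for v c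
  proof -
    have "N j (c *\<^sub>R v j) \<le> \<bar>c\<bar> * limit_norm N v" for j
      using normed_on_scale[OF n wW, OF that] lim(2)[OF that, of j]
      by (simp add: mult_left_mono)
    then have "bdd_above (range (\<lambda>j. N j (c *\<^sub>R v j)))"
      by (intro bdd_aboveI2)
    then show ?thesis
      using that linear_on_scale[OF standard_inverse_systemD(3)[OF S] sub] subspace_scale[OF sub]
      by (auto simp: inverse_limit_def scaleR_fun_def)
  qed
  show ?thesis
    unfolding normed_on_def
  proof (intro conjI ballI allI)
    show "subspace ?L" using L0 Ladd Lscale by (auto simp: subspace_def)
    fix x assume x: "x \<in> ?L"
    have nn: "0 \<le> N j (x j)" for j using normed_on_nonneg[OF n wW[OF x]] .
    show nonneg: "0 \<le> limit_norm N x"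
      using nn[of 0] lim(2)[OF x, of 0] by linarith
    have "limit_norm N x = 0 \<Longrightarrow> x j = 0" for j
      using nn[of j] lim(2)[OF x, of j] normed_on_eq_0[OF n wW[OF x]] by (metis order_antisym)
    moreover have "limit_norm N 0 = 0"
      using lim(1)[OF L0] normed_on_eq_0[OF n subspace_0[OF sub]]
      by (auto simp: LIMSEQ_const_iff)
    ultimately show "(limit_norm N x = 0) = (x = 0)" by (metis ext zero_fun_apply)
    show "limit_norm N (c *\<^sub>R x) = \<bar>c\<bar> * limit_norm N x" for c
    proof (rule LIMSEQ_unique[OF lim(1)[OF Lscale[OF x]]])
      show "(\<lambda>j. N j ((c *\<^sub>R x) j)) \<longlonglongrightarrow> \<bar>c\<bar> * limit_norm N x"
        using tendsto_mult_left[OF lim(1)[OF x], of "\<bar>c\<bar>"]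
        by (simp add: scaleR_fun_def normed_on_scale[OF n wW[OF x]])
    qed
    fix y assume y: "y \<in> ?L"
    show "limit_norm N (x + y) \<le> limit_norm N x + limit_norm N y"
      by (rule LIMSEQ_le[OF lim(1)[OF Ladd[OF x y]] tendsto_add[OF lim(1)[OF x] lim(1)[OF y]]])
        (use normed_on_triangle[OF n wW[OF x] wW[OF y]] in auto)
  qed
qed

section \<open>A Kadec--Klee norm\<close>

text \<open>
  The quotient norm modulo \<open>F\<close>, pulled back to the whole space.  It appears twice: as the distance to a line
  in the Kadec--Klee norm, and as the norm of the finite dimensional quotients.
\<close>

definition coset_norm :: "('a::real_vector \<Rightarrow> real) \<Rightarrow> 'a set \<Rightarrow> 'a \<Rightarrow> real" where
  "coset_norm M F x = (INF y\<in>F. M (x - y))"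

context
  fixes M :: "'a::real_vector \<Rightarrow> real" and F :: "'a set"
  assumes M: "normed_on UNIV M" and F: "subspace F"
begin

lemma coset_norm_lower: "y \<in> F \<Longrightarrow> coset_norm M F x \<le> M (x - y)"
  unfolding coset_norm_def
  by (intro cINF_lower bdd_belowI2[of _ 0]) (use normed_on_nonneg[OF M] in auto)

lemma coset_norm_greatest: "(\<And>y. y \<in> F \<Longrightarrow> a \<le> M (x - y)) \<Longrightarrow> a \<le> coset_norm M F x"
  unfolding coset_norm_def by (intro cINF_greatest) (use subspace_0[OF F] in auto)

lemma coset_norm_approx: "coset_norm M F x < a \<Longrightarrow> \<exists>y\<in>F. M (x - y) < a"
  using coset_norm_greatest[of a x] by (meson not_le)

lemma coset_norm_nonneg: "0 \<le> coset_norm M F x"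
  using normed_on_nonneg[OF M] by (intro coset_norm_greatest) auto

lemma coset_norm_le: "coset_norm M F x \<le> M x"
  using coset_norm_lower[OF subspace_0[OF F], of x] by simp

lemma coset_norm_triangle: "coset_norm M F (x + y) \<le> coset_norm M F x + coset_norm M F y"
proof -
  have "coset_norm M F (x + y) - M (x - u) \<le> coset_norm M F y" if u: "u \<in> F" for u
  proof (rule coset_norm_greatest)
    fix v assume v: "v \<in> F"
    have "coset_norm M F (x + y) \<le> M ((x + y) - (u + v))"
      by (intro coset_norm_lower subspace_add[OF F] u v)
    also have "(x + y) - (u + v) = (x - u) + (y - v)" by simp
    finally show "coset_norm M F (x + y) - M (x - u) \<le> M (y - v)"
      using normed_on_triangle[OF M, of "x - u" "y - v"] by simp
  qed
  then have "coset_norm M F (x + y) - coset_norm M F y \<le> coset_norm M F x"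
    by (intro coset_norm_greatest) (simp add: algebra_simps)
  then show ?thesis by simp
qed

lemma coset_norm_scale: "coset_norm M F (c *\<^sub>R x) = \<bar>c\<bar> * coset_norm M F x"
proof -
  have le: "coset_norm M F (c *\<^sub>R x) \<le> \<bar>c\<bar> * coset_norm M F x" if c: "c \<noteq> 0" for c x
  proof -
    have "coset_norm M F (c *\<^sub>R x) / \<bar>c\<bar> \<le> coset_norm M F x"
    proof (rule coset_norm_greatest)
      fix y assume y: "y \<in> F"
      have "coset_norm M F (c *\<^sub>R x) \<le> M (c *\<^sub>R x - c *\<^sub>R y)"
        by (intro coset_norm_lower subspace_scale[OF F] y)
      also have "\<dots> = \<bar>c\<bar> * M (x - y)"
        using normed_on_scale[OF M, of "x - y" c] by (simp add: scaleR_diff_right)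
      finally show "coset_norm M F (c *\<^sub>R x) / \<bar>c\<bar> \<le> M (x - y)"
        using c by (simp add: field_simps)
    qed
    then show ?thesis using c by (simp add: field_simps)
  qed
  show ?thesis
  proof (cases "c = 0")
    case True
    then show ?thesis
      using coset_norm_le[of 0] coset_norm_nonneg[of 0] normed_on_eq_0[OF M, of 0] by simp
  next
    case False
    then show ?thesis
      using le[OF False, of x] le[of "1/c" "c *\<^sub>R x"] by (simp add: field_simps)
  qed
qed

end

text \<open>
  What remains of a predual with its weak-star topology: countably many functionals that norm the space up to a
  constant and for which bounded sets are complete in the topology of pointwise convergence.
\<close>

locale coordinate_dual =
  fixes e :: "nat \<Rightarrow> 'v::banach \<Rightarrow> real" and c C :: real and d :: "nat \<Rightarrow> 'v"
  assumes lin: "linear (e i)"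
    and c_pos: "c > 0" and C_pos: "C > 0"
    and e_upper: "\<bar>e i x\<bar> \<le> C * norm x"
    and e_lower: "\<exists>i. c * norm x \<le> \<bar>e i x\<bar>"
    and sequential_compactness:
      "bounded (range X) \<Longrightarrow> (\<And>i. convergent (\<lambda>k. e i (X k))) \<Longrightarrow>
         \<exists>x. \<forall>i. (\<lambda>k. e i (X k)) \<longlonglongrightarrow> e i x"
    and dense: "\<epsilon> > 0 \<Longrightarrow> \<exists>n. norm (x - d n) < \<epsilon>"
begin

definition coord_conv :: "(nat \<Rightarrow> 'v) \<Rightarrow> 'v \<Rightarrow> bool" where
  "coord_conv X x \<longleftrightarrow> bounded (range X) \<and> (\<forall>i. (\<lambda>k. e i (X k)) \<longlonglongrightarrow> e i x)"

text \<open>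
  Lower semicontinuity along bounded sequences is enough, and it is preserved by countable sums of
  nonnegative functions.
\<close>

definition lsc :: "('v \<Rightarrow> real) \<Rightarrow> bool" where
  "lsc f \<longleftrightarrow> (\<forall>X x a. coord_conv X x \<longrightarrow> a < f x \<longrightarrow> (\<forall>\<^sub>F k in sequentially. a < f (X k)))"

definition coord_norm :: "'v \<Rightarrow> real" where "coord_norm x = (SUP i. \<bar>e i x\<bar>)"

definition line :: "nat \<Rightarrow> 'v set" where "line n = range (\<lambda>t. t *\<^sub>R d n)"

definition line_dist :: "nat \<Rightarrow> 'v \<Rightarrow> real" where "line_dist n = coset_norm coord_norm (line n)"

text \<open>
  The classical construction uses the distances to an increasing sequence of finite dimensional subspaces with
  dense union.  Lines through a dense sequence suffice, since a vector close to \<open>d n\<close> is close to its line;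
  compactness is then needed for one real parameter only.
\<close>

definition kk_norm :: "'v \<Rightarrow> real" where "kk_norm x = coord_norm x + (\<Sum>n. (1/2) ^ Suc n * line_dist n x)"

lemma coord_conv_subseq: "coord_conv X x \<Longrightarrow> strict_mono r \<Longrightarrow> coord_conv (\<lambda>k. X (r k)) x"
  unfolding coord_conv_def
  using LIMSEQ_subseq_LIMSEQ[of "\<lambda>k. e _ (X k)" _ r]
  by (auto simp: o_def intro: bounded_subset)

lemma e_le_coord_norm: "\<bar>e i x\<bar> \<le> coord_norm x"
  unfolding coord_norm_def using e_upper by (intro cSUP_upper bdd_aboveI2) auto

lemma coord_norm_le: "coord_norm x \<le> C * norm x"
  unfolding coord_norm_def by (intro cSUP_least) (auto intro: e_upper)

lemma coord_norm_ge: "c * norm x \<le> coord_norm x"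
  using e_lower[of x] e_le_coord_norm[of _ x] by (meson order_trans)

lemma normed_on_coord_norm: "normed_on UNIV coord_norm"
  unfolding normed_on_def
proof (intro conjI ballI allI)
  show "subspace (UNIV :: 'v set)" by simp
  fix x y :: 'v and r :: real
  show nonneg: "0 \<le> coord_norm x" using e_le_coord_norm[of 0 x] by simp
  have p0: "coord_norm 0 = 0" using coord_norm_le[of 0] e_le_coord_norm[of 0 0] by simp
  show "coord_norm x = 0 \<longleftrightarrow> x = 0"
    using coord_norm_ge[of x] p0 c_pos by (auto simp: mult_le_0_iff)
  have le: "coord_norm (r *\<^sub>R x) \<le> \<bar>r\<bar> * coord_norm x" for r x
    unfolding coord_norm_def[of "r *\<^sub>R x"]
    by (intro cSUP_least) (auto simp: linear_scale[OF lin] abs_mult e_le_coord_norm mult_left_mono)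
  show "coord_norm (r *\<^sub>R x) = \<bar>r\<bar> * coord_norm x"
  proof (cases "r = 0")
    case False
    then have "\<bar>r\<bar> * coord_norm ((1/r) *\<^sub>R (r *\<^sub>R x)) \<le> \<bar>r\<bar> * (\<bar>1/r\<bar> * coord_norm (r *\<^sub>R x))"
      by (intro mult_left_mono le) auto
    then show ?thesis using le[of r x] False by simp
  qed (simp add: p0)
  show "coord_norm (x + y) \<le> coord_norm x + coord_norm y"
    unfolding coord_norm_def[of "x + y"]
  proof (intro cSUP_least)
    show "\<bar>e i (x + y)\<bar> \<le> coord_norm x + coord_norm y" for i
      using e_le_coord_norm[of i x] e_le_coord_norm[of i y] by (simp add: linear_add[OF lin])
  qed auto
qed

lemma subspace_line: "subspace (line n)"
  unfolding line_def subspace_def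
  by (auto simp: image_iff scaleR_add_left[symmetric] intro: exI[of _ 0])

lemma line_dist_nonneg: "0 \<le> line_dist n x"
  unfolding line_dist_def by (rule coset_norm_nonneg[OF normed_on_coord_norm subspace_line])

lemma line_dist_le: "line_dist n x \<le> coord_norm x"
  unfolding line_dist_def by (rule coset_norm_le[OF normed_on_coord_norm subspace_line])

lemma lsc_coord_norm: "lsc coord_norm"
  unfolding lsc_def
proof (intro allI impI)
  fix X x a assume X: "coord_conv X x" and a: "a < coord_norm x"
  obtain i where i: "a < \<bar>e i x\<bar>"
    using a unfolding coord_norm_def
    by (subst (asm) less_cSUP_iff) (auto intro!: bdd_aboveI2 e_upper)
  have "(\<lambda>k. \<bar>e i (X k)\<bar>) \<longlonglongrightarrow> \<bar>e i x\<bar>"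
    using X by (auto simp: coord_conv_def intro: tendsto_rabs)
  from order_tendstoD(1)[OF this i] show "\<forall>\<^sub>F k in sequentially. a < coord_norm (X k)"
    by eventually_elim (use e_le_coord_norm less_le_trans in blast)
qed

text \<open>
  The only use of compactness: near-optimal multiples of \<open>d n\<close> for a bounded sequence are bounded, so a
  subsequence of them converges.  This gives the lower semicontinuity of the distance to the line, and it
  compares different members of the sequence with the same point of the line.
\<close>

lemma line_approximation:
  assumes X: "coord_conv X x" and ev: "\<not> (\<forall>\<^sub>F k in sequentially. a \<le> line_dist n (X k))"
  shows "\<exists>r t s. strict_mono r \<and> t \<longlonglongrightarrow> s \<and> (\<forall>k. coord_norm (X (r k) - t k *\<^sub>R d n) < a) \<and>
           coord_norm (x - s *\<^sub>R d n) \<le> a"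
proof -
  obtain r where r: "strict_mono (r :: nat \<Rightarrow> nat)" "\<And>k. line_dist n (X (r k)) < a"
    using not_eventually_sequentiallyD[OF ev] by (auto simp: not_le)
  have "\<exists>t. coord_norm (X (r k) - t *\<^sub>R d n) < a \<and> (d n = 0 \<longrightarrow> t = 0)" for k
  proof -
    obtain t where "coord_norm (X (r k) - t *\<^sub>R d n) < a"
      using coset_norm_approx[OF normed_on_coord_norm subspace_line r(2)[of k, unfolded line_dist_def]]
      by (auto simp: line_def)
    \<comment> \<open>if \<open>d n = 0\<close>, the parameter is arbitrary and has to be fixed to stay bounded\<close>
    then show ?thesis by (intro exI[of _ "if d n = 0 then 0 else t"]) auto
  qed
  then obtain t where t: "\<And>k. coord_norm (X (r k) - t k *\<^sub>R d n) < a" "\<And>k. d n = 0 \<Longrightarrow> t k = 0" by metis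
  obtain K where K: "\<And>k. norm (X k) \<le> K"
    using X by (auto simp: coord_conv_def bounded_iff)
  have "\<bar>t k\<bar> \<le> (C * K + a) / coord_norm (d n)" for k
  proof (cases "d n = 0")
    case True
    then show ?thesis using t(2) normed_on_eq_0[OF normed_on_coord_norm, of 0] by simp
  next
    case False
    then have pos: "coord_norm (d n) > 0"
      using normed_on_eq_0[OF normed_on_coord_norm, of "d n"] normed_on_nonneg[OF normed_on_coord_norm, of "d n"]
      by simp
    have "\<bar>t k\<bar> * coord_norm (d n) = coord_norm (X (r k) - (X (r k) - t k *\<^sub>R d n))"
      by (simp add: normed_on_scale[OF normed_on_coord_norm])
    also have "\<dots> \<le> coord_norm (X (r k)) + coord_norm (X (r k) - t k *\<^sub>R d n)"
      by (intro normed_on_minus(1)[OF normed_on_coord_norm]) auto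
    also have "\<dots> \<le> C * K + a"
      using coord_norm_le[of "X (r k)"] K[of "r k"] C_pos t(1)[of k]
      by (smt (verit) mult_left_mono)
    finally show ?thesis using pos by (simp add: field_simps)
  qed
  then have "bounded (range t)"
    by (auto simp: bounded_iff)
  then obtain s u where u: "strict_mono u" "(t \<circ> u) \<longlonglongrightarrow> s"
    using bounded_imp_convergent_subsequence by blast
  have ru: "coord_conv (\<lambda>k. X (r (u k))) x"
    using coord_conv_subseq[OF coord_conv_subseq[OF X r(1)] u(1)] .
  have "coord_conv (\<lambda>k. X (r (u k)) - t (u k) *\<^sub>R d n) (x - s *\<^sub>R d n)"
    unfolding coord_conv_def
  proof (intro conjI allI)
    have "bounded (range (\<lambda>k. t (u k) *\<^sub>R d n))"
      using u(2) by (intro convergent_imp_bounded[of _ "s *\<^sub>R d n"] tendsto_intros) (simp add: o_def)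
    then show "bounded (range (\<lambda>k. X (r (u k)) - t (u k) *\<^sub>R d n))"
      using ru by (intro bounded_minus_comp) (auto simp: coord_conv_def)
    show "(\<lambda>k. e i (X (r (u k)) - t (u k) *\<^sub>R d n)) \<longlonglongrightarrow> e i (x - s *\<^sub>R d n)" for i
      unfolding linear_diff[OF lin] linear_scale[OF lin]
      using ru u(2) by (intro tendsto_intros) (auto simp: coord_conv_def o_def)
  qed
  then have "\<not> a < coord_norm (x - s *\<^sub>R d n)"
    using lsc_coord_norm t(1) unfolding lsc_def
    by (metis (no_types, lifting) eventually_sequentially not_less_iff_gr_or_eq order_refl)
  then show ?thesis
    using r(1) u t(1) strict_mono_o[OF r(1) u(1)]
    by (intro exI[of _ "r \<circ> u"] exI[of _ "t \<circ> u"] exI[of _ s]) auto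
qed

lemma lsc_line_dist: "lsc (line_dist n)"
  unfolding lsc_def
proof (intro allI impI)
  fix X x a assume X: "coord_conv X x" and a: "a < line_dist n x"
  then obtain b where b: "a < b" "b < line_dist n x" using dense by (meson Orderings.dense)
  have "line_dist n x \<le> coord_norm (x - s *\<^sub>R d n)" for s
    unfolding line_dist_def by (rule coset_norm_lower[OF normed_on_coord_norm subspace_line]) (auto simp: line_def)
  then have "\<forall>\<^sub>F k in sequentially. b \<le> line_dist n (X k)"
    using line_approximation[OF X, of b n] b(2) by (meson not_le order_trans)
  then show "\<forall>\<^sub>F k in sequentially. a < line_dist n (X k)"
    by eventually_elim (use b(1) in simp)
qed

lemma lsc_add:
  assumes "lsc f" "lsc g"
  shows "lsc (\<lambda>x. f x + g x)"
  unfolding lsc_def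
proof (intro allI impI)
  fix X x a assume X: "coord_conv X x" and a: "a < f x + g x"
  define \<delta> where "\<delta> = (f x + g x - a) / 2"
  have "\<forall>\<^sub>F k in sequentially. f x - \<delta> < f (X k)" "\<forall>\<^sub>F k in sequentially. g x - \<delta> < g (X k)"
    using assms X a unfolding lsc_def \<delta>_def by auto
  then show "\<forall>\<^sub>F k in sequentially. a < f (X k) + g (X k)"
    by eventually_elim (auto simp: \<delta>_def field_simps)
qed

lemma lsc_const: "lsc (\<lambda>x. r)"
  by (auto simp: lsc_def)

lemma lsc_scale:
  assumes "lsc f" "r \<ge> 0"
  shows "lsc (\<lambda>x. r * f x)"
proof (cases "r = 0")
  case True
  then show ?thesis by (simp add: lsc_const)
next
  case False
  then have r: "r > 0" using assms(2) by simp
  show ?thesis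
    unfolding lsc_def
  proof (intro allI impI)
    fix X x a assume X: "coord_conv X x" and a: "a < r * f x"
    have "a / r < f x" using a r by (simp add: field_simps)
    then have "\<forall>\<^sub>F k in sequentially. a / r < f (X k)"
      using assms(1) X unfolding lsc_def by blast
    then show "\<forall>\<^sub>F k in sequentially. a < r * f (X k)"
      by eventually_elim (use r in \<open>simp add: field_simps\<close>)
  qed
qed

lemma lsc_suminf:
  assumes lsc: "\<And>m. lsc (f m)" and nonneg: "\<And>m x. 0 \<le> f m x" and sum: "\<And>x. summable (\<lambda>m. f m x)"
  shows "lsc (\<lambda>x. \<Sum>m. f m x)"
  unfolding lsc_def
proof (intro allI impI)
  fix X x a assume X: "coord_conv X x" and a: "a < (\<Sum>m. f m x)"
  obtain n where n: "a < (\<Sum>m<n. f m x)"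
    using order_tendstoD(1)[OF summable_LIMSEQ[OF sum[of x]] a]
    by (auto simp: eventually_sequentially)
  have "lsc (\<lambda>x. \<Sum>m<n. f m x)"
  proof (induction n)
    case (Suc n)
    then show ?case using lsc_add[OF Suc lsc[of n]] by simp
  qed (simp add: lsc_const)
  then have "\<forall>\<^sub>F k in sequentially. a < (\<Sum>m<n. f m (X k))"
    using X n by (auto simp: lsc_def)
  then show "\<forall>\<^sub>F k in sequentially. a < (\<Sum>m. f m (X k))"
  proof eventually_elim
    case (elim k)
    also have "(\<Sum>m<n. f m (X k)) \<le> (\<Sum>m. f m (X k))"
      using nonneg by (intro sum_le_suminf sum) auto
    finally show ?case .
  qed
qed

lemma weighted_summable:
  assumes "\<And>n. 0 \<le> r n" "\<And>n. r n \<le> (1/2) ^ Suc n"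
  shows "summable (\<lambda>n. r n * line_dist n x)"
proof (rule summable_comparison_test')
  show "summable (\<lambda>n. (1/2::real) ^ Suc n * coord_norm x)"
    using power_half_series by (intro summable_mult2) (rule sums_summable)
  show "norm (r n * line_dist n x) \<le> (1/2) ^ Suc n * coord_norm x" for n
    using mult_mono[OF assms(2)[of n] line_dist_le[of n x] _ line_dist_nonneg] assms(1)[of n]
      line_dist_nonneg[of n x] by (simp add: abs_mult)
qed

lemmas kk_norm_summable = weighted_summable[where r = "\<lambda>n. (1/2) ^ Suc n", OF _ order_refl]

lemma coord_norm_le_kk_norm: "coord_norm x \<le> kk_norm x"
  unfolding kk_norm_def using suminf_nonneg[OF kk_norm_summable, of x] line_dist_nonneg
  by (simp del: power_Suc)

lemma kk_norm_le: "kk_norm x \<le> 2 * coord_norm x"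
proof -
  have "(\<Sum>n. (1/2) ^ Suc n * line_dist n x) \<le> (\<Sum>n. (1/2) ^ Suc n * coord_norm x)"
    using line_dist_le by (intro suminf_le weighted_summable summable_mult2
        sums_summable[OF power_half_series]) auto
  also have "\<dots> = coord_norm x"
    using sums_unique[OF sums_mult2[OF power_half_series, of "coord_norm x"]] by simp
  finally show ?thesis by (simp add: kk_norm_def)
qed

lemma normed_on_kk_norm: "normed_on UNIV kk_norm"
  unfolding normed_on_def
proof (intro conjI ballI allI)
  show "subspace (UNIV :: 'v set)" by simp
  fix x y :: 'v and r :: real
  show nonneg: "0 \<le> kk_norm x"
    using coord_norm_le_kk_norm[of x] normed_on_nonneg[OF normed_on_coord_norm, of x] by simp
  show "kk_norm x = 0 \<longleftrightarrow> x = 0"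
    using coord_norm_le_kk_norm[of x] kk_norm_le[of x] normed_on_eq_0[OF normed_on_coord_norm, of x]
      normed_on_nonneg[OF normed_on_coord_norm, of x] by (metis UNIV_I mult_zero_right order_antisym nonneg)
  have "(\<Sum>n. (1/2) ^ Suc n * line_dist n (r *\<^sub>R x)) = (\<Sum>n. \<bar>r\<bar> * ((1/2) ^ Suc n * line_dist n x))"
    by (simp add: line_dist_def coset_norm_scale[OF normed_on_coord_norm subspace_line] mult.left_commute)
  also have "\<dots> = \<bar>r\<bar> * (\<Sum>n. (1/2) ^ Suc n * line_dist n x)"
    by (intro suminf_mult kk_norm_summable) auto
  finally show "kk_norm (r *\<^sub>R x) = \<bar>r\<bar> * kk_norm x"
    by (simp add: kk_norm_def normed_on_scale[OF normed_on_coord_norm] distrib_left)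
  have "(\<Sum>n. (1/2) ^ Suc n * line_dist n (x + y)) \<le> (\<Sum>n. (1/2) ^ Suc n * line_dist n x + (1/2) ^ Suc n * line_dist n y)"
    using coset_norm_triangle[OF normed_on_coord_norm subspace_line]
    by (intro suminf_le kk_norm_summable summable_add) (auto simp: line_dist_def distrib_left[symmetric])
  also have "\<dots> = (\<Sum>n. (1/2) ^ Suc n * line_dist n x) + (\<Sum>n. (1/2) ^ Suc n * line_dist n y)"
    by (intro suminf_add[symmetric] kk_norm_summable) auto
  finally show "kk_norm (x + y) \<le> kk_norm x + kk_norm y"
    using normed_on_triangle[OF normed_on_coord_norm, of x y] by (simp add: kk_norm_def)
qed

lemma lsc_kk_norm: "lsc kk_norm"
  unfolding kk_norm_def[abs_def]
  by (intro lsc_add lsc_coord_norm lsc_suminf lsc_scale lsc_line_dist weighted_summable) (auto simp: line_dist_nonneg)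

text \<open>
  Every summand of \<open>kk_norm\<close> is lower semicontinuous, so none of them can lose mass in the limit when the sum
  does not grow: each distance to a line converges.  Choosing a line that passes close to \<open>x\<close>, the
  \<open>X k\<close> are eventually close to it as well, and \<open>line_approximation\<close> identifies the points of the line that they
  approach.
\<close>

lemma kk_norm_Kadec_Klee:
  assumes X: "coord_conv X x"
    and ev: "\<And>\<epsilon>. \<epsilon> > 0 \<Longrightarrow> \<forall>\<^sub>F k in sequentially. kk_norm (X k) < kk_norm x + \<epsilon>"
  shows "(\<lambda>k. kk_norm (X k - x)) \<longlonglongrightarrow> 0"
proof -
  note N = normed_on_coord_norm
  have line_dist_conv: "\<forall>\<^sub>F k in sequentially. line_dist n (X k) < line_dist n x + \<epsilon>" if \<epsilon>: "\<epsilon> > 0" for n \<epsilon>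
  proof -
    \<comment> \<open>the part of the norm other than the distance to the line \<open>n\<close>, again lower semicontinuous\<close>
    define w where "w m = (if m = n then 0 else (1/2::real) ^ Suc m)" for m
    define R where "R x = coord_norm x + (\<Sum>m. w m * line_dist m x)" for x
    have w: "0 \<le> w m" "w m \<le> (1/2) ^ Suc m" for m by (auto simp: w_def)
    have "lsc R"
      unfolding R_def[abs_def]
      by (intro lsc_add lsc_coord_norm lsc_suminf lsc_scale lsc_line_dist weighted_summable w)
        (auto simp: line_dist_nonneg w)
    have split: "kk_norm z = R z + (1/2) ^ Suc n * line_dist n z" for z
    proof -
      have "(\<lambda>m. if m = n then (1/2) ^ Suc m * line_dist m z else 0) sums ((1/2) ^ Suc n * line_dist n z)"
        by (rule sums_single)
      from sums_add[OF summable_sums[OF weighted_summable[OF w]] this]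
      have "(\<lambda>m. (1/2) ^ Suc m * line_dist m z) sums ((\<Sum>m. w m * line_dist m z) + (1/2) ^ Suc n * line_dist n z)"
        by (rule sums_cong[THEN iffD1, rotated]) (auto simp: w_def)
      then show ?thesis
        by (simp add: kk_norm_def R_def sums_unique[symmetric])
    qed
    define \<eta> where "\<eta> = (1/2) ^ Suc n * \<epsilon> / 2"
    have \<eta>: "\<eta> > 0" using \<epsilon> by (simp add: \<eta>_def)
    have "\<forall>\<^sub>F k in sequentially. R x - \<eta> < R (X k)"
      using \<open>lsc R\<close> X \<eta> by (auto simp: lsc_def)
    then show ?thesis using ev[OF \<eta>]
    proof eventually_elim
      case (elim k)
      then have "(1/2) ^ Suc n * line_dist n (X k) < (1/2) ^ Suc n * (line_dist n x + \<epsilon>)"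
        unfolding split \<eta>_def by (simp add: distrib_left)
      then show ?case by simp
    qed
  qed
  have coord_norm_conv: "\<forall>\<^sub>F k in sequentially. coord_norm (X k - x) < \<epsilon>" if \<epsilon>: "\<epsilon> > 0" for \<epsilon>
  proof (rule ccontr)
    assume "\<not> ?thesis"
    then obtain r where r: "strict_mono (r :: nat \<Rightarrow> nat)" "\<And>k. \<not> coord_norm (X (r k) - x) < \<epsilon>"
      using not_eventually_sequentiallyD by blast
    have Xr: "coord_conv (\<lambda>k. X (r k)) x" by (rule coord_conv_subseq[OF X r(1)])
    obtain n where n: "norm (x - d n) < \<epsilon> / (8 * C)"
      using dense[of "\<epsilon> / (8 * C)"] \<epsilon> C_pos by auto
    have "d n \<in> line n"
      unfolding line_def by (rule range_eqI[of _ _ 1]) simp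
    then have "line_dist n x \<le> coord_norm (x - d n)"
      unfolding line_dist_def by (rule coset_norm_lower[OF N subspace_line])
    also have "\<dots> < \<epsilon> / 8"
      using coord_norm_le[of "x - d n"] n C_pos by (simp add: field_simps)
    finally have qx: "line_dist n x < \<epsilon> / 8" .
    have "\<forall>\<^sub>F k in sequentially. line_dist n (X (r k)) < line_dist n x + \<epsilon> / 8"
      using \<epsilon> by (intro eventually_subseq[OF r(1)] line_dist_conv) auto
    then have line_dist_small: "\<forall>\<^sub>F k in sequentially. \<not> \<epsilon> / 4 \<le> line_dist n (X (r k))"
      by eventually_elim (use qx in simp)
    have "\<not> (\<forall>\<^sub>F k in sequentially. \<epsilon> / 4 \<le> line_dist n (X (r k)))"
    proof
      assume "\<forall>\<^sub>F k in sequentially. \<epsilon> / 4 \<le> line_dist n (X (r k))"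
      with line_dist_small have "\<forall>\<^sub>F k in sequentially. False"
        by eventually_elim simp
      then show False by simp
    qed
    then obtain u t s where u: "strict_mono u" "t \<longlonglongrightarrow> s"
      "\<And>k. coord_norm (X (r (u k)) - t k *\<^sub>R d n) < \<epsilon> / 4" "coord_norm (x - s *\<^sub>R d n) \<le> \<epsilon> / 4"
      using line_approximation[OF Xr] by blast
    have "(\<lambda>k. \<bar>t k - s\<bar> * coord_norm (d n)) \<longlonglongrightarrow> \<bar>s - s\<bar> * coord_norm (d n)"
      by (intro tendsto_intros u(2))
    then have "\<forall>\<^sub>F k in sequentially. \<bar>t k - s\<bar> * coord_norm (d n) < \<epsilon> / 4"
      using \<epsilon> by (intro order_tendstoD(2)) auto
    then obtain k where k: "\<bar>t k - s\<bar> * coord_norm (d n) < \<epsilon> / 4"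
      by (auto dest: eventually_happens)
    have "coord_norm (X (r (u k)) - x) =
        coord_norm ((X (r (u k)) - t k *\<^sub>R d n) + ((t k - s) *\<^sub>R d n - (x - s *\<^sub>R d n)))"
      by (simp add: algebra_simps)
    also have "\<dots> \<le> coord_norm (X (r (u k)) - t k *\<^sub>R d n) + (coord_norm ((t k - s) *\<^sub>R d n) + coord_norm (x - s *\<^sub>R d n))"
      using normed_on_triangle[OF N] normed_on_minus(1)[OF N] UNIV_I by (meson add_left_mono order_trans)
    also have "\<dots> < \<epsilon>"
      using u(3)[of k] u(4) k normed_on_scale[OF N, of "d n" "t k - s"] \<epsilon> by simp
    finally show False using r(2) by blast
  qed
  show ?thesis
  proof (rule tendstoI)
    fix \<epsilon> :: real assume "\<epsilon> > 0"
    then have "\<forall>\<^sub>F k in sequentially. coord_norm (X k - x) < \<epsilon> / 2" by (intro coord_norm_conv) auto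
    then show "\<forall>\<^sub>F k in sequentially. dist (kk_norm (X k - x)) 0 < \<epsilon>"
    proof eventually_elim
      case (elim k)
      then show ?case
        using kk_norm_le[of "X k - x"] normed_on_nonneg[OF normed_on_kk_norm, of "X k - x"] by simp
    qed
  qed
qed

end

section \<open>The inverse system of a coordinate dual\<close>

text \<open>
  The biorthogonal system lets the spaces of values of finitely many functionals \<open>e i\<close> be subspaces of the type
  \<open>'u\<close>, with the bonding maps given by truncation.
\<close>

locale embedded_coordinate_dual = coordinate_dual e c C d
  for e :: "nat \<Rightarrow> 'v::banach \<Rightarrow> real" and c C d +
  fixes b :: "nat \<Rightarrow> 'u::real_vector" and \<beta> :: "nat \<Rightarrow> 'u \<Rightarrow> real"
  assumes linear_\<beta>: "linear (\<beta> i)" and biorthogonal: "\<beta> i (b k) = (if i = k then 1 else 0)"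
begin

definition P :: "nat \<Rightarrow> 'v \<Rightarrow> 'u" where "P j x = (\<Sum>i<j. e i x *\<^sub>R b i)"

definition W :: "nat \<Rightarrow> 'u set" where "W j = range (P j)"

definition N :: "nat \<Rightarrow> 'u \<Rightarrow> real" where "N j w = (INF x\<in>{x. P j x = w}. kk_norm x)"

definition \<theta> :: "nat \<Rightarrow> 'u \<Rightarrow> 'u" where "\<theta> j w = (\<Sum>i<j. \<beta> i w *\<^sub>R b i)"

definition S :: "'v \<Rightarrow> nat \<Rightarrow> 'u" where "S x = (\<lambda>j. P j x)"

lemma linear_P: "linear (P j)"
  unfolding P_def[abs_def]
  by (intro linear_compose_sum ballI linearI)
    (auto simp: linear_add[OF lin] linear_scale[OF lin] scaleR_add_left)

lemma linear_\<theta>: "linear (\<theta> j)"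
  unfolding \<theta>_def[abs_def]
  by (intro linear_compose_sum ballI linearI)
    (auto simp: linear_add[OF linear_\<beta>] linear_scale[OF linear_\<beta>] scaleR_add_left)

lemma \<beta>_sum: "\<beta> i (\<Sum>k<j. a k *\<^sub>R b k) = (if i < j then a i else 0)"
  by (simp add: linear_sum[OF linear_\<beta>] linear_scale[OF linear_\<beta>] biorthogonal if_distrib
      cong: if_cong)

lemma \<beta>_P: "i < j \<Longrightarrow> \<beta> i (P j x) = e i x"
  by (simp add: P_def \<beta>_sum)

lemma P_eq_iff: "P j x = P j y \<longleftrightarrow> (\<forall>i<j. e i x = e i y)"
proof
  assume "P j x = P j y"
  then show "\<forall>i<j. e i x = e i y"
    using \<beta>_P[of _ j x] \<beta>_P[of _ j y] by metis
qed (simp add: P_def)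

lemma \<theta>_P: "\<theta> j (P (Suc j) x) = P j x"
  unfolding \<theta>_def P_def[of j] by (intro sum.cong) (auto simp: \<beta>_P)

lemma subspace_W: "subspace (W j)"
  unfolding W_def by (intro linear_subspace_image linear_P) simp

lemma finite_dim_W: "\<exists>B. finite B \<and> span B = W j"
proof -
  obtain B where B: "B \<subseteq> W j" "independent B" "W j \<subseteq> span B"
    using maximal_independent_subset by blast
  have "P j x \<in> span (b ` {..<j})" for x
    unfolding P_def by (intro span_sum span_scale span_base imageI)
  then have "W j \<subseteq> span (b ` {..<j})" by (auto simp: W_def)
  then have "finite B"
    using independent_span_bound[of "b ` {..<j}" B] B by auto
  moreover have "span B = W j"
    using B span_minimal[OF B(1) subspace_W] by blast
  ultimately show ?thesis by blast
qed

lemma subspace_kernel_P: "subspace {y. P j y = 0}"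
  by (rule linear_subspace_kernel[OF linear_P])

lemma N_P: "N j (P j x) = coset_norm kk_norm {y. P j y = 0} x"
proof -
  have "{z. P j z = P j x} = (\<lambda>y. x - y) ` {y. P j y = 0}"
  proof (intro set_eqI iffI)
    fix z assume "z \<in> {z. P j z = P j x}"
    then show "z \<in> (\<lambda>y. x - y) ` {y. P j y = 0}"
      by (intro image_eqI[of _ _ "x - z"]) (auto simp: linear_diff[OF linear_P])
  qed (auto simp: linear_diff[OF linear_P])
  then show ?thesis
    by (simp add: N_def coset_norm_def image_image)
qed

lemma N_P_le: "P j z = P j x \<Longrightarrow> N j (P j x) \<le> kk_norm z"
  using coset_norm_le[OF normed_on_kk_norm subspace_kernel_P, of j z] N_P[of j z] by simp

lemma N_P_approx:
  assumes "N j (P j x) < a"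
  obtains z where "P j z = P j x" "kk_norm z < a"
proof -
  obtain y where "P j y = 0" "kk_norm (x - y) < a"
    using coset_norm_approx[OF normed_on_kk_norm subspace_kernel_P assms[unfolded N_P]] by blast
  then show thesis
    using that[of "x - y"] by (simp add: linear_diff[OF linear_P])
qed

text \<open>
  The functionals \<open>e i\<close> with \<open>i < j\<close> factor through \<open>W j\<close>, with norm at most \<open>1\<close>.  This makes the quotient seminorm
  definite and turns convergence in the \<open>W j\<close> into convergence of all \<open>e i\<close>.
\<close>

lemma e_le_N: "i < j \<Longrightarrow> \<bar>e i x\<bar> \<le> N j (P j x)"
  unfolding N_P
proof (rule coset_norm_greatest[OF normed_on_kk_norm subspace_kernel_P])
  fix y assume "i < j" "y \<in> {y. P j y = 0}"
  then have "e i y = 0"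
    using P_eq_iff[of j y 0] linear_0[OF linear_P] linear_0[OF lin] by auto
  then show "\<bar>e i x\<bar> \<le> kk_norm (x - y)"
    using e_le_coord_norm[of i "x - y"] coord_norm_le_kk_norm[of "x - y"] by (simp add: linear_diff[OF lin])
qed

lemma normed_on_N: "normed_on (W j) (N j)"
proof -
  note K = normed_on_kk_norm subspace_kernel_P
  have "0 \<le> N j (P j x)" for x
    unfolding N_P by (rule coset_norm_nonneg[OF K])
  moreover have "N j (P j x) = 0 \<longleftrightarrow> P j x = 0" for x
  proof
    assume "N j (P j x) = 0"
    then have "e i x = e i 0" if "i < j" for i
      using e_le_N[OF that, of x] linear_0[OF lin] by simp
    then show "P j x = 0"
      using P_eq_iff[of j x 0] linear_0[OF linear_P] by simp
  next
    assume "P j x = 0"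
    then have "N j (P j x) \<le> kk_norm 0" using linear_0[OF linear_P] by (intro N_P_le) simp
    also have "kk_norm 0 = 0" using normed_on_eq_0[OF normed_on_kk_norm, of 0] by simp
    finally show "N j (P j x) = 0" using coset_norm_nonneg[OF K, of j x] by (simp add: N_P)
  qed
  moreover have "N j (r *\<^sub>R P j x) = \<bar>r\<bar> * N j (P j x)" for r x
    unfolding linear_scale[OF linear_P, symmetric] N_P by (rule coset_norm_scale[OF K])
  moreover have "N j (P j x + P j y) \<le> N j (P j x) + N j (P j y)" for x y
    unfolding linear_add[OF linear_P, symmetric] N_P by (rule coset_norm_triangle[OF K])
  ultimately show ?thesis
    using subspace_W[of j] unfolding normed_on_def by (auto simp: W_def)
qed

lemma standard_inverse_system_W: "standard_inverse_system W N \<theta>"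
  unfolding standard_inverse_system_def
proof (intro conjI allI ballI)
  fix i
  show "\<exists>B. finite B \<and> span B = W i" by (rule finite_dim_W)
  then obtain B where "finite B" "span B = W i" by blast
  then show "banach_on (W i) (N i)"
    using finite_dim_banach_on[of B "N i"] normed_on_N[of i] by simp
  show "linear_on (W (Suc i)) (\<theta> i)" by (rule linear_imp_linear_on[OF linear_\<theta>])
  show "\<theta> i \<in> W (Suc i) \<rightarrow> W i" by (auto simp: W_def \<theta>_P)
  fix w assume "w \<in> W (Suc i)"
  then obtain x where w: "w = P (Suc i) x" by (auto simp: W_def)
  show "N i (\<theta> i w) \<le> N (Suc i) w"
  proof (rule field_le_epsilon)
    fix \<epsilon> :: real assume "\<epsilon> > 0"
    then obtain z where z: "P (Suc i) z = P (Suc i) x" "kk_norm z < N (Suc i) w + \<epsilon>"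
      using N_P_approx[of "Suc i" x "N (Suc i) w + \<epsilon>"] w by auto
    then have "P i z = P i x" by (simp add: P_eq_iff)
    then have "N i (P i x) \<le> kk_norm z" by (rule N_P_le)
    then show "N i (\<theta> i w) \<le> N (Suc i) w + \<epsilon>"
      using z by (simp add: w \<theta>_P)
  qed
qed

lemma S_in_limit: "S x \<in> inverse_limit W N \<theta>"
  using N_P_le[OF refl] by (auto simp: inverse_limit_def S_def W_def \<theta>_P intro!: bdd_aboveI2)

text \<open>
  Were the limit smaller, there would be vectors \<open>z k\<close> of smaller norm with the same first \<open>r k\<close> coordinates as
  \<open>x\<close>; they converge to \<open>x\<close> coordinatewise, against lower semicontinuity.
\<close>

lemma N_P_tendsto: "(\<lambda>j. N j (P j x)) \<longlonglongrightarrow> kk_norm x"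
proof (rule order_tendstoI)
  fix a assume "kk_norm x < a"
  then show "\<forall>\<^sub>F j in sequentially. N j (P j x) < a"
    using N_P_le[OF refl] le_less_trans by (intro always_eventually allI) blast
next
  fix a assume "a < kk_norm x"
  then obtain a' where a': "a < a'" "a' < kk_norm x" using Orderings.dense by blast
  show "\<forall>\<^sub>F j in sequentially. a < N j (P j x)"
  proof (rule ccontr)
    assume "\<not> ?thesis"
    then obtain r where r: "strict_mono (r :: nat \<Rightarrow> nat)" "\<And>k. \<not> a < N (r k) (P (r k) x)"
      using not_eventually_sequentiallyD by blast
    have "\<exists>z. P (r k) z = P (r k) x \<and> kk_norm z < a'" for k
      using N_P_approx[of "r k" x a'] r(2)[of k] a' by auto
    then obtain z where z: "\<And>k. P (r k) (z k) = P (r k) x" "\<And>k. kk_norm (z k) < a'" by metis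
    have "norm (z k) \<le> a' / c" for k
      using z(2)[of k] coord_norm_le_kk_norm[of "z k"] coord_norm_ge[of "z k"] c_pos by (simp add: field_simps)
    then have "bounded (range z)" by (auto simp: bounded_iff)
    moreover have "(\<lambda>k. e i (z k)) \<longlonglongrightarrow> e i x" for i
    proof (rule tendsto_eventually)
      have "e i (z k) = e i x" if "k \<ge> Suc i" for k
        using z(1)[of k] seq_suble[OF r(1), of k] that by (auto simp: P_eq_iff)
      then show "\<forall>\<^sub>F k in sequentially. e i (z k) = e i x"
        by (auto simp: eventually_sequentially)
    qed
    ultimately have "coord_conv z x" by (simp add: coord_conv_def)
    then have "\<forall>\<^sub>F k in sequentially. a' < kk_norm (z k)"
      using lsc_kk_norm a'(2) by (simp add: lsc_def)
    then show False using z(2) by (auto simp: eventually_sequentially dest: less_asym)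
  qed
qed

lemma limit_norm_S: "limit_norm N (S x) = kk_norm x"
  unfolding limit_norm_def S_def by (rule limI[OF N_P_tendsto])

text \<open>
  Almost norm-preserving lifts of the entries of a point of the limit form a bounded sequence whose
  coordinates are eventually constant, so \<open>sequential_compactness\<close> provides a preimage.
\<close>

lemma inverse_limit_eq: "inverse_limit W N \<theta> = range S"
proof (intro antisym subsetI)
  fix w assume w: "w \<in> inverse_limit W N \<theta>"
  then have wW: "\<And>j. w j \<in> W j" and w\<theta>: "\<And>j. \<theta> j (w (Suc j)) = w j"
    by (auto simp: inverse_limit_def)
  have "\<exists>x. P j x = w j \<and> kk_norm x < limit_norm N w + 1" for j
  proof -
    obtain y where y: "w j = P j y" using wW[of j] by (auto simp: W_def)
    have "N j (P j y) < limit_norm N w + 1"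
      using limit_norm_tendsto(2)[OF standard_inverse_system_W w, of j] y by simp
    from N_P_approx[OF this] y show ?thesis by metis
  qed
  then obtain X where X: "\<And>j. P j (X j) = w j" "\<And>j. kk_norm (X j) < limit_norm N w + 1" by metis
  have "norm (X k) \<le> (limit_norm N w + 1) / c" for k
    using X(2)[of k] coord_norm_le_kk_norm[of "X k"] coord_norm_ge[of "X k"] c_pos by (simp add: field_simps)
  then have bdd: "bounded (range X)" by (auto simp: bounded_iff)
  have \<beta>w: "\<beta> i (w j) = \<beta> i (w (Suc i))" if "Suc i \<le> j" for i j
    using that
  proof (induction j rule: dec_induct)
    case (step j)
    have "\<beta> i (w j) = \<beta> i (w (Suc j))"
      using step(1) w\<theta>[of j] \<beta>_sum[of i "\<lambda>i. \<beta> i (w (Suc j))" j] by (simp add: \<theta>_def)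
    then show ?case using step by simp
  qed simp
  have eX: "e i (X j) = \<beta> i (w (Suc i))" if "Suc i \<le> j" for i j
    using \<beta>_P[of i j "X j"] X(1)[of j] \<beta>w[OF that] that by simp
  have lim: "(\<lambda>j. e i (X j)) \<longlonglongrightarrow> \<beta> i (w (Suc i))" for i
    using eX by (intro tendsto_eventually) (auto simp: eventually_sequentially)
  then obtain x where "\<And>i. (\<lambda>k. e i (X k)) \<longlonglongrightarrow> e i x"
    using sequential_compactness[OF bdd] by (auto simp: convergent_def)
  then have ex: "e i x = \<beta> i (w (Suc i))" for i
    using LIMSEQ_unique lim by blast
  have "S x j = w j" for j
    using P_eq_iff[of j x "X j"] ex eX[of _ j] X(1)[of j] by (simp add: S_def)
  then have "w = S x" by (intro ext) simp
  then show "w \<in> range S" by blast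
qed (use S_in_limit in auto)

lemma linear_S: "linear S"
  by (intro linearI)
    (auto simp: S_def fun_eq_iff linear_add[OF linear_P] linear_scale[OF linear_P] scaleR_fun_def)

text \<open>
  Convergence of the projections gives a coordinatewise limit \<open>x\<close> and convergence of the norms in each \<open>W j\<close>.
  Uniformity allows the exchange of the limits in \<open>j\<close> and in \<open>k\<close>, so the norms do not exceed that of \<open>x\<close> asymptotically,
  and the Kadec--Klee property applies.
\<close>

lemma determining_property_S: "determining_property W N (range S)"
  unfolding determining_property_def
proof (intro allI impI, elim conjE)
  fix v :: "nat \<Rightarrow> nat \<Rightarrow> 'u"
  assume v: "range v \<subseteq> range S"
    and lim: "\<forall>j. \<exists>l. limitin (norm_topology (W j) (N j)) (\<lambda>k. v k j) l sequentially"
    and bdd: "bdd_above (range (\<lambda>k. limit_norm N (v k)))"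
    and unif: "uniform_limit UNIV (\<lambda>j k. N j (v k j)) (\<lambda>k. limit_norm N (v k)) sequentially"
  have "\<forall>k. \<exists>x. v k = S x" using v by blast
  then obtain X where X: "\<And>k. v k = S (X k)" by metis
  have vP: "v k j = P j (X k)" for k j by (simp add: X S_def)
  have conv: "\<exists>y. (\<lambda>k. N j (P j (X k) - P j y)) \<longlonglongrightarrow> 0" for j
  proof -
    obtain l where l: "limitin (norm_topology (W j) (N j)) (\<lambda>k. v k j) l sequentially"
      using lim by blast
    then have "l \<in> W j" by (simp add: limitin_norm_topology[OF normed_on_N])
    then obtain y where y: "l = P j y" by (auto simp: W_def)
    from l show ?thesis
      by (subst (asm) limitin_norm_topology_tendsto[OF normed_on_N])
        (auto simp: vP y W_def intro!: exI[of _ y])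
  qed
  have e_conv: "(\<lambda>k. e i (X k)) \<longlonglongrightarrow> e i y"
    if "i < j" "(\<lambda>k. N j (P j (X k) - P j y)) \<longlonglongrightarrow> 0" for i j y
  proof -
    have "\<bar>e i (X k - y)\<bar> \<le> N j (P j (X k) - P j y)" for k
      using e_le_N[OF that(1), of "X k - y"] by (simp add: linear_diff[OF linear_P])
    then have "(\<lambda>k. e i (X k - y)) \<longlonglongrightarrow> 0"
      by (intro Lim_null_comparison[OF _ that(2)]) auto
    then show ?thesis by (simp add: linear_diff[OF lin] LIM_zero_iff)
  qed
  obtain K where K: "\<And>k. kk_norm (X k) \<le> K"
    using bdd by (auto simp: bdd_above_def X limit_norm_S)
  have "norm (X k) \<le> K / c" for k
    using K[of k] coord_norm_le_kk_norm[of "X k"] coord_norm_ge[of "X k"] c_pos by (simp add: field_simps)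
  then have bddX: "bounded (range X)" by (auto simp: bounded_iff)
  have "convergent (\<lambda>k. e i (X k))" for i
    using conv[of "Suc i"] e_conv[of i "Suc i"] by (auto simp: convergent_def)
  then obtain x where x: "\<And>i. (\<lambda>k. e i (X k)) \<longlonglongrightarrow> e i x"
    using sequential_compactness[OF bddX] by blast
  have Xx: "coord_conv X x" using bddX x by (simp add: coord_conv_def)
  have Nconv: "(\<lambda>k. N j (P j (X k))) \<longlonglongrightarrow> N j (P j x)" for j
  proof -
    obtain y where y: "(\<lambda>k. N j (P j (X k) - P j y)) \<longlonglongrightarrow> 0" using conv by blast
    have "P j y = P j x"
      using e_conv[OF _ y] x LIMSEQ_unique unfolding P_eq_iff by blast
    then have "(\<lambda>k. N j (P j (X k) - P j x)) \<longlonglongrightarrow> 0" using y by simp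
    then have "(\<lambda>k. N j (P j (X k)) - N j (P j x)) \<longlonglongrightarrow> 0"
      by (rule Lim_null_comparison[rotated])
        (use normed_on_minus(3)[OF normed_on_N] in \<open>auto simp: W_def\<close>)
    then show ?thesis by (simp add: LIM_zero_iff)
  qed
  have "\<forall>\<^sub>F k in sequentially. kk_norm (X k) < kk_norm x + \<epsilon>" if \<epsilon>: "\<epsilon> > 0" for \<epsilon>
  proof -
    obtain j where j: "\<And>k. dist (N j (v k j)) (limit_norm N (v k)) < \<epsilon> / 2"
      using uniform_limitD[OF unif, of "\<epsilon> / 2"] \<epsilon> by (auto simp: eventually_sequentially)
    have "N j (P j x) < kk_norm x + \<epsilon> / 2" using N_P_le[of j x x] \<epsilon> by simp
    then have "\<forall>\<^sub>F k in sequentially. N j (P j (X k)) < kk_norm x + \<epsilon> / 2"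
      by (rule order_tendstoD(2)[OF Nconv])
    then show ?thesis
    proof eventually_elim
      case (elim k)
      then show ?case
        using j[of k] limit_norm_S[of "X k"] unfolding vP X[symmetric] dist_real_def abs_less_iff
        by linarith
    qed
  qed
  then have "(\<lambda>k. kk_norm (X k - x)) \<longlonglongrightarrow> 0"
    by (rule kk_norm_Kadec_Klee[OF Xx])
  then have "(\<lambda>k. limit_norm N (v k - S x)) \<longlonglongrightarrow> 0"
    by (simp add: X linear_diff[OF linear_S, symmetric] limit_norm_S)
  moreover have "normed_on (range S) (limit_norm N)"
    using normed_on_inverse_limit[OF standard_inverse_system_W] by (simp add: inverse_limit_eq)
  ultimately show "\<exists>l. limitin (norm_topology (range S) (limit_norm N)) v l sequentially"
    by (intro exI[of _ "S x"], subst limitin_norm_topology_tendsto) (auto simp: X)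
qed

lemma GFDA_S: "GFDA W N \<theta> (range S)"
proof -
  note norm = normed_on_inverse_limit[OF standard_inverse_system_W, unfolded inverse_limit_eq]
  have "norm_quotient_map (range S) (limit_norm N) (W i) (N i) (\<lambda>w. w i)" for i
    unfolding norm_quotient_map_def
  proof (intro conjI ballI)
    show "linear_on (range S) (\<lambda>w. w i)"
      by (auto simp: linear_on_def scaleR_fun_def)
    show "(\<lambda>w. w i) ` range S = W i"
      by (auto simp: W_def S_def)
    fix w assume "w \<in> W i"
    have "{a \<in> range S. a i = w} = S ` {x. P i x = w}" by (auto simp: S_def)
    then show "N i w = (INF a\<in>{a \<in> range S. a i = w}. limit_norm N a)"
      by (simp add: N_def image_image limit_norm_S)
  qed
  moreover have "closedin (norm_topology (range S) (limit_norm N)) (range S)"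
    using topspace_norm_topology[OF norm] closedin_topspace[of "norm_topology (range S) (limit_norm N)"]
    by simp
  ultimately show ?thesis
    unfolding GFDA_def inverse_limit_eq
    using standard_inverse_system_W determining_property_S normed_on_subspace[OF norm] by blast
qed

lemma admits_GFDA_coordinate_dual: "admits_GFDA TYPE('u) (UNIV :: 'v set) norm"
proof -
  have normed: "normed_on (range S) (limit_norm N)"
    using normed_on_inverse_limit[OF standard_inverse_system_W] by (simp add: inverse_limit_eq)
  have "isomorphic_on (UNIV :: 'v set) norm (range S) (limit_norm N)"
    unfolding isomorphic_on_iff[OF normed_on_UNIV normed]
  proof (rule exI[of _ S], rule exI[of _ c], rule exI[of _ "2 * C"], intro conjI ballI)
    fix x :: 'v
    show "c * norm x \<le> limit_norm N (S x)"
      using coord_norm_ge[of x] coord_norm_le_kk_norm[of x] by (simp add: limit_norm_S)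
    show "limit_norm N (S x) \<le> 2 * C * norm x"
      using kk_norm_le[of x] coord_norm_le[of x] by (simp add: limit_norm_S)
  qed (use linear_imp_linear_on[OF linear_S] c_pos C_pos in auto)
  then show ?thesis
    unfolding admits_GFDA_def using GFDA_S by blast
qed

end

section \<open>Spaces of continuum dimension\<close>

lemma biorthogonal_sequence:
  assumes "has_continuum_dimension TYPE('u::real_vector)"
  shows "\<exists>(b :: nat \<Rightarrow> 'u) \<beta> :: nat \<Rightarrow> 'u \<Rightarrow> real.
           (\<forall>i. linear (\<beta> i)) \<and> (\<forall>i k. \<beta> i (b k) = (if i = k then 1 else 0))"
proof -
  obtain B :: "'u set" and g :: "real \<Rightarrow> 'u" where B: "independent B" "inj g" "range g \<subseteq> B"
    using assms by (auto simp: has_continuum_dimension_def lepoll_def)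
  define b where "b n = g (real n)" for n
  have ind: "independent (range b)"
    using B(3) by (intro independent_mono[OF B(1)]) (auto simp: b_def)
  have inj: "b i = b k \<longleftrightarrow> i = k" for i k
    using B(2) by (auto simp: b_def inj_eq)
  have "\<forall>i. \<exists>f. linear f \<and> (\<forall>x\<in>range b. f x = (if x = b i then 1 else 0 :: real))"
    by (intro allI linear_independent_extend[OF ind])
  from choice[OF this] obtain \<beta> where
    \<beta>: "\<forall>i. linear (\<beta> i) \<and> (\<forall>x\<in>range b. \<beta> i x = (if x = b i then 1 else 0 :: real))" ..
  have "\<beta> i (b k) = (if i = k then 1 else 0)" for i k
    using \<beta> inj[of k i] by auto
  then show ?thesis using \<beta> by (intro exI[of _ b] exI[of _ \<beta>]) simp
qed

lemma linear_embedding: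
  assumes "has_continuum_dimension TYPE('u::real_vector)"
    and "(UNIV :: 'y::real_vector set) \<lesssim> (UNIV :: real set)"
  shows "\<exists>J :: 'y \<Rightarrow> 'u. linear J \<and> inj J"
proof -
  obtain B :: "'u set" where B: "independent B" "(UNIV :: real set) \<lesssim> B"
    using assms(1) by (auto simp: has_continuum_dimension_def)
  then have "(UNIV :: 'y set) \<lesssim> B"
    using assms(2) lepoll_trans by blast
  then obtain g :: "'y \<Rightarrow> 'u" where g: "inj g" "range g \<subseteq> B"
    by (auto simp: lepoll_def)
  obtain H :: "'y set" where "independent H" "UNIV \<subseteq> span H"
    using maximal_independent_subset[of "UNIV :: 'y set"] by metis
  then have H: "independent H" "span H = UNIV" by auto
  obtain J where J: "linear J" "\<And>x. x \<in> H \<Longrightarrow> J x = g x"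
    using linear_independent_extend[OF H(1), of g] by blast
  have im: "J ` H = g ` H" using J(2) by auto
  have "independent (J ` H)"
    unfolding im using g(2) by (intro independent_mono[OF B(1)]) auto
  moreover have "inj_on J H"
    using J(2) g(1) by (auto simp: inj_on_def)
  ultimately have "inj J"
    using linear_inj_on_span_independent_image[OF J(1), of H] H(2) by simp
  then show ?thesis using J(1) by blast
qed

section \<open>Dual spaces\<close>

lemma dual_norm_upper:
  assumes M: "normed_on Y M" and f: "f \<in> dual_space Y M" and y: "y \<in> Y" "M y \<le> 1"
  shows "\<bar>f y\<bar> \<le> dual_norm Y M f"
proof -
  obtain C where C: "\<And>y. y \<in> Y \<Longrightarrow> \<bar>f y\<bar> \<le> C * M y"
    using f by (auto simp: dual_space_def)
  have "bdd_above ((\<lambda>y. \<bar>f y\<bar>) ` {y \<in> Y. M y \<le> 1})"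
  proof (rule bdd_aboveI2[of _ _ "\<bar>C\<bar>"])
    fix y assume y: "y \<in> {y \<in> Y. M y \<le> 1}"
    then have "C * M y \<le> \<bar>C\<bar> * M y" using normed_on_nonneg[OF M] by (intro mult_right_mono) auto
    moreover have "\<bar>C\<bar> * M y \<le> \<bar>C\<bar> * 1" using y by (intro mult_left_mono) auto
    ultimately show "\<bar>f y\<bar> \<le> \<bar>C\<bar>" using C[of y] y by simp
  qed
  then show ?thesis
    unfolding dual_norm_def using y by (intro cSUP_upper) auto
qed

lemma dual_spaceD:
  assumes M: "normed_on Y M" and f: "f \<in> dual_space Y M"
  shows "linear_on Y f" "y \<notin> Y \<Longrightarrow> f y = 0" "y \<in> Y \<Longrightarrow> \<bar>f y\<bar> \<le> dual_norm Y M f * M y"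
proof -
  show lin: "linear_on Y f" and "y \<notin> Y \<Longrightarrow> f y = 0" using f by (auto simp: dual_space_def)
  note sub = normed_on_subspace[OF M]
  show "\<bar>f y\<bar> \<le> dual_norm Y M f * M y" if y: "y \<in> Y"
  proof (cases "y = 0")
    case True
    then show ?thesis
      using linear_on_0[OF lin sub] normed_on_eq_0[OF M y] by simp
  next
    case False
    then have pos: "M y > 0" using normed_on_eq_0[OF M y] normed_on_nonneg[OF M y] by simp
    have "\<bar>f ((1 / M y) *\<^sub>R y)\<bar> \<le> dual_norm Y M f"
      using pos normed_on_scale[OF M y] subspace_scale[OF sub y]
      by (intro dual_norm_upper[OF M f]) auto
    then show ?thesis
      using pos by (simp add: linear_on_scale[OF lin sub y] abs_mult field_simps)
  qed
qed

lemma dual_norm_le: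
  assumes M: "normed_on Y M" and bd: "\<And>y. y \<in> Y \<Longrightarrow> \<bar>f y\<bar> \<le> K * M y" and K: "K \<ge> 0"
  shows "dual_norm Y M f \<le> K"
  unfolding dual_norm_def
proof (rule cSUP_least)
  have "0 \<in> {y \<in> Y. M y \<le> 1}"
    using subspace_0[OF normed_on_subspace[OF M]] normed_on_eq_0[OF M, of 0] by simp
  then show "{y \<in> Y. M y \<le> 1} \<noteq> {}" by blast
  fix y assume y: "y \<in> {y \<in> Y. M y \<le> 1}"
  then have "K * M y \<le> K * 1" using K by (intro mult_left_mono) auto
  then show "\<bar>f y\<bar> \<le> K" using bd[of y] y by simp
qed

lemma dual_norm_nonneg:
  assumes M: "normed_on Y M" and f: "f \<in> dual_space Y M"
  shows "0 \<le> dual_norm Y M f"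
  using dual_norm_upper[OF M f, of 0] normed_on_eq_0[OF M, of 0]
    subspace_0[OF normed_on_subspace[OF M]] by simp

lemma dual_norm_attained_approx:
  assumes M: "normed_on Y M" and a: "a < dual_norm Y M f"
  shows "\<exists>y\<in>Y. M y \<le> 1 \<and> a < \<bar>f y\<bar>"
proof (rule ccontr)
  assume H: "\<not> ?thesis"
  have "0 \<in> {y \<in> Y. M y \<le> 1}"
    using subspace_0[OF normed_on_subspace[OF M]] normed_on_eq_0[OF M, of 0] by simp
  then have "dual_norm Y M f \<le> a"
    unfolding dual_norm_def using H by (intro cSUP_least) (auto simp: not_less)
  then show False using a by simp
qed

lemma dual_spaceI:
  assumes "linear_on Y f" "\<And>y. y \<in> Y \<Longrightarrow> \<bar>f y\<bar> \<le> K * M y" "\<And>y. y \<notin> Y \<Longrightarrow> f y = 0"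
  shows "f \<in> dual_space Y M"
  using assms by (auto simp: dual_space_def)

lemma normed_on_dual_space:
  assumes M: "normed_on Y M"
  shows "normed_on (dual_space Y M) (dual_norm Y M)"
  unfolding normed_on_def
proof (intro conjI ballI allI)
  let ?D = "dual_space Y M"
  note sub = normed_on_subspace[OF M] and nn = normed_on_nonneg[OF M]
  note D = dual_spaceD[OF M]
  have add: "f + g \<in> ?D \<and> dual_norm Y M (f + g) \<le> dual_norm Y M f + dual_norm Y M g"
    if "f \<in> ?D" "g \<in> ?D" for f g
  proof -
    have "\<bar>(f + g) y\<bar> \<le> (dual_norm Y M f + dual_norm Y M g) * M y" if "y \<in> Y" for y
      using D(3)[OF \<open>f \<in> ?D\<close> that] D(3)[OF \<open>g \<in> ?D\<close> that] by (simp add: distrib_right)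
    moreover have "linear_on Y (f + g)"
      using D(1)[OF that(1)] D(1)[OF that(2)] by (auto simp: linear_on_def distrib_left)
    ultimately show ?thesis
      using dual_norm_nonneg[OF M] that D(2)[OF that(1)] D(2)[OF that(2)]
      by (auto intro!: dual_spaceI dual_norm_le[OF M] add_nonneg_nonneg)
  qed
  have scale: "r *\<^sub>R f \<in> ?D \<and> dual_norm Y M (r *\<^sub>R f) \<le> \<bar>r\<bar> * dual_norm Y M f"
    if "f \<in> ?D" for f r
  proof -
    have "\<bar>(r *\<^sub>R f) y\<bar> \<le> (\<bar>r\<bar> * dual_norm Y M f) * M y" if "y \<in> Y" for y
      using mult_left_mono[OF D(3)[OF \<open>f \<in> ?D\<close> that], of "\<bar>r\<bar>"]
      by (simp add: scaleR_fun_def abs_mult mult.assoc)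
    moreover have "linear_on Y (r *\<^sub>R f)"
      using D(1)[OF that] by (auto simp: linear_on_def distrib_left scaleR_fun_def)
    ultimately show ?thesis
      using dual_norm_nonneg[OF M that] D(2)[OF that]
      by (auto intro!: dual_spaceI dual_norm_le[OF M] simp: scaleR_fun_def)
  qed
  have zero: "0 \<in> ?D"
    by (rule dual_spaceI[of _ _ 0]) (auto simp: linear_on_def)
  show "subspace ?D" using add scale zero by (auto simp: subspace_def)
  fix f assume f: "f \<in> ?D"
  show nonneg: "0 \<le> dual_norm Y M f" by (rule dual_norm_nonneg[OF M f])
  have "dual_norm Y M 0 \<le> 0"
    by (rule dual_norm_le[OF M]) auto
  moreover have "f y = 0" if "dual_norm Y M f = 0" for y
    using D(3)[OF f, of y] D(2)[OF f, of y] that by (cases "y \<in> Y") auto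
  ultimately show "dual_norm Y M f = 0 \<longleftrightarrow> f = 0"
    using dual_norm_nonneg[OF M zero] by (metis ext order_antisym zero_fun_apply)
  show "dual_norm Y M (r *\<^sub>R f) = \<bar>r\<bar> * dual_norm Y M f" for r
  proof (cases "r = 0")
    case True
    then show ?thesis
      using \<open>dual_norm Y M 0 \<le> 0\<close> dual_norm_nonneg[OF M zero] by simp
  next
    case False
    have "dual_norm Y M ((1/r) *\<^sub>R (r *\<^sub>R f)) \<le> \<bar>1/r\<bar> * dual_norm Y M (r *\<^sub>R f)"
      using scale f by blast
    then have "\<bar>r\<bar> * dual_norm Y M f \<le> dual_norm Y M (r *\<^sub>R f)"
      using False by (simp add: field_simps)
    then show ?thesis using scale[OF f, of r] by simp
  qed
  fix g assume g: "g \<in> ?D"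
  show "dual_norm Y M (f + g) \<le> dual_norm Y M f + dual_norm Y M g"
    using add[OF f g] by simp
qed

text \<open>
  A linear minorant of the upper limit assigns a limit to every sequence of values at once.  It extends a limit
  functional defined on part of the space without loss of norm, and stands in for weak-star compactness of
  the dual ball.
\<close>

lemma generalized_limit:
  fixes F :: "nat \<Rightarrow> 'u::real_vector \<Rightarrow> real"
  assumes lin: "\<And>k. linear (F k)" and bdd: "\<And>u. bounded (range (\<lambda>k. F k u))"
  shows "\<exists>f. linear f \<and> (\<forall>u l. (\<lambda>k. F k u) \<longlonglongrightarrow> l \<longrightarrow> f u = l) \<and>
           (\<forall>u B. (\<forall>k. F k u \<le> B) \<longrightarrow> f u \<le> B)"
proof -
  define A where "A u = {a. \<forall>\<^sub>F k in sequentially. F k u \<le> a}" for u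
  define q where "q u = Inf (A u)" for u
  have lower: "\<exists>a0. \<forall>a\<in>A u. a0 \<le> a" for u
  proof -
    obtain B where B: "\<And>k. \<bar>F k u\<bar> \<le> B"
      using bdd[of u] by (auto simp: bounded_iff)
    have "- B \<le> a" if a: "a \<in> A u" for a
    proof -
      obtain k where "F k u \<le> a"
        using a by (auto simp: A_def dest: eventually_happens)
      then show ?thesis using B[of k] by linarith
    qed
    then show ?thesis by blast
  qed
  have bddb: "bdd_below (A u)" for u
    using lower[of u] by (auto simp: bdd_below_def)
  have nonempty: "A u \<noteq> {}" for u
  proof -
    obtain B where "\<And>k. \<bar>F k u\<bar> \<le> B"
      using bdd[of u] by (auto simp: bounded_iff)
    then have "\<And>k. F k u \<le> B" by (meson abs_le_D1)
    then have "B \<in> A u" by (simp add: A_def)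
    then show ?thesis by blast
  qed
  have q_le: "q u \<le> a" if "a \<in> A u" for u a
    unfolding q_def by (rule cInf_lower[OF that bddb])
  have q_ge: "a0 \<le> q u" if "\<And>a. a \<in> A u \<Longrightarrow> a0 \<le> a" for u a0
    unfolding q_def by (rule cInf_greatest[OF nonempty that])
  have q_lim: "q u \<le> l" if "(\<lambda>k. F k u) \<longlonglongrightarrow> l" for u l
  proof (rule field_le_epsilon)
    fix \<epsilon> :: real assume "\<epsilon> > 0"
    then have "\<forall>\<^sub>F k in sequentially. F k u < l + \<epsilon>"
      by (intro order_tendstoD(2)[OF that]) auto
    then show "q u \<le> l + \<epsilon>"
      by (intro q_le) (auto simp: A_def elim: eventually_mono)
  qed
  have add: "q (u + v) \<le> q u + q v" for u v
  proof -
    have "q (u + v) - a \<le> q v" if a: "a \<in> A u" for a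
    proof (rule q_ge)
      fix a' assume a': "a' \<in> A v"
      have "\<forall>\<^sub>F k in sequentially. F k u \<le> a" "\<forall>\<^sub>F k in sequentially. F k v \<le> a'"
        using a a' by (auto simp: A_def)
      then have "\<forall>\<^sub>F k in sequentially. F k (u + v) \<le> a + a'"
        by eventually_elim (simp add: linear_add[OF lin])
      then have "q (u + v) \<le> a + a'" by (intro q_le) (simp add: A_def)
      then show "q (u + v) - a \<le> a'" by simp
    qed
    then have "q (u + v) - q v \<le> q u" by (intro q_ge) (simp add: algebra_simps)
    then show ?thesis by simp
  qed
  have scale_le: "q (t *\<^sub>R u) \<le> t * q u" if t: "t > 0" for t u
  proof -
    have "q (t *\<^sub>R u) / t \<le> q u"
    proof (rule q_ge)
      fix a assume "a \<in> A u"
      then have "\<forall>\<^sub>F k in sequentially. F k u \<le> a" by (simp add: A_def)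
      then have "\<forall>\<^sub>F k in sequentially. F k (t *\<^sub>R u) \<le> t * a"
        by eventually_elim (use t in \<open>simp add: linear_scale[OF lin]\<close>)
      then have "q (t *\<^sub>R u) \<le> t * a" by (intro q_le) (simp add: A_def)
      then show "q (t *\<^sub>R u) / t \<le> a" using t by (simp add: field_simps)
    qed
    then show ?thesis using t by (simp add: field_simps)
  qed
  have "sublinear q"
    using add scale_le by (rule sublinearI)
  then obtain f where f: "linear f" "\<And>u. f u \<le> q u"
    using sublinear_linear_minorant by blast
  have "f u = l" if l: "(\<lambda>k. F k u) \<longlonglongrightarrow> l" for u l
  proof -
    have "(\<lambda>k. F k (- u)) \<longlonglongrightarrow> - l"
      using tendsto_minus[OF l] by (simp add: linear_neg[OF lin])
    then have "f (- u) \<le> - l" using f(2)[of "- u"] q_lim by fastforce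
    moreover have "f u \<le> l" using f(2)[of u] q_lim[OF l] by simp
    ultimately show ?thesis by (simp add: linear_neg[OF f(1)])
  qed
  moreover have "f u \<le> B" if "\<And>k. F k u \<le> B" for u B
    using f(2)[of u] q_le[of B u] that by (auto simp: A_def)
  ultimately show ?thesis using f(1) by blast
qed

text \<open>
  For each \<open>d n\<close> a vector \<open>y n\<close> in the unit ball of the predual is kept on which \<open>d n\<close> attains half of its norm.
  Density of the \<open>d n\<close> extends this to the lower estimate for all vectors, and \<open>generalized_limit\<close> extends a limit on the \<open>y n\<close> to all of \<open>Y\<close>.
\<close>

lemma separable_dual_imp_coordinate_dual:
  assumes "isomorphic_to_separable_dual (u :: 'u::real_vector itself) (UNIV :: 'v::banach set) norm"
  shows "\<exists>(e :: nat \<Rightarrow> 'v \<Rightarrow> real) c C d. coordinate_dual e c C d"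
proof -
  obtain Y :: "'u set" and M where Y: "banach_on Y M"
    and sep: "separable_space (norm_topology (dual_space Y M) (dual_norm Y M))"
    and iso: "isomorphic_on (UNIV :: 'v set) norm (dual_space Y M) (dual_norm Y M)"
    using assms by (auto simp: isomorphic_to_separable_dual_def)
  have M: "normed_on Y M" using Y by (simp add: banach_on_def)
  note sub = normed_on_subspace[OF M] and nn = normed_on_nonneg[OF M]
  note D = dual_spaceD[OF M]
  note ND = normed_on_dual_space[OF M]
  obtain T c C where T: "linear_on UNIV T" "T ` (UNIV :: 'v set) = dual_space Y M"
    and c: "c > 0" and C: "C > 0"
    and T_bd: "\<And>x. c * norm x \<le> dual_norm Y M (T x)" "\<And>x. dual_norm Y M (T x) \<le> C * norm x"
    using iso unfolding isomorphic_on_iff[OF normed_on_UNIV ND] by blast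
  have linT: "linear T" using T(1) by (simp add: linear_on_UNIV)
  have TD: "T x \<in> dual_space Y M" for x using T(2) by blast
  have "(euclidean :: 'v topology) homeomorphic_space norm_topology (dual_space Y M) (dual_norm Y M)"
    using iso unfolding isomorphic_on_def norm_topology_UNIV homeomorphic_space by blast
  then have "separable_space (euclidean :: 'v topology)"
    using sep homeomorphic_separable_space by blast
  then obtain E :: "'v set" where E: "countable E" "closure E = UNIV"
    by (auto simp: separable_space_def)
  then have "E \<noteq> {}" by auto
  define d where "d = from_nat_into E"
  have dense: "\<exists>n. norm (x - d n) < \<epsilon>" if \<epsilon>: "\<epsilon> > 0" for x \<epsilon>
  proof -
    obtain z where z: "z \<in> E" "dist z x < \<epsilon>"
      using \<epsilon> E(2) closure_approachable[of x E] by auto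
    then show ?thesis
      using from_nat_into_surj[OF E(1) z(1)] by (auto simp: d_def dist_norm norm_minus_commute)
  qed
  have "\<exists>y\<in>Y. M y \<le> 1 \<and> dual_norm Y M (T (d n)) \<le> 2 * \<bar>T (d n) y\<bar>" for n
  proof (cases "dual_norm Y M (T (d n)) = 0")
    case True
    then show ?thesis
      using subspace_0[OF sub] normed_on_eq_0[OF M, of 0] by (intro bexI[of _ 0]) auto
  next
    case False
    then have "dual_norm Y M (T (d n)) / 2 < dual_norm Y M (T (d n))"
      using dual_norm_nonneg[OF M TD, of "d n"] by simp
    from dual_norm_attained_approx[OF M this] show ?thesis by force
  qed
  then obtain y where y: "\<And>n. y n \<in> Y" "\<And>n. M (y n) \<le> 1"
    "\<And>n. dual_norm Y M (T (d n)) \<le> 2 * \<bar>T (d n) (y n)\<bar>" by metis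
  define e where "e n x = T x (y n)" for n x
  have linear_e: "linear (e n)" for n
    unfolding e_def[abs_def]
    by (intro linearI) (auto simp: linear_add[OF linT] linear_scale[OF linT] scaleR_fun_def)
  have upper: "\<bar>e n x\<bar> \<le> C * norm x" for n x
  proof -
    have "\<bar>e n x\<bar> \<le> dual_norm Y M (T x) * M (y n)"
      unfolding e_def by (rule D(3)[OF TD y(1)])
    also have "\<dots> \<le> dual_norm Y M (T x) * 1"
      using y(2) dual_norm_nonneg[OF M TD] by (intro mult_left_mono) auto
    finally show ?thesis using T_bd(2)[of x] by simp
  qed
  have lower: "\<exists>i. (c / 4) * norm x \<le> \<bar>e i x\<bar>" for x
  proof (cases "x = 0")
    case False
    \<comment> \<open>replacing \<open>x\<close> by \<open>d n\<close> costs \<open>(c / 2 + C) * norm (x - d n)\<close>, which may use up \<open>c / 4 * norm x\<close>\<close>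
    define \<delta> where "\<delta> = c * norm x / (4 * (c / 2 + C))"
    have "\<delta> > 0" using False c C by (simp add: \<delta>_def)
    then obtain n where n: "norm (x - d n) < \<delta>" using dense by blast
    have "c * norm (d n) \<le> 2 * \<bar>e n (d n)\<bar>"
      using T_bd(1)[of "d n"] y(3)[of n] by (simp add: e_def)
    moreover have "\<bar>e n (d n)\<bar> \<le> \<bar>e n x\<bar> + C * norm (x - d n)"
      using upper[of n "x - d n"] by (simp add: linear_diff[OF linear_e])
    moreover have "norm x - norm (x - d n) \<le> norm (d n)"
      using norm_triangle_ineq2[of x "x - d n"] by simp
    then have "c * norm x - c * norm (x - d n) \<le> c * norm (d n)"
      using c by (simp flip: right_diff_distrib)
    ultimately have "c / 2 * norm x - (c / 2 + C) * norm (x - d n) \<le> \<bar>e n x\<bar>"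
      by (simp add: algebra_simps)
    moreover have "(c / 2 + C) * norm (x - d n) \<le> (c / 2 + C) * \<delta>"
      using n c C by (intro mult_left_mono) auto
    moreover have "(c / 2 + C) * \<delta> = c / 4 * norm x"
      using c C by (simp add: \<delta>_def field_simps)
    ultimately show ?thesis by (intro exI[of _ n]) (simp add: field_simps)
  qed simp
  have compact: "\<exists>x. \<forall>i. (\<lambda>k. e i (X k)) \<longlonglongrightarrow> e i x"
    if X: "bounded (range X)" and conv: "\<And>i. convergent (\<lambda>k. e i (X k))" for X
  proof -
    obtain K where K: "\<And>k. norm (X k) \<le> K" using X by (auto simp: bounded_iff)
    obtain Pr where Pr: "linear Pr" "\<And>u. Pr u \<in> Y" "\<And>u. u \<in> Y \<Longrightarrow> Pr u = u"
      using subspace_projection[OF sub] by blast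
    define F where "F k u = T (X k) (Pr u)" for k u
    have linF: "linear (F k)" for k
      unfolding F_def[abs_def]
      using linear_on_add[OF D(1)[OF TD] sub Pr(2) Pr(2)] linear_on_scale[OF D(1)[OF TD] sub Pr(2)]
      by (intro linearI) (auto simp: linear_add[OF Pr(1)] linear_scale[OF Pr(1)])
    have F_bd: "\<bar>F k u\<bar> \<le> (C * K) * M (Pr u)" for k u
    proof -
      have "\<bar>F k u\<bar> \<le> dual_norm Y M (T (X k)) * M (Pr u)"
        unfolding F_def by (rule D(3)[OF TD Pr(2)])
      also have "\<dots> \<le> (C * K) * M (Pr u)"
        using T_bd(2)[of "X k"] K[of k] C nn[OF Pr(2)]
        by (intro mult_right_mono) (auto intro: order_trans mult_left_mono)
      finally show ?thesis .
    qed
    then have "bounded (range (\<lambda>k. F k u))" for u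
      by (auto simp: bounded_iff)
    from generalized_limit[OF linF this] obtain f where f: "linear f"
      "\<And>u l. (\<lambda>k. F k u) \<longlonglongrightarrow> l \<Longrightarrow> f u = l" "\<And>u B. (\<And>k. F k u \<le> B) \<Longrightarrow> f u \<le> B" by blast
    define g where "g u = (if u \<in> Y then f u else 0)" for u
    have g_le: "g u \<le> (C * K) * M u" if "u \<in> Y" for u
      using f(3)[of u "(C * K) * M u"] F_bd[of _ u] that Pr(3)[OF that]
      by (auto simp: g_def dest: abs_le_D1)
    have "g \<in> dual_space Y M"
    proof (rule dual_spaceI)
      show "linear_on Y g"
        using subspace_add[OF sub] subspace_scale[OF sub]
        by (auto simp: linear_on_def g_def linear_add[OF f(1)] linear_scale[OF f(1)])
      show "\<bar>g u\<bar> \<le> (C * K) * M u" if u: "u \<in> Y" for u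
        using g_le[OF u] g_le[OF subspace_neg[OF sub u]] normed_on_uminus[OF M u]
          subspace_neg[OF sub u] u by (simp add: g_def linear_neg[OF f(1)])
      show "g u = 0" if "u \<notin> Y" for u using that by (simp add: g_def)
    qed
    then obtain x where x: "T x = g" using T(2) by (metis imageE)
    have "(\<lambda>k. e i (X k)) \<longlonglongrightarrow> e i x" for i
    proof -
      obtain l where l: "(\<lambda>k. e i (X k)) \<longlonglongrightarrow> l" using conv by (auto simp: convergent_def)
      then have "f (y i) = l" by (intro f(2)) (simp add: F_def e_def Pr(3)[OF y(1)])
      then show ?thesis using l y(1) x by (simp add: e_def g_def)
    qed
    then show ?thesis by blast
  qed
  have "c / 4 > 0" using c by simp
  then have "coordinate_dual e (c / 4) C d"
    by (rule coordinate_dual.intro[OF linear_e _ C upper lower compact dense])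
  then show ?thesis by blast
qed

lemma separable_dual_imp_GFDA:
  assumes "has_continuum_dimension TYPE('u::real_vector)"
    and "isomorphic_to_separable_dual TYPE('u) (UNIV :: 'v::banach set) norm"
  shows "admits_GFDA TYPE('u) (UNIV :: 'v set) norm"
proof -
  obtain e c C and d :: "nat \<Rightarrow> 'v" where "coordinate_dual e c C d"
    using separable_dual_imp_coordinate_dual[OF assms(2)] by blast
  moreover obtain b :: "nat \<Rightarrow> 'u" and \<beta> :: "nat \<Rightarrow> 'u \<Rightarrow> real"
    where "\<And>i. linear (\<beta> i)" "\<And>i k. \<beta> i (b k) = (if i = k then 1 else 0)"
    using biorthogonal_sequence[OF assms(1)] by blast
  ultimately interpret embedded_coordinate_dual e c C d b \<beta>
    by (simp add: embedded_coordinate_dual_def embedded_coordinate_dual_axioms_def)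
  show ?thesis by (rule admits_GFDA_coordinate_dual)
qed

section \<open>Spaces with a good finite dimensional approximation are dual spaces\<close>

lemma nat_real_functions_lepoll_real: "(UNIV :: (nat \<Rightarrow> real) set) \<lesssim> (UNIV :: real set)"
proof -
  have "(UNIV :: real set) \<lesssim> (UNIV :: nat set set)"
    using nat_sets_eqpoll_reals eqpoll_imp_lepoll eqpoll_sym by blast
  then obtain h :: "real \<Rightarrow> nat set" where h: "inj h" by (auto simp: lepoll_def)
  define H where "H f = {prod_encode (n, m) | n m. m \<in> h (f n)}" for f :: "nat \<Rightarrow> real"
  have mem: "prod_encode (n, m) \<in> H f \<longleftrightarrow> m \<in> h (f n)" for n m f
    by (auto simp: H_def prod_encode_eq)
  have "inj H"
  proof
    fix f g assume "H f = H g"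
    then have "h (f n) = h (g n)" for n
      using mem[of n _ f] mem[of n _ g] by blast
    then show "f = g" using h by (auto simp: inj_eq)
  qed
  then have "(UNIV :: (nat \<Rightarrow> real) set) \<lesssim> (UNIV :: nat set set)"
    by (auto simp: lepoll_def)
  then show ?thesis
    using nat_sets_eqpoll_reals eqpoll_imp_lepoll lepoll_trans by blast
qed

lemma dense_imp_closure_range:
  fixes d :: "nat \<Rightarrow> 'v::real_normed_vector"
  assumes "\<And>x \<epsilon>. \<epsilon> > 0 \<Longrightarrow> \<exists>n. norm (x - d n) < \<epsilon>"
  shows "closure (range d) = UNIV"
proof -
  have "\<exists>y\<in>range d. dist y x < \<epsilon>" if "\<epsilon> > 0" for x and \<epsilon> :: real
    using assms[OF that, of x] by (auto simp: dist_norm norm_minus_commute)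
  then show ?thesis by (auto simp: closure_approachable)
qed

text \<open>
  A continuous functional is determined by its values on a dense sequence.  This bounds the dimension of the
  predual constructed below.
\<close>

lemma blinfun_lepoll_real:
  fixes d :: "nat \<Rightarrow> 'v::real_normed_vector"
  assumes dense: "\<And>x \<epsilon>. \<epsilon> > 0 \<Longrightarrow> \<exists>n. norm (x - d n) < \<epsilon>"
  shows "(UNIV :: ('v \<Rightarrow>\<^sub>L real) set) \<lesssim> (UNIV :: real set)"
proof -
  define R where "R f = (\<lambda>n. blinfun_apply f (d n))" for f :: "'v \<Rightarrow>\<^sub>L real"
  note cl = dense_imp_closure_range[of d, OF dense]
  have "inj R"
  proof
    fix f g assume eq: "R f = R g"
    have "blinfun_apply f x - blinfun_apply g x = 0" for x
    proof (rule continuous_constant_on_closure[of "range d" "\<lambda>x. blinfun_apply f x - blinfun_apply g x"])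
      show "x \<in> closure (range d)" using cl by simp
      show "\<And>y. y \<in> range d \<Longrightarrow> blinfun_apply f y - blinfun_apply g y = 0"
        using eq by (auto simp: R_def fun_eq_iff)
    qed (intro continuous_intros)
    then have "blinfun_apply f x = blinfun_apply g x" for x by simp
    then show "f = g" by (rule blinfun_eqI)
  qed
  then have "(UNIV :: ('v \<Rightarrow>\<^sub>L real) set) \<lesssim> (UNIV :: (nat \<Rightarrow> real) set)"
    by (auto simp: lepoll_def)
  then show ?thesis
    using nat_real_functions_lepoll_real lepoll_trans by blast
qed

lemma linear_on_sum:
  assumes T: "linear_on X T" "subspace X" and f: "\<And>i. i \<in> I \<Longrightarrow> f i \<in> X"
  shows "T (sum f I) = (\<Sum>i\<in>I. T (f i))"
  using f
proof (induction I rule: infinite_finite_induct)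
  case (insert i I)
  then show ?case
    using linear_on_add[OF T, of "f i" "sum f I"] subspace_sum[OF T(2), of I f] by simp
qed (simp_all add: linear_on_0[OF T])

locale gfda =
  fixes W :: "nat \<Rightarrow> 'w::real_vector set" and N \<theta> U
  assumes GFDA: "GFDA W N \<theta> U"
begin

abbreviation "L \<equiv> inverse_limit W N \<theta>"

lemma sis: "standard_inverse_system W N \<theta>"
  and subspace_U: "subspace U"
  and determining: "determining_property W N U"
  and quotient: "norm_quotient_map U (limit_norm N) (W i) (N i) (\<lambda>w. w i)"
  using GFDA by (auto simp: GFDA_def)

lemmas normed_W = standard_inverse_systemD(1)[OF sis]
lemmas normed_L = normed_on_inverse_limit[OF sis]

lemma U_subset_L: "U \<subseteq> L"
  using GFDA closedin_subset[of "norm_topology L (limit_norm N)" U]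
  by (simp add: GFDA_def topspace_norm_topology[OF normed_L])

lemma normed_U: "normed_on U (limit_norm N)"
  by (rule normed_on_subset[OF normed_L subspace_U U_subset_L])

lemma L_W: "w \<in> L \<Longrightarrow> w i \<in> W i"
  by (simp add: inverse_limit_def)

text \<open>
  The Determining Property provides some strong limit; comparing projections identifies it with the coordinatewise
  limit \<open>w\<close>, which therefore belongs to \<open>U\<close>.  By monotonicity in \<open>j\<close>, one index \<open>j\<close> for each
  \<open>\<epsilon>\<close> is enough for uniformity.
\<close>

lemma determining_limit:
  assumes v: "\<And>k. v k \<in> U" and w: "w \<in> L"
    and conv: "\<And>j. (\<lambda>k. N j (v k j - w j)) \<longlonglongrightarrow> 0"
    and bdd: "\<And>k. limit_norm N (v k) \<le> K"
    and unif: "\<And>\<epsilon>. \<epsilon> > 0 \<Longrightarrow> \<exists>j. \<forall>k. limit_norm N (v k) - N j (v k j) < \<epsilon>"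
  shows "w \<in> U" "(\<lambda>k. limit_norm N (v k - w)) \<longlonglongrightarrow> 0"
proof -
  have vL: "v k \<in> L" for k using v U_subset_L by blast
  have "uniform_limit UNIV (\<lambda>j k. N j (v k j)) (\<lambda>k. limit_norm N (v k)) sequentially"
  proof (rule uniform_limitI)
    fix \<epsilon> :: real assume "\<epsilon> > 0"
    from unif[OF this] obtain j0 where j0: "\<And>k. limit_norm N (v k) - N j0 (v k j0) < \<epsilon>" by blast
    have "dist (N j (v k j)) (limit_norm N (v k)) < \<epsilon>" if "j \<ge> j0" for j k
      using limit_norm_tendsto(2)[OF sis vL, of j k] limit_norm_tendsto(3)[OF sis vL that, of k] j0[of k]
      by (simp add: dist_real_def)
    then show "\<forall>\<^sub>F j in sequentially. \<forall>k\<in>UNIV. dist (N j (v k j)) (limit_norm N (v k)) < \<epsilon>"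
      by (auto simp: eventually_sequentially)
  qed
  moreover have "limitin (norm_topology (W j) (N j)) (\<lambda>k. v k j) (w j) sequentially" for j
    using conv by (subst limitin_norm_topology_tendsto[OF normed_W]) (auto intro: L_W vL w)
  moreover have "bdd_above (range (\<lambda>k. limit_norm N (v k)))"
    using bdd by (intro bdd_aboveI2)
  ultimately obtain l where l: "limitin (norm_topology U (limit_norm N)) v l sequentially"
    using determining[unfolded determining_property_def, THEN spec, of v] v
    by (auto simp: image_subset_iff)
  then have lU: "l \<in> U" by (simp add: limitin_norm_topology[OF normed_U])
  then have lL: "l \<in> L" using U_subset_L by blast
  have lim: "(\<lambda>k. limit_norm N (v k - l)) \<longlonglongrightarrow> 0"
    using l by (subst (asm) limitin_norm_topology_tendsto[OF normed_U]) (auto intro: v lU)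
  have "l j = w j" for j
  proof -
    have "N j (l j - w j) \<le> limit_norm N (v k - l) + N j (v k j - w j)" for k
    proof -
      have "N j (l j - w j) = N j ((v k j - w j) - (v k j - l j))" by simp
      also have "\<dots> \<le> N j (v k j - w j) + N j (v k j - l j)"
        using subspace_diff[OF normed_on_subspace[OF normed_W]] L_W vL w lL
        by (intro normed_on_minus(1)[OF normed_W]) blast+
      also have "N j (v k j - l j) \<le> limit_norm N (v k - l)"
        using limit_norm_tendsto(2)[OF sis subspace_diff[OF normed_on_subspace[OF normed_L] vL lL], of j k]
        by simp
      finally show ?thesis by simp
    qed
    moreover have "(\<lambda>k. limit_norm N (v k - l) + N j (v k j - w j)) \<longlonglongrightarrow> 0"
      using tendsto_add[OF lim conv] by simp
    ultimately have "N j (l j - w j) \<le> 0" by (intro LIMSEQ_le_const) auto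
    then show ?thesis
      using normed_on_nonneg[OF normed_W] normed_on_eq_0[OF normed_W]
        subspace_diff[OF normed_on_subspace[OF normed_W] L_W[OF lL] L_W[OF w], of j]
      by (metis eq_iff_diff_eq_0 order_antisym)
  qed
  then have "l = w" by (rule ext)
  then show "w \<in> U" "(\<lambda>k. limit_norm N (v k - w)) \<longlonglongrightarrow> 0"
    using lU lim by auto
qed

lemma quotient_approx:
  assumes "w \<in> W i" "\<epsilon> > 0"
  shows "\<exists>v\<in>U. v i = w \<and> limit_norm N v < N i w + \<epsilon>"
proof -
  note q = quotient[of i, unfolded norm_quotient_map_def]
  have img: "(\<lambda>v. v i) ` U = W i" using q by (elim conjE)
  have inf: "N i w = (INF a\<in>{a \<in> U. a i = w}. limit_norm N a)"
    using q assms(1) by (elim conjE) (erule bspec)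
  have "w \<in> (\<lambda>v. v i) ` U" using img assms(1) by simp
  then have "{a \<in> U. a i = w} \<noteq> {}" by auto
  moreover have "bdd_below (limit_norm N ` {a \<in> U. a i = w})"
    using normed_on_nonneg[OF normed_U] by (intro bdd_belowI2[of _ 0]) auto
  moreover have "(INF a\<in>{a \<in> U. a i = w}. limit_norm N a) < N i w + \<epsilon>"
    using assms(2) inf by linarith
  ultimately show ?thesis by (simp add: cINF_less_iff) blast
qed

text \<open>
  Because the projections of \<open>U\<close> are quotient maps, each entry \<open>w k\<close> has a lift \<open>v k\<close> in \<open>U\<close> of almost the same norm.  The
  norms of the lifts and of their projections are then squeezed between those of the entries of \<open>w\<close>, which gives
  uniformity for large \<open>k\<close>; finitely many \<open>k\<close> remain.
\<close>

lemma L_eq_U: "L = U"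
proof (intro antisym U_subset_L subsetI)
  fix w assume w: "w \<in> L"
  have "\<exists>v\<in>U. v k = w k \<and> limit_norm N v < N k (w k) + 1 / Suc k" for k
    using L_W[OF w] by (intro quotient_approx) auto
  then obtain v where v: "\<And>k. v k \<in> U" "\<And>k. v k k = w k"
    "\<And>k. limit_norm N (v k) < N k (w k) + 1 / Suc k" by metis
  have vL: "v k \<in> L" for k using v(1) U_subset_L by blast
  have agree: "v k j = w j" if "j \<le> k" for k j
    using that
  proof (induction j rule: inc_induct)
    case (step j)
    have "v k j = \<theta> j (v k (Suc j))" "w j = \<theta> j (w (Suc j))"
      using vL[of k] w by (simp_all add: inverse_limit_def)
    then show ?case using step by simp
  qed (simp add: v(2))
  have v_le: "limit_norm N (v k) \<le> limit_norm N w + 1 / Suc k" for k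
    using v(3)[of k] limit_norm_tendsto(2)[OF sis w, of k] by simp
  show "w \<in> U"
  proof (rule determining_limit(1)[of v w "limit_norm N w + 1"])
    show "v k \<in> U" for k by (rule v(1))
    show "w \<in> L" by (rule w)
    show "(\<lambda>k. N j (v k j - w j)) \<longlonglongrightarrow> 0" for j
      using agree normed_on_eq_0[OF normed_W subspace_0[OF normed_on_subspace[OF normed_W]]]
      by (intro tendsto_eventually) (auto simp: eventually_sequentially intro!: exI[of _ j])
    have "1 / real (Suc k) \<le> 1" for k by simp
    then show "limit_norm N (v k) \<le> limit_norm N w + 1" for k
      using v_le[of k] by (meson add_left_mono order_trans)
    fix \<epsilon> :: real assume \<epsilon>: "\<epsilon> > 0"
    have "\<forall>\<^sub>F j in sequentially. limit_norm N w - \<epsilon> / 2 < N j (w j)"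
      using \<epsilon> by (intro order_tendstoD(1)[OF limit_norm_tendsto(1)[OF sis w]]) auto
    moreover have "\<forall>\<^sub>F j in sequentially. 1 / real (Suc j) < \<epsilon> / 2"
      using order_tendstoD(2)[OF LIMSEQ_inverse_real_of_nat, of "\<epsilon> / 2"] \<epsilon>
      by (simp add: inverse_eq_divide)
    ultimately have "\<forall>\<^sub>F j in sequentially. limit_norm N w - \<epsilon> / 2 < N j (w j) \<and> 1 / real (Suc j) < \<epsilon> / 2"
      by (rule eventually_conj)
    then obtain j where j: "limit_norm N w - \<epsilon> / 2 < N j (w j)" "1 / real (Suc j) < \<epsilon> / 2"
      by (auto simp: eventually_sequentially)
    have late: "limit_norm N (v k) - N i (v k i) < \<epsilon>" if k: "k \<ge> j" "i \<ge> j" for k i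
    proof -
      have "1 / real (Suc k) \<le> 1 / real (Suc j)" using k by (simp add: frac_le)
      moreover have "N j (w j) \<le> N i (v k i)"
        using limit_norm_tendsto(3)[OF sis vL k(2), of k] agree[OF k(1)] by simp
      ultimately show ?thesis using v_le[of k] j by linarith
    qed
    have "\<forall>\<^sub>F i in sequentially. \<forall>k\<in>{..<j}. limit_norm N (v k) - \<epsilon> < N i (v k i)"
      using \<epsilon> by (intro eventually_ball_finite ballI
          order_tendstoD(1)[OF limit_norm_tendsto(1)[OF sis vL]]) auto
    then obtain i0 where i0: "\<And>i k. i \<ge> i0 \<Longrightarrow> k < j \<Longrightarrow> limit_norm N (v k) - \<epsilon> < N i (v k i)"
      by (auto simp: eventually_sequentially)
    have "limit_norm N (v k) - N (max i0 j) (v k (max i0 j)) < \<epsilon>" for k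
      using late[of k "max i0 j"] i0[of "max i0 j" k] by (cases "k < j") auto
    then show "\<exists>j. \<forall>k. limit_norm N (v k) - N j (v k j) < \<epsilon>" by blast
  qed
qed

definition basis :: "nat \<Rightarrow> 'w set" where "basis i = (SOME B. finite B \<and> span B = W i)"

lemma basis: "finite (basis i)" "span (basis i) = W i"
  using someI_ex[OF standard_inverse_systemD(2)[OF sis, of i]] by (auto simp: basis_def)

lemma coordinates_exist:
  "\<exists>c C. C \<ge> 0 \<and> (\<forall>b. linear (c b)) \<and>
     (\<forall>x\<in>W i. x = (\<Sum>b\<in>basis i. c b x *\<^sub>R b) \<and> (\<forall>b\<in>basis i. \<bar>c b x\<bar> \<le> C * N i x))"
  using finite_dim_bounded_coordinates[OF basis(1)[of i], of "N i"] normed_W[of i]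
  by (simp add: basis(2))

definition coord :: "nat \<Rightarrow> 'w \<Rightarrow> 'w \<Rightarrow> real" where
  "coord i = (SOME c. \<exists>C. C \<ge> 0 \<and> (\<forall>b. linear (c b)) \<and>
     (\<forall>x\<in>W i. x = (\<Sum>b\<in>basis i. c b x *\<^sub>R b) \<and> (\<forall>b\<in>basis i. \<bar>c b x\<bar> \<le> C * N i x)))"

lemma coord: "\<exists>C. C \<ge> 0 \<and> (\<forall>b. linear (coord i b)) \<and>
     (\<forall>x\<in>W i. x = (\<Sum>b\<in>basis i. coord i b x *\<^sub>R b) \<and> (\<forall>b\<in>basis i. \<bar>coord i b x\<bar> \<le> C * N i x))"
  unfolding coord_def by (rule someI_ex[OF coordinates_exist])

lemma linear_coord: "linear (coord i b)"
  and coord_expansion: "x \<in> W i \<Longrightarrow> (\<Sum>b\<in>basis i. coord i b x *\<^sub>R b) = x"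
  using coord[of i] by auto

lemma linear_functional_bounded:
  assumes g: "linear (g :: 'w \<Rightarrow> real)"
  shows "\<exists>K\<ge>0. \<forall>x\<in>W i. \<bar>g x\<bar> \<le> K * N i x"
proof -
  obtain C where C: "C \<ge> 0" "\<And>x b. x \<in> W i \<Longrightarrow> b \<in> basis i \<Longrightarrow> \<bar>coord i b x\<bar> \<le> C * N i x"
    using coord[of i] by blast
  have "\<bar>g x\<bar> \<le> (\<Sum>b\<in>basis i. C * \<bar>g b\<bar>) * N i x" if x: "x \<in> W i" for x
  proof -
    have "g x = (\<Sum>b\<in>basis i. coord i b x * g b)"
      using arg_cong[OF coord_expansion[OF x], of g]
      by (simp add: linear_sum[OF g] linear_scale[OF g])
    also have "\<bar>\<dots>\<bar> \<le> (\<Sum>b\<in>basis i. \<bar>coord i b x * g b\<bar>)" by (rule sum_abs)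
    also have "\<dots> \<le> (\<Sum>b\<in>basis i. (C * N i x) * \<bar>g b\<bar>)"
      by (intro sum_mono) (auto simp: abs_mult intro!: mult_right_mono C(2) x)
    also have "\<dots> = (\<Sum>b\<in>basis i. C * \<bar>g b\<bar>) * N i x"
      unfolding sum_distrib_right by (intro sum.cong) (auto simp: mult_ac)
    finally show ?thesis .
  qed
  moreover have "0 \<le> (\<Sum>b\<in>basis i. C * \<bar>g b\<bar>)" using C(1) by (intro sum_nonneg) auto
  ultimately show ?thesis by blast
qed

text \<open>
  In a countable product of real lines, which is second countable, every subset has a countable dense
  subset.  The code \<open>G v\<close> of \<open>v\<close> records its coordinates and a modulus \<open>J v m\<close> of convergence of the norms.  Integers
  that converge are bounded, so convergence of codes gives a common modulus and hence uniformity, and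
  \<open>determining_limit\<close> yields norm convergence.
\<close>

lemma countable_dense_subset:
  "\<exists>D. countable D \<and> D \<subseteq> U \<and> (\<forall>v\<in>U. \<forall>\<epsilon>>0. \<exists>u\<in>D. limit_norm N (u - v) < \<epsilon>)"
proof -
  have "\<exists>j. limit_norm N v \<le> real j \<and> limit_norm N v - N j (v j) < 1 / real (Suc m)"
    if v: "v \<in> U" for v m
  proof -
    have vL: "v \<in> L" using v U_subset_L by blast
    have "\<forall>\<^sub>F j in sequentially. limit_norm N v - 1 / real (Suc m) < N j (v j)"
      by (intro order_tendstoD(1)[OF limit_norm_tendsto(1)[OF sis vL]]) auto
    then obtain j0 where j0: "\<And>j. j \<ge> j0 \<Longrightarrow> limit_norm N v - 1 / real (Suc m) < N j (v j)"
      by (auto simp: eventually_sequentially)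
    obtain j1 :: nat where "limit_norm N v \<le> real j1" using real_arch_simple by blast
    then show ?thesis using j0[of "max j0 j1"] by (intro exI[of _ "max j0 j1"]) auto
  qed
  note ex = this
  \<comment> \<open>the modulus also dominates the norm, so that bounded moduli force a bounded sequence\<close>
  define J where
    "J v m = (SOME j. limit_norm N v \<le> real j \<and> limit_norm N v - N j (v j) < 1 / real (Suc m))"
    for v m
  have J: "limit_norm N v \<le> real (J v m)"
    "limit_norm N v - N (J v m) (v (J v m)) < 1 / real (Suc m)" if "v \<in> U" for v m
    using someI_ex[OF ex[OF that, of m]] by (simp_all add: J_def)
  define G :: "(nat \<Rightarrow> 'w) \<Rightarrow> nat + nat \<times> nat \<Rightarrow> real" where
    "G v = case_sum (\<lambda>m. real (J v m)) (\<lambda>(i, n). coord i (from_nat_into (basis i) n) (v i))" for v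
  obtain E where E: "countable E" "E \<subseteq> G ` U" "G ` U \<subseteq> closure E"
    using separable[of "G ` U"] by blast
  obtain D where D: "countable D" "D \<subseteq> U" "E = G ` D"
    using countable_subset_image[of E G U] E(1,2) by blast
  have "\<exists>u\<in>D. limit_norm N (u - w) < \<epsilon>" if w: "w \<in> U" and \<epsilon>: "\<epsilon> > 0" for w \<epsilon>
  proof -
    have wL: "w \<in> L" using w U_subset_L by blast
    have "G w \<in> closure E" using E(3) w by blast
    then obtain f where f: "\<And>k. f k \<in> E" "f \<longlonglongrightarrow> G w" unfolding closure_sequential by blast
    have "\<forall>k. \<exists>u\<in>D. f k = G u" using f(1) D(3) by blast
    then obtain v where v: "\<And>k. v k \<in> D" "\<And>k. f k = G (v k)" by metis
    have vU: "v k \<in> U" for k using v(1) D(2) by blast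
    have vL: "v k \<in> L" for k using vU U_subset_L by blast
    have lim: "(\<lambda>k. G (v k) a) \<longlonglongrightarrow> G w a" for a
      using continuous_on_tendsto_compose[OF continuous_on_product_coordinates f(2), of a] v(2)
      by simp
    have J_bdd: "\<exists>j. \<forall>k. J (v k) m \<le> j" for m
    proof -
      have "(\<lambda>k. real (J (v k) m)) \<longlonglongrightarrow> real (J w m)"
        using lim[of "Inl m"] by (simp add: G_def)
      then obtain K where "\<And>k. real (J (v k) m) \<le> K"
        using convergent_imp_bounded[of "\<lambda>k. real (J (v k) m)"] by (auto simp: bounded_iff)
      then have "J (v k) m \<le> nat \<lceil>K\<rceil>" for k by (metis le_nat_iff ceiling_mono ceiling_of_nat nat_int nat_mono)
      then show ?thesis by blast
    qed
    obtain K where K: "\<And>k. J (v k) 0 \<le> K" using J_bdd by blast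
    have "(\<lambda>k. limit_norm N (v k - w)) \<longlonglongrightarrow> 0"
    proof (rule determining_limit(2)[of v w "real K"])
      show "v k \<in> U" for k by (rule vU)
      show "w \<in> L" by (rule wL)
      show "limit_norm N (v k) \<le> real K" for k
        using J(1)[OF vU, of k 0] K[of k] by simp
      show "(\<lambda>k. N j (v k j - w j)) \<longlonglongrightarrow> 0" for j
      proof -
        have "(\<lambda>k. coord j b (v k j)) \<longlonglongrightarrow> coord j b (w j)" if b: "b \<in> basis j" for b
          using lim[of "Inr (j, to_nat_on (basis j) b)"] b
          by (simp add: G_def from_nat_into_to_nat_on countable_finite basis(1))
        then show ?thesis
          using coordinates_tendsto_imp_norm_tendsto[of "basis j" "N j" "\<lambda>k. v k j" "coord j"
              "\<lambda>b. coord j b (w j)"] normed_W[of j] coord_expansion L_W[OF vL] L_W[OF wL]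
          by (simp add: basis(2))
      qed
      fix \<epsilon> :: real assume "\<epsilon> > 0"
      then obtain m where m: "1 / real (Suc m) < \<epsilon>"
        using nat_approx_posE by blast
      obtain j where j: "\<And>k. J (v k) m \<le> j" using J_bdd by blast
      have "limit_norm N (v k) - N j (v k j) < \<epsilon>" for k
        using J(2)[OF vU, of k m] limit_norm_tendsto(3)[OF sis vL[of k] j[of k]] m by linarith
      then show "\<exists>j. \<forall>k. limit_norm N (v k) - N j (v k j) < \<epsilon>" by blast
    qed
    then have "\<forall>\<^sub>F k in sequentially. limit_norm N (v k - w) < \<epsilon>"
      using \<epsilon> by (rule order_tendstoD(2))
    then show ?thesis using v(1) by (auto simp: eventually_sequentially)
  qed
  then show ?thesis using D(1,2) by blast
qed

end

section \<open>The predual\<close>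

lemma closed_subspace_image_banach_on:
  fixes J :: "'y::banach \<Rightarrow> 'u::real_vector"
  assumes J: "linear J" "inj J" and Y: "subspace Y" "closed Y"
  shows "banach_on (J ` Y) (\<lambda>u. norm (inv J u))"
proof (rule banach_onI)
  have inv: "inv J (J y) = y" for y using J(2) by simp
  show "normed_on (J ` Y) (\<lambda>u. norm (inv J u))"
    unfolding normed_on_def
  proof (intro conjI ballI allI)
    show "subspace (J ` Y)" by (rule linear_subspace_image[OF J(1) Y(1)])
    fix u assume "u \<in> J ` Y"
    then obtain y where u: "u = J y" by blast
    show "0 \<le> norm (inv J u)" by simp
    show "norm (inv J u) = 0 \<longleftrightarrow> u = 0"
      using inj_eq[OF J(2), of y 0] by (simp add: u inv linear_0[OF J(1)])
    show "norm (inv J (r *\<^sub>R u)) = \<bar>r\<bar> * norm (inv J u)" for r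
      by (simp add: u inv flip: linear_scale[OF J(1)])
    fix v assume "v \<in> J ` Y"
    then obtain z where v: "v = J z" by blast
    show "norm (inv J (u + v)) \<le> norm (inv J u) + norm (inv J v)"
      by (simp add: u v inv norm_triangle_ineq flip: linear_add[OF J(1)])
  qed
  fix s :: "nat \<Rightarrow> 'u" assume s: "range s \<subseteq> J ` Y"
    and Cau: "\<And>e. e > 0 \<Longrightarrow> \<exists>n0. \<forall>m\<ge>n0. \<forall>n\<ge>n0. norm (inv J (s m - s n)) < e"
  define y where "y n = inv J (s n)" for n :: nat
  have sy: "s n = J (y n)" and yY: "y n \<in> Y" for n
  proof -
    have "s n \<in> J ` Y" using s by blast
    then obtain z where "z \<in> Y" "s n = J z" by blast
    then show "s n = J (y n)" "y n \<in> Y" by (simp_all add: y_def inv)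
  qed
  have diff: "inv J (J a - J b) = a - b" for a b
    by (simp add: inv flip: linear_diff[OF J(1)])
  have "Cauchy y"
    using Cau by (auto simp: Cauchy_def dist_norm sy diff)
  then obtain l where l: "y \<longlonglongrightarrow> l" by (auto simp: Cauchy_convergent_iff convergent_def)
  then have "l \<in> Y" using closed_sequentially[OF Y(2)] yY by blast
  moreover have "(\<lambda>k. norm (inv J (s k - J l))) \<longlonglongrightarrow> 0"
    using tendsto_norm_zero[OF LIM_zero[OF l]] by (simp add: sy diff)
  ultimately show "\<exists>l\<in>J ` Y. (\<lambda>k. norm (inv J (s k - l))) \<longlonglongrightarrow> 0" by blast
qed

lemma subspace_closure:
  fixes S :: "'a::real_normed_vector set"
  assumes S: "subspace S"
  shows "subspace (closure S)"
  unfolding subspace_def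
proof (intro conjI ballI allI)
  show "0 \<in> closure S" using subspace_0[OF S] closure_subset by blast
  fix x assume "x \<in> closure S"
  then obtain s where s: "\<And>n. s n \<in> S" "s \<longlonglongrightarrow> x" unfolding closure_sequential by blast
  show "r *\<^sub>R x \<in> closure S" for r
    unfolding closure_sequential using s subspace_scale[OF S]
    by (intro exI[of _ "\<lambda>n. r *\<^sub>R s n"]) (auto intro: tendsto_intros)
  fix y assume "y \<in> closure S"
  then obtain t where t: "\<And>n. t n \<in> S" "t \<longlonglongrightarrow> y" unfolding closure_sequential by blast
  show "x + y \<in> closure S"
    unfolding closure_sequential using s t subspace_add[OF S]
    by (intro exI[of _ "\<lambda>n. s n + t n"]) (auto intro: tendsto_intros)
qed

locale gfda_isomorphism = gfda W N \<theta> U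
  for W :: "nat \<Rightarrow> 'u::real_vector set" and N \<theta> U +
  fixes T :: "'v::banach \<Rightarrow> nat \<Rightarrow> 'u" and c C :: real
  assumes linear_T: "linear T" and T_onto: "range T = U"
    and c_pos: "c > 0" and C_pos: "C > 0"
    and T_lower: "c * norm x \<le> limit_norm N (T x)"
    and T_upper: "limit_norm N (T x) \<le> C * norm x"
begin

lemma T_in_L: "T x \<in> L"
  using T_onto U_subset_L by blast

lemma T_in_W: "T x i \<in> W i"
  by (rule L_W[OF T_in_L])

lemma T_component_bound: "N i (T x i) \<le> C * norm x"
  using limit_norm_tendsto(2)[OF sis T_in_L, of i x] T_upper[of x] by simp

definition rep :: "nat \<Rightarrow> ('u \<Rightarrow> real) \<Rightarrow> 'v \<Rightarrow>\<^sub>L real" where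
  "rep i g = Blinfun (\<lambda>x. g (T x i))"

lemma rep_apply:
  assumes g: "linear g"
  shows "blinfun_apply (rep i g) x = g (T x i)"
proof -
  obtain K where K: "K \<ge> 0" "\<And>x. x \<in> W i \<Longrightarrow> \<bar>g x\<bar> \<le> K * N i x"
    using linear_functional_bounded[OF g] by blast
  have "bounded_linear (\<lambda>x. g (T x i))"
  proof (rule bounded_linear_intro[of _ "K * C"])
    fix x y and r :: real
    show "g (T (x + y) i) = g (T x i) + g (T y i)"
      by (simp add: linear_add[OF linear_T] linear_add[OF g])
    show "g (T (r *\<^sub>R x) i) = r *\<^sub>R g (T x i)"
      by (simp add: linear_scale[OF linear_T] scaleR_fun_def linear_scale[OF g])
    have "\<bar>g (T x i)\<bar> \<le> K * N i (T x i)" by (rule K(2)[OF T_in_W])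
    also have "\<dots> \<le> K * (C * norm x)" by (intro mult_left_mono T_component_bound K(1))
    finally show "norm (g (T x i)) \<le> norm x * (K * C)" by (simp add: mult_ac)
  qed
  then show ?thesis by (simp add: rep_def bounded_linear_Blinfun_apply)
qed

lemma norm_rep_le:
  assumes g: "linear g" and bd: "\<And>w. w \<in> W i \<Longrightarrow> \<bar>g w\<bar> \<le> N i w"
  shows "norm (rep i g) \<le> C"
proof (rule norm_blinfun_bound)
  show "norm (blinfun_apply (rep i g) x) \<le> C * norm x" for x
    using bd[OF T_in_W, of x] T_component_bound[of i x] by (simp add: rep_apply[OF g])
qed (use C_pos in simp)

text \<open>
  The closure of the direct limit of the duals of the \<open>W i\<close>.  The functionals that factor through some \<open>W i\<close> already
  form a subspace; passing to the span saves the comparison of indices.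
\<close>

definition predual :: "('v \<Rightarrow>\<^sub>L real) set" where
  "predual = closure (span {rep i g | i g. linear g})"

lemma rep_in_predual: "linear g \<Longrightarrow> rep i g \<in> predual"
  unfolding predual_def using closure_subset span_superset by fast

lemma subspace_predual: "subspace predual"
  unfolding predual_def by (rule subspace_closure) simp

lemma closed_predual: "closed predual"
  by (simp add: predual_def)

lemma rep_expansion:
  assumes g: "linear g"
  shows "rep i g = (\<Sum>b\<in>basis i. g b *\<^sub>R rep i (coord i b))"
proof (rule blinfun_eqI)
  fix x
  have "g (T x i) = (\<Sum>b\<in>basis i. coord i b (T x i) * g b)"
    using arg_cong[OF coord_expansion[OF T_in_W], of g]
    by (simp add: linear_sum[OF g] linear_scale[OF g])
  then show "blinfun_apply (rep i g) x = blinfun_apply (\<Sum>b\<in>basis i. g b *\<^sub>R rep i (coord i b)) x"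
    by (simp add: rep_apply[OF g] rep_apply[OF linear_coord] blinfun.sum_left blinfun.scaleR_left
        mult.commute)
qed

text \<open>
  Reflexivity of \<open>W i\<close> in coordinates: the point \<open>w i\<close> with \<open>\<psi> (rep i g) = g (w i)\<close> is read off from the
  coordinate functionals, and a norming functional bounds its norm.  The points \<open>w i\<close> are compatible because
  a functional on \<open>W i\<close>, pulled back along \<open>\<theta> i\<close>, represents the same element of the predual.
\<close>

lemma linear_functional_on_predual:
  assumes \<psi>: "linear_on predual \<psi>" and K: "K \<ge> 0" "\<And>f. f \<in> predual \<Longrightarrow> \<bar>\<psi> f\<bar> \<le> K * norm f"
  shows "\<exists>x. \<forall>f\<in>predual. \<psi> f = blinfun_apply f x"
proof -
  note lin = linear_onD[OF \<psi> subspace_predual]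
  define w where "w i = (\<Sum>b\<in>basis i. \<psi> (rep i (coord i b)) *\<^sub>R b)" for i
  have \<psi>_rep: "\<psi> (rep i g) = g (w i)" if g: "linear g" for i g
  proof -
    have "\<psi> (rep i g) = (\<Sum>b\<in>basis i. \<psi> (g b *\<^sub>R rep i (coord i b)))"
      unfolding rep_expansion[OF g]
      by (intro linear_on_sum[OF \<psi> subspace_predual] subspace_scale[OF subspace_predual]
          rep_in_predual linear_coord)
    also have "\<dots> = g (w i)"
      by (simp add: w_def linear_sum[OF g] linear_scale[OF g] mult.commute
          lin(2)[OF rep_in_predual[OF linear_coord]])
    finally show ?thesis .
  qed
  have "w i \<in> span (basis i)" for i
    unfolding w_def by (intro span_sum span_scale span_base)
  then have wW: "w i \<in> W i" for i by (simp only: basis(2))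
  have w_bound: "N i (w i) \<le> K * C" for i
  proof -
    obtain g where g: "linear g" "\<And>x. x \<in> W i \<Longrightarrow> \<bar>g x\<bar> \<le> N i x" "g (w i) = N i (w i)"
      using norming_functional[OF normed_W wW, of i] by blast
    have "N i (w i) = \<psi> (rep i g)" using g \<psi>_rep by simp
    also have "\<dots> \<le> K * norm (rep i g)" using K(2)[OF rep_in_predual[OF g(1)], of i] by simp
    also have "\<dots> \<le> K * C" by (intro mult_left_mono norm_rep_le g(1,2) K(1))
    finally show ?thesis .
  qed
  have w_compat: "\<theta> i (w (Suc i)) = w i" for i
  proof -
    obtain Pr where Pr: "linear Pr" "\<And>x. Pr x \<in> W (Suc i)" "\<And>x. x \<in> W (Suc i) \<Longrightarrow> Pr x = x"
      using subspace_projection[OF normed_on_subspace[OF normed_W]] by blast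
    note sW = normed_on_subspace[OF normed_W] and l\<theta> = standard_inverse_systemD(3)[OF sis]
    have "coord i b (\<theta> i (w (Suc i))) = coord i b (w i)" for b
    proof -
      \<comment> \<open>\<open>\<theta> i\<close> is linear only on \<open>W (Suc i)\<close>; the projection makes the functional linear on the type\<close>
      define g where "g u = coord i b (\<theta> i (Pr u))" for u
      have g: "linear g"
        unfolding g_def
        by (intro linearI) (simp_all add: linear_add[OF Pr(1)] linear_scale[OF Pr(1)]
            linear_on_add[OF l\<theta> sW Pr(2) Pr(2)] linear_on_scale[OF l\<theta> sW Pr(2)]
            linear_add[OF linear_coord] linear_scale[OF linear_coord])
      have "\<theta> i (T x (Suc i)) = T x i" for x
        using T_in_L[of x] by (simp add: inverse_limit_def)
      then have "rep (Suc i) g = rep i (coord i b)"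
        by (intro blinfun_eqI) (simp add: rep_apply g linear_coord g_def Pr(3)[OF T_in_W])
      then show ?thesis
        using \<psi>_rep[OF g, of "Suc i"] \<psi>_rep[of "coord i b" i, OF linear_coord]
        by (simp add: g_def Pr(3)[OF wW])
    qed
    note same = this
    have "\<theta> i (w (Suc i)) = (\<Sum>b\<in>basis i. coord i b (\<theta> i (w (Suc i))) *\<^sub>R b)"
      by (rule coord_expansion[symmetric, OF standard_inverse_systemD(4)[OF sis wW]])
    also have "\<dots> = (\<Sum>b\<in>basis i. coord i b (w i) *\<^sub>R b)" by (simp only: same)
    also have "\<dots> = w i" by (rule coord_expansion[OF wW])
    finally show ?thesis .
  qed
  have "w \<in> L"
    using wW w_compat w_bound by (auto simp: inverse_limit_def intro!: bdd_aboveI2)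
  then have "w \<in> range T" by (simp only: L_eq_U T_onto)
  then obtain x where x: "T x = w" by blast
  define h where "h f = \<psi> f - blinfun_apply f x" for f
  have h: "linear_on predual h"
    using lin(1,2) by (auto simp: linear_on_def h_def blinfun.add_left blinfun.scaleR_left algebra_simps)
  have h_bound: "\<bar>h f\<bar> \<le> (K + norm x) * norm f" if "f \<in> predual" for f
    using K(2)[OF that] norm_blinfun[of f x] by (simp add: h_def algebra_simps)
  let ?S = "span {rep i g | i g. linear g}"
  have S: "?S \<subseteq> predual" unfolding predual_def by (rule closure_subset)
  have "subspace {f \<in> predual. h f = 0}"
    using linear_onD[OF h subspace_predual] subspace_predual by (auto simp: subspace_def)
  moreover have "{rep i g | i g. linear g} \<subseteq> {f \<in> predual. h f = 0}"
    using rep_in_predual \<psi>_rep x by (auto simp: h_def rep_apply)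
  ultimately have h_span: "h f = 0" if "f \<in> ?S" for f
    using span_minimal that by blast
  have "h f = 0" if f: "f \<in> predual" for f
  proof -
    obtain s where s: "\<And>n. s n \<in> ?S" "s \<longlonglongrightarrow> f"
      using f unfolding predual_def closure_sequential by blast
    have sp: "s n \<in> predual" for n using s(1) S by blast
    have "\<bar>h f\<bar> \<le> (K + norm x) * norm (f - s n)" for n
      using h_bound[OF subspace_diff[OF subspace_predual f sp]] h_span[OF s(1)]
        linear_on_diff[OF h subspace_predual f sp] by simp
    moreover have "(\<lambda>n. (K + norm x) * norm (f - s n)) \<longlonglongrightarrow> (K + norm x) * norm (f - f)"
      by (intro tendsto_intros s(2))
    ultimately have "\<bar>h f\<bar> \<le> 0"
      by (intro LIMSEQ_le_const) auto
    then show ?thesis by simp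
  qed
  then show ?thesis by (intro exI[of _ x]) (simp add: h_def)
qed

text \<open>
  Evaluation maps the space onto the dual of the predual by \<open>linear_functional_on_predual\<close>.  It is bounded below
  because the norms of the projections to the \<open>W j\<close> are attained at elements of the predual.
\<close>

lemma isomorphic_to_dual_of_predual:
  fixes J :: "('v \<Rightarrow>\<^sub>L real) \<Rightarrow> 'z::real_vector"
  assumes J: "linear J" "inj J"
  defines "Y \<equiv> J ` predual" and "M \<equiv> \<lambda>u. norm (inv J u)"
  shows "banach_on Y M" "isomorphic_on (UNIV :: 'v set) norm (dual_space Y M) (dual_norm Y M)"
proof -
  show B: "banach_on Y M"
    unfolding Y_def M_def by (rule closed_subspace_image_banach_on[OF J subspace_predual closed_predual])
  then have M: "normed_on Y M" by (simp add: banach_on_def)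
  have inv: "inv J (J f) = f" for f using J(2) by simp
  have MJ: "M (J f) = norm f" for f by (simp add: M_def inv)
  define \<Phi> where "\<Phi> x u = (if u \<in> Y then blinfun_apply (inv J u) x else 0)" for x u
  have \<Phi>J: "\<Phi> x (J f) = blinfun_apply f x" if "f \<in> predual" for x f
    using that by (simp add: \<Phi>_def Y_def inv)
  have sY: "subspace Y" by (rule normed_on_subspace[OF M])
  have \<Phi>_bound: "\<bar>\<Phi> x u\<bar> \<le> norm x * M u" if u: "u \<in> Y" for x u
    using norm_blinfun[of "inv J u" x] u by (simp add: \<Phi>_def M_def mult.commute)
  have \<Phi>_dual: "\<Phi> x \<in> dual_space Y M" for x
  proof (rule dual_spaceI[OF _ \<Phi>_bound])
    show "linear_on Y (\<Phi> x)"
      unfolding linear_on_def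
    proof (intro conjI ballI allI)
      fix u assume "u \<in> Y"
      then obtain f where f: "u = J f" "f \<in> predual" by (auto simp: Y_def)
      show "\<Phi> x (r *\<^sub>R u) = r *\<^sub>R \<Phi> x u" for r
        using f(2) subspace_scale[OF subspace_predual f(2)]
        by (simp add: f(1) \<Phi>J blinfun.scaleR_left flip: linear_scale[OF J(1)])
      fix v assume "v \<in> Y"
      then obtain g where g: "v = J g" "g \<in> predual" by (auto simp: Y_def)
      show "\<Phi> x (u + v) = \<Phi> x u + \<Phi> x v"
        using f(2) g(2) subspace_add[OF subspace_predual f(2) g(2)]
        by (simp add: f(1) g(1) \<Phi>J blinfun.add_left flip: linear_add[OF J(1)])
    qed
    show "\<Phi> x u = 0" if "u \<notin> Y" for u using that by (simp add: \<Phi>_def)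
  qed
  have linear_\<Phi>: "linear \<Phi>"
    by (intro linearI)
      (auto simp: \<Phi>_def fun_eq_iff scaleR_fun_def blinfun.add_right blinfun.scaleR_right)
  have upper: "dual_norm Y M (\<Phi> x) \<le> 1 * norm x" for x
    using dual_norm_le[OF M \<Phi>_bound] by simp
  have lower: "(c / C) * norm x \<le> dual_norm Y M (\<Phi> x)" for x
  proof -
    have "N j (T x j) \<le> dual_norm Y M (\<Phi> x) * C" for j
    proof -
      obtain g where g: "linear g" "\<And>w. w \<in> W j \<Longrightarrow> \<bar>g w\<bar> \<le> N j w" "g (T x j) = N j (T x j)"
        using norming_functional[OF normed_W T_in_W, of j x] by blast
      note r = rep_in_predual[OF g(1), of j]
      have "N j (T x j) = \<Phi> x (J (rep j g))" by (simp add: \<Phi>J[OF r] rep_apply[OF g(1)] g(3))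
      also have "\<dots> \<le> dual_norm Y M (\<Phi> x) * M (J (rep j g))"
        using dual_spaceD(3)[OF M \<Phi>_dual, of "J (rep j g)" x] r by (simp add: Y_def)
      also have "\<dots> \<le> dual_norm Y M (\<Phi> x) * C"
        unfolding MJ by (intro mult_left_mono norm_rep_le g(1,2) dual_norm_nonneg[OF M \<Phi>_dual])
      finally show ?thesis .
    qed
    then have "limit_norm N (T x) \<le> dual_norm Y M (\<Phi> x) * C"
      by (intro LIMSEQ_le_const2[OF limit_norm_tendsto(1)[OF sis T_in_L]]) auto
    then show ?thesis
      using T_lower[of x] C_pos by (simp add: field_simps)
  qed
  have "\<exists>x. \<psi> = \<Phi> x" if \<psi>: "\<psi> \<in> dual_space Y M" for \<psi>
  proof -
    note D = dual_spaceD[OF M \<psi>]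
    have JY: "J f \<in> Y" if "f \<in> predual" for f using that by (simp add: Y_def)
    have "linear_on predual (\<lambda>f. \<psi> (J f))"
      using linear_on_add[OF D(1) sY JY JY] linear_on_scale[OF D(1) sY JY]
      by (auto simp: linear_on_def linear_add[OF J(1)] linear_scale[OF J(1)])
    moreover have "\<bar>\<psi> (J f)\<bar> \<le> dual_norm Y M \<psi> * norm f" if "f \<in> predual" for f
      using D(3)[OF JY[OF that]] by (simp add: MJ)
    ultimately obtain x where x: "\<And>f. f \<in> predual \<Longrightarrow> \<psi> (J f) = blinfun_apply f x"
      using linear_functional_on_predual dual_norm_nonneg[OF M \<psi>] by blast
    have "\<psi> u = \<Phi> x u" for u
    proof (cases "u \<in> Y")
      case True
      then show ?thesis using x \<Phi>J by (auto simp: Y_def)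
    qed (simp add: D(2) \<Phi>_def)
    then show ?thesis by blast
  qed
  then have onto: "range \<Phi> = dual_space Y M" using \<Phi>_dual by blast
  show "isomorphic_on (UNIV :: 'v set) norm (dual_space Y M) (dual_norm Y M)"
    unfolding isomorphic_on_iff[OF normed_on_UNIV normed_on_dual_space[OF M]]
    by (rule exI[of _ \<Phi>], rule exI[of _ "c / C"], rule exI[of _ 1])
      (use onto linear_imp_linear_on[OF linear_\<Phi>] lower upper c_pos C_pos in auto)
qed

lemma dense_sequence: "\<exists>d :: nat \<Rightarrow> 'v. \<forall>x. \<forall>\<epsilon>>0. \<exists>n. norm (x - d n) < \<epsilon>"
proof -
  obtain D where D: "countable D" "D \<subseteq> U"
    "\<And>v \<epsilon>. v \<in> U \<Longrightarrow> \<epsilon> > 0 \<Longrightarrow> \<exists>u\<in>D. limit_norm N (u - v) < \<epsilon>"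
    using countable_dense_subset by blast
  have "D \<noteq> {}" using D(3)[OF subspace_0[OF subspace_U], of 1] by auto
  define d where "d n = inv T (from_nat_into D n)" for n
  have Td: "T (d n) = from_nat_into D n" for n
    using from_nat_into[OF \<open>D \<noteq> {}\<close>, of n] D(2) T_onto
    by (auto simp: d_def intro!: f_inv_into_f)
  have "\<exists>n. norm (x - d n) < \<epsilon>" if \<epsilon>: "\<epsilon> > 0" for x \<epsilon>
  proof -
    obtain u where u: "u \<in> D" "limit_norm N (u - T x) < c * \<epsilon>"
      using D(3)[of "T x" "c * \<epsilon>", OF rangeI[of T x, unfolded T_onto]] \<epsilon> c_pos by auto
    obtain n where n: "from_nat_into D n = u" using from_nat_into_surj[OF D(1) u(1)] by blast
    have "c * norm (d n - x) \<le> limit_norm N (T (d n - x))" by (rule T_lower)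
    also have "\<dots> < c * \<epsilon>" using u(2) by (simp add: linear_diff[OF linear_T] Td n)
    finally show ?thesis using c_pos by (auto simp: norm_minus_commute)
  qed
  then show ?thesis by blast
qed

end

lemma GFDA_imp_separable_dual:
  assumes cont: "has_continuum_dimension TYPE('u::real_vector)"
    and adm: "admits_GFDA TYPE('u) (UNIV :: 'v::banach set) norm"
  shows "isomorphic_to_separable_dual TYPE('u) (UNIV :: 'v set) norm"
proof -
  obtain W :: "nat \<Rightarrow> 'u set" and N \<theta> U where G: "GFDA W N \<theta> U"
    and iso: "isomorphic_on (UNIV :: 'v set) norm U (limit_norm N)"
    using adm by (auto simp: admits_GFDA_def)
  interpret gfda W N \<theta> U by unfold_locales (rule G)
  obtain T c C where T: "linear_on (UNIV :: 'v set) T" "range T = U" "c > 0" "C > 0"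
    "\<And>x. c * norm x \<le> limit_norm N (T x) \<and> limit_norm N (T x) \<le> C * norm x"
    using iso unfolding isomorphic_on_iff[OF normed_on_UNIV normed_U] by auto
  interpret gfda_isomorphism W N \<theta> U T c C
    using T by (intro gfda_isomorphism.intro gfda_axioms gfda_isomorphism_axioms.intro)
      (simp_all only: linear_on_UNIV)
  obtain d :: "nat \<Rightarrow> 'v" where d: "\<And>x \<epsilon>. \<epsilon> > 0 \<Longrightarrow> \<exists>n. norm (x - d n) < \<epsilon>"
    using dense_sequence by blast
  obtain J :: "('v \<Rightarrow>\<^sub>L real) \<Rightarrow> 'u" where J: "linear J" "inj J"
    using linear_embedding[OF cont blinfun_lepoll_real[OF d]] by blast
  let ?Y = "J ` predual" and ?M = "\<lambda>u. norm (inv J u)"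
  note P = isomorphic_to_dual_of_predual[OF J]
  have "closure (range d) = UNIV"
    by (rule dense_imp_closure_range[OF d])
  then have "separable_space (euclidean :: 'v topology)"
    unfolding separable_space_def by (intro exI[of _ "range d"]) simp
  moreover have "(euclidean :: 'v topology) homeomorphic_space
      norm_topology (dual_space ?Y ?M) (dual_norm ?Y ?M)"
    using P(2) unfolding isomorphic_on_def norm_topology_UNIV homeomorphic_space by blast
  ultimately have "separable_space (norm_topology (dual_space ?Y ?M) (dual_norm ?Y ?M))"
    using homeomorphic_separable_space by blast
  then show ?thesis
    unfolding isomorphic_to_separable_dual_def using P by blast
qed

theorem mainTheorem2:
  assumes "has_continuum_dimension TYPE('u::real_vector)"
  shows "admits_GFDA TYPE('u) (UNIV :: 'v::banach set) norm \<longleftrightarrow>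
         isomorphic_to_separable_dual TYPE('u) (UNIV :: 'v set) norm"
  using GFDA_imp_separable_dual[OF assms] separable_dual_imp_GFDA[OF assms] by blast

end
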